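(* Let $A>1$ be a real number and let $J\ge 0$ be an integer. We have $$ D_k(y)=\prod_{p\le k}\bigg(1-\frac{1}{p}\bigg)^{-2k}\exp\bigg(\frac{2k}{\log k}\bigg\{\sum_{j=0}^J \frac{C_j}{(\log k)^j}+ O_{A,J}\bigg(\frac1{(\log k)^{J+1}}+\frac{k}{y}\bigg)\bigg\}\bigg) $$ uniformly for integers $k\ge 2$ and real $y$ with $2k\le y\le k^A$, where the product is over primes $p$ and the implied constant depends on $A$ and $J$ only.
   Context: For a positive integer $k$, $d_k(n)$ is defined by $\zeta(s)^k=\sum_{n\ge1}d_k(n)n^{-s}$ for $\mathrm{Re}\,s>1$, where $\zeta$ is the Riemann zeta function. $S(y)$ denotes the set of $y$-friable positive integers, i.e. those all of whose prime factors are $\le y$ (with $1\in S(y)$), and $$D_k(y):=\sum_{n\in S(y)}\frac{d_k(n)^2}{n^2}.$$ The constants $C_j$ ($j\ge 0$) are $$C_j:=\int_0^2\Big(\log\frac t2\Big)^j\frac{\log I_0(t)}{t^2}\,dt+\int_2^\infty\Big(\log\frac t2\Big)^j\frac{\log I_0(t)-t}{t^2}\,dt,$$ where $I_0(t):=\sum_{n=0}^\infty \frac{(t/2)^{2n}}{(n!)^2}$. *)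

theory Defs
  imports "HOL-Analysis.Analysis" "HOL-Computational_Algebra.Primes"
begin

(* Only meaningful (and only used) in the half-plane Re s > 1. *)
definition zeta :: "complex \<Rightarrow> complex" where
  "zeta s = (\<Sum>\<^sub>\<infinity>n\<in>{1..}. of_nat n powr (-s))"

(* d is the sequence of coefficients, indexed by n \<ge> 1, of the Dirichlet series of zeta(s)^k.
   The value at the unused index 0 is fixed to be 0, so that d is unique. *)
definition is_divisor_coeffs :: "nat \<Rightarrow> (nat \<Rightarrow> real) \<Rightarrow> bool" where
  "is_divisor_coeffs k d \<longleftrightarrow> d 0 = 0 \<and>
     (\<forall>s. Re s > 1 \<longrightarrow>
        ((\<lambda>n. of_real (d n) * of_nat n powr (-s)) has_sum zeta s ^ k) {1..})"

(* Existence and uniqueness: is_divisor_coeffs_divisor_coeff and is_divisor_coeffs_unique below. *)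
definition divisor_coeff :: "nat \<Rightarrow> nat \<Rightarrow> real" where
  "divisor_coeff k = (THE f. is_divisor_coeffs k f)"

definition friable :: "real \<Rightarrow> nat set" where
  "friable y = {n. n > 0 \<and> (\<forall>p. prime p \<and> p dvd n \<longrightarrow> real p \<le> y)}"

definition D_friable :: "nat \<Rightarrow> real \<Rightarrow> real" where
  "D_friable k y = (\<Sum>\<^sub>\<infinity>n\<in>friable y. (divisor_coeff k n)\<^sup>2 / (real n)\<^sup>2)"

definition bessel_I0 :: "real \<Rightarrow> real" where
  "bessel_I0 t = (\<Sum>n. (t / 2) ^ (2 * n) / (fact n)\<^sup>2)"

definition C_coeff :: "nat \<Rightarrow> real" where
  "C_coeff j = (LINT t:{0<..2}|lborel. ln (t / 2) ^ j * ln (bessel_I0 t) / t\<^sup>2)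
       + (LINT t:{2<..}|lborel. ln (t / 2) ^ j * (ln (bessel_I0 t) - t) / t\<^sup>2)"


subsection \<open>The coefficients of the Dirichlet series are well defined\<close>

lemma zeta_has_sum:
  assumes "Re s > 1"
  shows "((\<lambda>n. of_nat n powr (-s)) has_sum zeta s) {1..}"
proof -
  have "summable (\<lambda>n. norm (of_nat n powr (-s) :: complex))"
    using summable_real_powr_iff[of "- Re s"] assms by (simp add: norm_powr_real_powr)
  hence "(\<lambda>n. of_nat n powr (-s) :: complex) summable_on UNIV"
    by (rule norm_summable_imp_summable_on)
  hence "(\<lambda>n. of_nat n powr (-s) :: complex) summable_on {1..}"
    by (rule summable_on_subset_banach) auto
  thus ?thesis unfolding zeta_def by (rule has_sum_infsum)
qed

fun div_count :: "nat \<Rightarrow> nat \<Rightarrow> real" where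
  "div_count 0 n = (if n = 1 then 1 else 0)"
| "div_count (Suc k) n = (if n = 0 then 0 else (\<Sum>m | m dvd n. div_count k m))"

lemma has_sum_times_complex:
  fixes f :: "'a \<Rightarrow> complex" and g :: "'b \<Rightarrow> complex"
  assumes f: "(f has_sum a) A" and g: "(g has_sum b) B"
  shows "((\<lambda>(x, y). f x * g y) has_sum (a * b)) (A \<times> B)"
proof (rule has_sum_SigmaI)
  show "((\<lambda>y. case (x, y) of (x, y) \<Rightarrow> f x * g y) has_sum (f x * b)) B" for x
    using has_sum_cmult_right[OF g, of "f x"] by simp
  show "((\<lambda>x. f x * b) has_sum a * b) A"
    by (rule has_sum_cmult_left[OF f])
  have fa: "(\<lambda>x. norm (f x)) summable_on A" and ga: "(\<lambda>y. norm (g y)) summable_on B"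
    using f g by (auto simp flip: summable_on_iff_abs_summable_on_complex simp: summable_on_def)
  have "(\<lambda>z. norm (case z of (x, y) \<Rightarrow> f x * g y)) summable_on A \<times> B"
  proof (subst Infinite_Sum.abs_summable_on_Sigma_iff, intro conjI ballI)
    fix x
    show "(\<lambda>y. norm (case (x, y) of (x, y) \<Rightarrow> f x * g y)) summable_on B"
      using ga by (simp add: norm_mult summable_on_cmult_right)
  next
    have "(\<lambda>x. norm (f x) * infsum (\<lambda>y. norm (g y)) B) summable_on A"
      by (rule summable_on_cmult_left[OF fa])
    thus "(\<lambda>x. norm (infsum (\<lambda>y. norm (case (x, y) of (x, y) \<Rightarrow> f x * g y)) B)) summable_on A"
      using ga by (simp add: norm_mult infsum_cmult_right' infsum_nonneg)
  qed
  thus "(\<lambda>(x, y). f x * g y) summable_on A \<times> B"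
    by (rule abs_summable_summable)
qed

lemma div_count_has_sum:
  assumes s: "Re s > 1"
  shows "((\<lambda>n. of_real (div_count k n) * of_nat n powr (-s)) has_sum zeta s ^ k) {1..}"
proof (induction k)
  case 0
  have "((\<lambda>n. of_real (div_count 0 n) * of_nat n powr (-s)) has_sum
          (\<Sum>n\<in>{1}. of_real (div_count 0 n) * of_nat n powr (-s))) {1::nat}"
    by (rule has_sum_finite) auto
  also have "?this \<longleftrightarrow> ?case"
    by (rule has_sum_cong_neutral[THEN trans]) auto
  finally show ?case .
next
  case (Suc k)
  let ?F = "\<lambda>(m, n). of_real (div_count k m) * of_nat m powr (-s) * (of_nat n powr (-s) :: complex)"
  let ?G = "\<lambda>(N, m). of_real (div_count k m) * (of_nat N powr (-s) :: complex)"
  have "(?F has_sum (zeta s ^ k * zeta s)) ({1..} \<times> {1..})"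
    using has_sum_times_complex[OF Suc zeta_has_sum[OF s]] .
  also have "(?F has_sum (zeta s ^ k * zeta s)) ({1..} \<times> {1..}) \<longleftrightarrow>
      (?G has_sum (zeta s ^ k * zeta s)) (Sigma {1..} (\<lambda>N. {m. m dvd N}))"
    by (rule has_sum_reindex_bij_witness[where i = "\<lambda>(N, m). (m, N div m)" and j = "\<lambda>(m, n). (m * n, m)"])
       (auto simp: powr_times_real Suc_le_eq intro: Nat.gr0I)
  finally have G: "(?G has_sum (zeta s ^ k * zeta s)) (Sigma {1..} (\<lambda>N. {m. m dvd N}))" .
  have "((\<lambda>N. \<Sum>m | m dvd N. ?G (N, m)) has_sum (zeta s ^ k * zeta s)) {1..}"
    by (rule has_sum_SigmaD[OF G]) (auto intro!: has_sum_finite)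
  also have "?this \<longleftrightarrow>
      ((\<lambda>n. of_real (div_count (Suc k) n) * of_nat n powr (-s)) has_sum (zeta s ^ k * zeta s)) {1..}"
    by (intro has_sum_cong) (auto simp: sum_distrib_right)
  finally show ?case by (simp add: mult.commute)
qed

lemma is_divisor_coeffs_div_count: "is_divisor_coeffs k (\<lambda>n. if n = 0 then 0 else div_count k n)"
proof -
  have "((\<lambda>n. of_real (if n = 0 then 0 else div_count k n) * of_nat n powr (-s)) has_sum zeta s ^ k) {1..}"
    if "Re s > 1" for s
    using div_count_has_sum[OF that, of k]
    by (rule has_sum_cong[THEN iffD1, rotated]) auto
  thus ?thesis by (simp add: is_divisor_coeffs_def)
qed

lemma Dirichlet_series_zero_imp_zero:
  fixes c :: "nat \<Rightarrow> real"
  assumes sums: "\<And>x::real. x > 1 \<Longrightarrow> ((\<lambda>n. c n * real n powr (-x)) has_sum 0) {1..}"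
  assumes "N \<ge> 1"
  shows "c N = 0"
  using \<open>N \<ge> 1\<close>
proof (induction N rule: less_induct)
  case (less N)
  have N: "real N > 0" using less.prems by simp
  define q where "q = real N / real (Suc N)"
  have q: "0 < q" "q < 1" using N by (auto simp: q_def)
  define S where "S = infsum (\<lambda>n. norm (c n * real n powr (-2))) {N<..}"
  have S: "((\<lambda>n. norm (c n * real n powr (-2))) has_sum S) {N<..}"
  proof -
    have "(\<lambda>n. c n * real n powr (-2)) summable_on {1..}"
      using sums[of 2] by (auto simp: summable_on_def)
    hence "(\<lambda>n. c n * real n powr (-2)) summable_on {N<..}"
      by (rule summable_on_subset_banach) auto
    hence "(\<lambda>n. norm (c n * real n powr (-2))) summable_on {N<..}"
      by (rule iffD1[OF summable_on_iff_abs_summable_on_real])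
    thus ?thesis unfolding S_def by (rule has_sum_infsum)
  qed
  have bound: "\<bar>c N\<bar> \<le> real N powr 2 * S * q ^ j" for j :: nat
  proof -
    define x where "x = 2 + real j"
    have "((\<lambda>n. c n * real n powr (-x)) has_sum 0) {1..}"
      by (rule sums) (simp add: x_def)
    also have "?this \<longleftrightarrow> ((\<lambda>n. c n * real n powr (-x)) has_sum 0) {N..}"
      using less by (intro has_sum_cong_neutral) auto
    finally have "((\<lambda>n. c n * real n powr (-x)) has_sum (0 - c N * real N powr (-x))) ({N..} - {N})"
      by (intro has_sum_Diff) (use has_sum_finite[of "{N}" "\<lambda>n. c n * real n powr (-x)"] in auto)
    moreover have "{N..} - {N} = {N<..}" by auto
    ultimately have hs: "((\<lambda>n. c n * real n powr (-x)) has_sum (- (c N * real N powr (-x)))) {N<..}"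
      by simp
    have "norm (- (c N * real N powr (-x))) \<le> real (Suc N) powr (- real j) * S"
    proof (rule norm_infsum_le)
      show "((\<lambda>n. real (Suc N) powr (- real j) * norm (c n * real n powr (-2))) has_sum
              (real (Suc N) powr (- real j) * S)) {N<..}"
        by (rule has_sum_cmult_right[OF S])
      show "norm (c n * real n powr (-x)) \<le> real (Suc N) powr (- real j) * norm (c n * real n powr (-2))"
        if "n \<in> {N<..}" for n
      proof -
        have "real n powr (-x) = real n powr (- real j) * real n powr (-2)"
          by (simp add: x_def algebra_simps flip: powr_add)
        also have "\<dots> \<le> real (Suc N) powr (- real j) * real n powr (-2)"
          using that by (intro mult_right_mono powr_mono2') auto
        finally have "\<bar>c n\<bar> * real n powr (-x) \<le>
            \<bar>c n\<bar> * (real (Suc N) powr (- real j) * real n powr (-2))"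
          by (rule mult_left_mono) auto
        thus ?thesis by (simp add: abs_mult mult_ac)
      qed
    qed (use hs in simp_all)
    hence "real N powr x * (\<bar>c N\<bar> * real N powr (-x)) \<le>
        real N powr x * (real (Suc N) powr (- real j) * S)"
      by (intro mult_left_mono) (simp_all add: abs_mult)
    also have "real N powr x * (\<bar>c N\<bar> * real N powr (-x)) = \<bar>c N\<bar>"
      using N by (simp add: powr_minus field_simps)
    also have "real N powr x * (real (Suc N) powr (- real j) * S) = real N powr 2 * S * q ^ j"
    proof -
      have "real N powr x = real N powr 2 * real N ^ j"
        using N by (simp add: x_def powr_add powr_realpow)
      moreover have "real (Suc N) powr (- real j) = 1 / real (Suc N) ^ j"
        by (simp add: powr_minus powr_realpow divide_inverse del: of_nat_Suc)
      ultimately show ?thesis by (simp add: q_def power_divide)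
    qed
    finally show ?thesis .
  qed
  have "(\<lambda>j. real N powr 2 * S * q ^ j) \<longlonglongrightarrow> real N powr 2 * S * 0"
    using q by (intro tendsto_intros LIMSEQ_power_zero) auto
  hence "\<bar>c N\<bar> \<le> real N powr 2 * S * 0"
    by (rule LIMSEQ_le_const) (use bound in blast)
  thus ?case by simp
qed

lemma is_divisor_coeffs_unique:
  assumes f: "is_divisor_coeffs k f" and g: "is_divisor_coeffs k g"
  shows "f = g"
proof
  fix n
  have "((\<lambda>n. (f n - g n) * real n powr (-x)) has_sum 0) {1..}" if "x > 1" for x
  proof -
    have "((\<lambda>n. of_real (f n) * of_nat n powr (- of_real x) + - (of_real (g n) * of_nat n powr (- of_real x)))
            has_sum (zeta (of_real x) ^ k + - (zeta (of_real x) ^ k))) {1..}"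
      using f g that by (intro has_sum_add has_sum_uminusI) (auto simp: is_divisor_coeffs_def)
    moreover have "of_real (f n) * of_nat n powr (- of_real x) + - (of_real (g n) * of_nat n powr (- of_real x))
        = complex_of_real ((f n - g n) * real n powr (-x))" for n
      using powr_of_real[of "real n" "-x"] by (simp add: algebra_simps)
    ultimately have "((\<lambda>n. complex_of_real ((f n - g n) * real n powr (-x))) has_sum of_real 0) {1..}"
      by simp
    thus ?thesis by (simp only: has_sum_of_real_iff)
  qed
  hence "f n - g n = 0" if "n \<ge> 1"
    using Dirichlet_series_zero_imp_zero[of "\<lambda>n. f n - g n" n] that by blast
  thus "f n = g n"
    using f g by (cases "n = 0") (auto simp: is_divisor_coeffs_def)
qed

lemma is_divisor_coeffs_divisor_coeff: "is_divisor_coeffs k (divisor_coeff k)"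
  unfolding divisor_coeff_def
  by (rule theI[where P = "is_divisor_coeffs k", OF is_divisor_coeffs_div_count]) (rule is_divisor_coeffs_unique[OF _ is_divisor_coeffs_div_count])

end

theory Submission
  imports Defs "HOL-Complex_Analysis.Complex_Analysis" "HOL-Number_Theory.Prime_Powers"
    "HOL-Probability.Characteristic_Functions"
begin

text \<open>
By multiplicativity, \<open>D_k(y)\<close> is the product over \<open>p \<le> y\<close> of the local factors
\<open>f(1/p)\<close>, where \<open>f(x) = \<Sum>_a (binomial(k+a-1, a) x^a)^2\<close>. Since
\<open>(1-x)^{-k} = e^{kx} (e^{-x}/(1-x))^k\<close> and all power series here have nonnegative coefficients, the
Cauchy--Schwarz inequality compares \<open>f(x)\<close> with \<open>I_0(2kx)\<close> up to a factor \<open>exp(O(k x^2))\<close>, which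
suffices for \<open>p > \<surd>k\<close>; for \<open>p \<le> \<surd>k\<close> the trivial bound
\<open>log f(1/p) + 2k log(1-1/p) = O(log k)\<close> is enough. It remains to evaluate a sum over primes of a
Lipschitz function of \<open>2k/p\<close>. Partial summation turns it into an integral against \<open>du / log u\<close>, and
with \<open>u = 2k/t\<close> the geometric expansion of \<open>1 / (log k - log(t/2))\<close> in powers of \<open>1 / log k\<close> produces the
constants \<open>C_j\<close>.

The partial summation needs \<open>\<pi>(x) = \<Sum>_{2 \<le> n \<le> x} 1/log n + O(x / (log x)^q)\<close> for every \<open>q\<close>. For
this, all derivatives of \<open>-\<zeta>'/\<zeta> - \<zeta>\<close> are bounded polynomially, with an exponent independent of the
order of the derivative, uniformly in \<open>Re s > 1\<close> (only \<open>|\<zeta>|^{\<plusminus>1} = O(|t|^\<epsilon>)\<close> near the line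
\<open>Re s = 1\<close> is needed, and that follows from the inequality \<open>3 + 4 cos \<theta> + cos 2\<theta> \<ge> 0\<close>). The
\<open>k\<close>-th derivative carries the weights \<open>(log n)^k\<close>, so a Perron formula with a Gaussian cutoff on the
absolutely convergent side gains arbitrarily many logarithms without any contour shift.
\<close>

subsection \<open>Dirichlet series and the logarithm of zeta\<close>

text \<open>A prime p enters through t = 2k/p. Removing (1 - 1/p)^(-2k) for p <= k subtracts t up to
  O(k/p^2), so the split of the primes at k is the split of the C_j at t = 2. The absence of primes
  p > y truncates the integrals near t = 2k/y; as log I_0(t) = O(t^2), the loss is O(k/y) times
  powers of log k, and these are cancelled by the denominators because y <= k^A. The cut at sqrt k
  must be a power of k: log(t/2) then stays below (log k)/2, which controls the geometric remainder.
  On the prime side the obstacle is to win every power of the logarithm from polynomial bounds in Re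
  s > 1 alone. Since k derivatives cost a fixed power of the height, smoothing on scale \<delta>
  costs \<delta>^(-3) whatever k is, against the gain (log x)^k; \<delta> = (log x)^(-q) with k = 4q
  - 1 is the right balance. Subtracting zeta from -zeta'/zeta cancels the pole at s = 1, so no main
  term has to be extracted and the comparison with the sum of 1/log n comes out directly.\<close>

text \<open>The term \<open>n = 0\<close> vanishes because \<open>0 powr z = 0\<close>.\<close>

definition dirichlet :: "(nat \<Rightarrow> real) \<Rightarrow> complex \<Rightarrow> complex" where
  "dirichlet f s = (\<Sum>n. of_real (f n) * of_nat n powr (-s))"

definition dirichlet_abs :: "(nat \<Rightarrow> real) \<Rightarrow> bool" where
  "dirichlet_abs f \<longleftrightarrow> (\<forall>x>1. summable (\<lambda>n. \<bar>f n\<bar> * real n powr (-x)))"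

lemma norm_of_nat_powr: "norm (of_nat n powr s :: complex) = real n powr Re s"
  by (simp add: norm_powr_real_powr)

lemma dirichlet_abs_summable_norm:
  assumes "dirichlet_abs f" "Re s > 1"
  shows "summable (\<lambda>n. norm (of_real (f n) * of_nat n powr (-s) :: complex))"
  using assms by (simp add: dirichlet_abs_def norm_mult norm_of_nat_powr)

lemma dirichlet_abs_has_sum:
  assumes "dirichlet_abs f" "Re s > 1"
  shows "((\<lambda>n. of_real (f n) * of_nat n powr (-s)) has_sum dirichlet f s) {1..}"
proof -
  have "((\<lambda>n. of_real (f n) * of_nat n powr (-s)) has_sum dirichlet f s) UNIV"
    unfolding dirichlet_def
    by (intro norm_summable_imp_has_sum dirichlet_abs_summable_norm summable_sums summable_norm_cancel assms)
  also have "?this \<longleftrightarrow> ?thesis"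
    by (intro has_sum_cong_neutral) (auto simp: not_le)
  finally show ?thesis .
qed

lemma dirichlet_abs_mono:
  assumes "dirichlet_abs g" "\<And>n. n \<ge> 1 \<Longrightarrow> \<bar>f n\<bar> \<le> C * \<bar>g n\<bar>"
  shows "dirichlet_abs f"
  unfolding dirichlet_abs_def
proof (intro allI impI)
  fix x :: real assume "x > 1"
  then have "summable (\<lambda>n. C * (\<bar>g n\<bar> * real n powr (-x)))"
    using assms by (intro summable_mult) (auto simp: dirichlet_abs_def)
  moreover have "norm (\<bar>f n\<bar> * real n powr (-x)) \<le> C * (\<bar>g n\<bar> * real n powr (-x))" for n
  proof (cases "n = 0")
    case False
    then show ?thesis
      using mult_right_mono[OF assms(2)[of n], of "real n powr (-x)"] by (simp add: mult_ac)
  qed auto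
  ultimately show "summable (\<lambda>n. \<bar>f n\<bar> * real n powr (-x))"
    by (intro summable_comparison_test'[where N = 0 and f = "\<lambda>n. \<bar>f n\<bar> * real n powr (-x)"])
qed

lemma dirichlet_abs_const: "dirichlet_abs (\<lambda>_. c)"
  unfolding dirichlet_abs_def by (auto intro!: summable_mult simp: summable_real_powr_iff)

lemma dirichlet_abs_add: "dirichlet_abs f \<Longrightarrow> dirichlet_abs g \<Longrightarrow> dirichlet_abs (\<lambda>n. f n + g n)"
  unfolding dirichlet_abs_def
proof (intro allI impI)
  fix x :: real
  assume "\<forall>x>1. summable (\<lambda>n. \<bar>f n\<bar> * real n powr (-x))" "\<forall>x>1. summable (\<lambda>n. \<bar>g n\<bar> * real n powr (-x))" "x > 1"
  then have "summable (\<lambda>n. \<bar>f n\<bar> * real n powr (-x) + \<bar>g n\<bar> * real n powr (-x))"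
    by (intro summable_add) auto
  then show "summable (\<lambda>n. \<bar>f n + g n\<bar> * real n powr (-x))"
    by (rule summable_comparison_test') 
       (simp add: abs_mult ring_distribs(2)[symmetric] mult_right_mono)
qed

lemma dirichlet_abs_uminus: "dirichlet_abs f \<Longrightarrow> dirichlet_abs (\<lambda>n. - f n)"
  by (simp add: dirichlet_abs_def)

lemma dirichlet_abs_diff: "dirichlet_abs f \<Longrightarrow> dirichlet_abs g \<Longrightarrow> dirichlet_abs (\<lambda>n. f n - g n)"
  using dirichlet_abs_add[of f "\<lambda>n. - g n"] dirichlet_abs_uminus[of g] by simp

lemma dirichlet_abs_ln:
  assumes "dirichlet_abs f" shows "dirichlet_abs (\<lambda>n. f n * ln (real n))"
  unfolding dirichlet_abs_def
proof (intro allI impI)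
  fix x :: real assume x: "x > 1"
  \<comment> \<open>Half of the distance from \<open>x\<close> to 1 is spent on the logarithm; since
    \<open>dirichlet_abs\<close> covers every abscissa beyond 1, summability is still available at
    \<open>x - e\<close>.\<close>
  define e where "e = (x - 1) / 2"
  have e: "e > 0" "x - e > 1" using x by (auto simp: e_def field_simps)
  have "summable (\<lambda>n. (1 / e) * (\<bar>f n\<bar> * real n powr (-(x - e))))"
    using assms e by (intro summable_mult) (auto simp: dirichlet_abs_def)
  moreover have "norm (\<bar>f n * ln (real n)\<bar> * real n powr (-x)) \<le> (1 / e) * (\<bar>f n\<bar> * real n powr (-(x - e)))" for n
  proof (cases "n = 0")
    case False
    then have "\<bar>ln (real n)\<bar> \<le> real n powr e / e"
      using ln_powr_bound[of "real n" e] e by simp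
    then have "\<bar>ln (real n)\<bar> * real n powr (-x) \<le> real n powr e / e * real n powr (-x)"
      by (intro mult_right_mono) auto
    also have "\<dots> = real n powr (-(x - e)) / e" by (simp add: powr_add[symmetric])
    finally have "\<bar>f n\<bar> * (\<bar>ln (real n)\<bar> * real n powr (-x)) \<le> \<bar>f n\<bar> * (real n powr (-(x - e)) / e)"
      by (intro mult_left_mono) auto
    then show ?thesis by (simp add: abs_mult mult_ac)
  qed auto
  ultimately show "summable (\<lambda>n. \<bar>f n * ln (real n)\<bar> * real n powr (-x))"
    by (intro summable_comparison_test'[where N = 0 and f = "\<lambda>n. \<bar>f n * ln (real n)\<bar> * real n powr (-x)"])
qed

lemma dirichlet_abs_ln_pow:
  assumes "dirichlet_abs f" shows "dirichlet_abs (\<lambda>n. f n * ln (real n) ^ k)"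
  by (induction k) (use assms in \<open>auto dest: dirichlet_abs_ln simp: mult_ac\<close>)

lemma dirichlet_abs_mangoldt: "dirichlet_abs (\<lambda>n. mangoldt n)"
  using dirichlet_abs_ln[OF dirichlet_abs_const[of 1]]
  by (rule dirichlet_abs_mono[where C = 1]) (use mangoldt_le in auto)

lemma dirichlet_add:
  assumes "dirichlet_abs f" "dirichlet_abs g" "Re s > 1"
  shows "dirichlet (\<lambda>n. f n + g n) s = dirichlet f s + dirichlet g s"
  using suminf_add[OF summable_norm_cancel[OF dirichlet_abs_summable_norm[OF assms(1,3)]]
      summable_norm_cancel[OF dirichlet_abs_summable_norm[OF assms(2,3)]]]
  by (simp add: dirichlet_def algebra_simps)

lemma dirichlet_uminus:
  assumes "dirichlet_abs f" "Re s > 1"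
  shows "dirichlet (\<lambda>n. - f n) s = - dirichlet f s"
  using suminf_minus[OF summable_norm_cancel[OF dirichlet_abs_summable_norm[OF assms]]]
  by (simp add: dirichlet_def)

lemma dirichlet_diff:
  assumes "dirichlet_abs f" "dirichlet_abs g" "Re s > 1"
  shows "dirichlet (\<lambda>n. f n - g n) s = dirichlet f s - dirichlet g s"
  using dirichlet_add[OF assms(1) dirichlet_abs_uminus[OF assms(2)] assms(3)] dirichlet_uminus[OF assms(2,3)] by simp

lemma DERIV_of_nat_powr:
  assumes "n > 0"
  shows "((\<lambda>z. of_nat n powr (-z) :: complex) has_field_derivative - (of_real (ln (real n)) * of_nat n powr (-z))) (at z within S)"
proof -
  have "((\<lambda>z. exp (- z * of_real (ln (real n))) :: complex) has_field_derivative
      - (of_real (ln (real n)) * exp (- z * of_real (ln (real n))))) (at z within S)"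
    by (auto intro!: derivative_eq_intros)
  then show ?thesis using assms by (simp add: powr_def Ln_of_nat)
qed

lemma DERIV_dirichlet:
  assumes f: "dirichlet_abs f" and s: "Re s > 1"
  shows "(dirichlet f has_field_derivative - dirichlet (\<lambda>n. f n * ln (real n)) s) (at s)"
proof -
  define x where "x = (1 + Re s) / 2"
  have x: "1 < x" "x < Re s" using s by (auto simp: x_def)
  define S where "S = {z. Re z \<ge> x}"
  have "((\<lambda>z. \<Sum>n. of_real (f n) * of_nat n powr (-z)) has_field_derivative
      (\<Sum>n. - (of_real (f n * ln (real n)) * of_nat n powr (-s)))) (at s)"
  proof (rule has_field_derivative_series'[where S = S])
    show "convex S" unfolding S_def by (rule convex_halfspace_Re_ge)
    show "((\<lambda>z. of_real (f n) * of_nat n powr (-z)) has_field_derivative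
            - (of_real (f n * ln (real n)) * of_nat n powr (-z))) (at z within S)" for n z
      using DERIV_cmult[OF DERIV_of_nat_powr[of n z S], of "of_real (f n)"] by (cases "n = 0") (auto simp: mult_ac)
    show "uniformly_convergent_on S (\<lambda>n z. \<Sum>i<n. - (of_real (f i * ln (real i)) * of_nat i powr (-z) :: complex))"
    proof (rule Weierstrass_m_test')
      show "summable (\<lambda>n. \<bar>f n * ln (real n)\<bar> * real n powr (-x))"
        using dirichlet_abs_ln[OF f] x by (auto simp: dirichlet_abs_def)
      show "norm (- (of_real (f n * ln (real n)) * of_nat n powr (-z) :: complex)) \<le> \<bar>f n * ln (real n)\<bar> * real n powr (-x)"
        if "z \<in> S" for n z
        using that by (cases "n = 0") (auto simp: S_def norm_mult norm_of_nat_powr abs_mult intro!: mult_left_mono powr_mono)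
    qed
    show "s \<in> S" using x by (simp add: S_def)
    show "summable (\<lambda>n. of_real (f n) * of_nat n powr (-s) :: complex)"
      by (rule summable_norm_cancel[OF dirichlet_abs_summable_norm[OF f s]])
    have "open {z. Re z > x}" by (rule open_halfspace_Re_gt)
    then show "s \<in> interior S"
      using x by (intro interiorI[of "{z. Re z > x}"]) (auto simp: S_def)
  qed
  also have "(\<Sum>n. - (of_real (f n * ln (real n)) * of_nat n powr (-s))) = - dirichlet (\<lambda>n. f n * ln (real n)) s"
    unfolding dirichlet_def
    by (intro suminf_minus summable_norm_cancel[OF dirichlet_abs_summable_norm] dirichlet_abs_ln f s)
  finally show ?thesis by (simp add: dirichlet_def[abs_def])
qed

lemma higher_deriv_dirichlet:
  assumes f: "dirichlet_abs f" and s: "Re s > 1"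
  shows "(deriv ^^ k) (dirichlet f) s = (-1) ^ k * dirichlet (\<lambda>n. f n * ln (real n) ^ k) s"
  using s
proof (induction k arbitrary: s)
  case (Suc k)
  have "((\<lambda>s. (-1) ^ k * dirichlet (\<lambda>n. f n * ln (real n) ^ k) s) has_field_derivative
      (-1) ^ k * (- dirichlet (\<lambda>n. f n * ln (real n) ^ k * ln (real n)) s)) (at s)"
    by (intro DERIV_cmult DERIV_dirichlet dirichlet_abs_ln_pow f Suc.prems)
  then have "((deriv ^^ k) (dirichlet f) has_field_derivative
      (-1) ^ k * (- dirichlet (\<lambda>n. f n * ln (real n) ^ k * ln (real n)) s)) (at s)"
    by (rule has_field_derivative_transform_within_open[where S = "{z. Re z > 1}"])
       (use Suc in \<open>auto simp: open_halfspace_Re_gt\<close>)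
  then show ?case by (simp add: DERIV_imp_deriv mult_ac)
qed auto

text \<open>Serves to fix the constant of integration in \<open>dirichlet_one_eq_exp\<close>: along
  the integers only the term n = 1 survives, by Tannery's theorem with the terms at abscissa 2 as
  majorant.\<close>

lemma tendsto_dirichlet:
  assumes f: "dirichlet_abs f"
  shows "(\<lambda>m. dirichlet f (of_nat m)) \<longlonglongrightarrow> of_real (f 1)"
proof -
  define b where "b = (\<lambda>n::nat. if n = 1 then of_real (f 1) else 0 :: complex)"
  have lim: "(\<lambda>m. of_real (f n) * of_nat n powr (- of_nat m)) \<longlonglongrightarrow> b n" for n
  proof (cases "n \<ge> 2")
    case True
    have "(\<lambda>m. of_real (f n) * (1 / of_nat n :: complex) ^ m) \<longlonglongrightarrow> of_real (f n) * 0"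
      using True by (intro tendsto_intros LIMSEQ_power_zero) (auto simp: norm_divide)
    also have "(\<lambda>m. of_real (f n) * (1 / of_nat n :: complex) ^ m) = (\<lambda>m. of_real (f n) * of_nat n powr (- of_nat m))"
      using True by (auto simp: powr_minus powr_nat power_one_over inverse_eq_divide)
    finally show ?thesis using True by (simp add: b_def)
  next
    case False
    then have "n = 0 \<or> n = 1" by linarith
    then show ?thesis by (auto simp: b_def)
  qed
  have "(\<lambda>m. \<Sum>n. of_real (f n) * of_nat n powr (- of_nat m)) \<longlonglongrightarrow> suminf b"
  proof (rule conjunct2[OF conjunct2[OF tannerys_theorem]])
    show "summable (\<lambda>n. \<bar>f n\<bar> * real n powr (-2))"
      using f by (auto simp: dirichlet_abs_def)
    have "norm (of_real (f n) * of_nat n powr (- of_nat m) :: complex) \<le> \<bar>f n\<bar> * real n powr (-2)" if "m \<ge> 2" for n m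
      using that by (cases "n = 0") (auto simp: norm_mult norm_of_nat_powr intro!: mult_left_mono powr_mono)
    then show "\<forall>\<^sub>F (n, m) in at_top \<times>\<^sub>F at_top. norm (of_real (f n) * of_nat n powr (- of_nat m) :: complex) \<le> \<bar>f n\<bar> * real n powr (-2)"
      by (intro eventually_mono[OF eventually_prodI[OF eventually_True eventually_ge_at_top[of "2::nat"]]])
         (auto simp: case_prod_unfold)
  qed (use lim in auto)
  moreover have "suminf b = of_real (f 1)"
    using suminf_finite[of "{1}" b] by (simp add: b_def)
  ultimately show ?thesis by (simp add: dirichlet_def)
qed

text \<open>The absolutely convergent double series is grouped by the product N of the two indices,
  and \<open>mangoldt\<close> sums to log N over the divisors of N. Together with
  \<open>DERIV_dirichlet\<close> this is the series of -zeta'/zeta.\<close>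

lemma dirichlet_mangoldt_mult:
  assumes s: "Re s > 1"
  shows "dirichlet mangoldt s * dirichlet (\<lambda>_. 1) s = dirichlet (\<lambda>n. ln (real n)) s"
proof -
  let ?Z = "dirichlet (\<lambda>_. 1) s"
  let ?F = "\<lambda>(m, n). of_real (mangoldt m) * of_nat m powr (-s) * (of_real 1 * of_nat n powr (-s) :: complex)"
  let ?G = "\<lambda>(N, m). of_real (mangoldt m) * (of_nat N powr (-s) :: complex)"
  have "(?F has_sum (dirichlet mangoldt s * ?Z)) ({1..} \<times> {1..})"
    by (rule has_sum_times_complex[OF dirichlet_abs_has_sum[OF dirichlet_abs_mangoldt s] dirichlet_abs_has_sum[OF dirichlet_abs_const s]])
  also have "?this \<longleftrightarrow> (?G has_sum (dirichlet mangoldt s * ?Z)) (Sigma {1..} (\<lambda>N. {m. m dvd N}))"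
    by (rule has_sum_reindex_bij_witness[where i = "\<lambda>(N, m). (m, N div m)" and j = "\<lambda>(m, n). (m * n, m)"])
       (auto simp: powr_times_real Suc_le_eq intro: Nat.gr0I)
  finally have G: "(?G has_sum (dirichlet mangoldt s * ?Z)) (Sigma {1..} (\<lambda>N. {m. m dvd N}))" .
  have "((\<lambda>N. \<Sum>m | m dvd N. ?G (N, m)) has_sum (dirichlet mangoldt s * ?Z)) {1..}"
    by (rule has_sum_SigmaD[OF G]) (auto intro!: has_sum_finite)
  also have "?this \<longleftrightarrow>
      ((\<lambda>n. of_real (ln (real n)) * of_nat n powr (-s)) has_sum (dirichlet mangoldt s * ?Z)) {1..}"
    by (intro has_sum_cong) (auto simp: sum_distrib_right[symmetric] mangoldt_sum)
  finally show ?thesis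
    using dirichlet_abs_has_sum[OF _ s, of "\<lambda>n. ln (real n)"] dirichlet_abs_ln[OF dirichlet_abs_const[of 1]]
    by (auto dest: has_sum_unique)
qed

text \<open>Giving the logarithm by its series, with coefficient 1/a at p^a, avoids any choice of
  branch. At n = 1 the coefficient is 0 / 0 = 0.\<close>

definition log_zeta :: "complex \<Rightarrow> complex" where
  "log_zeta = dirichlet (\<lambda>n. mangoldt n / ln (real n))"

lemma dirichlet_abs_log_zeta: "dirichlet_abs (\<lambda>n. mangoldt n / ln (real n))"
proof (rule dirichlet_abs_mono[OF dirichlet_abs_const[of 1], where C = 1])
  fix n :: nat assume n: "n \<ge> 1"
  show "\<bar>mangoldt n / ln (real n)\<bar> \<le> 1 * \<bar>1\<bar>"
    using mangoldt_le[of n] n by (cases "n = 1") (auto simp: mangoldt_nonneg)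
qed

text \<open>The product of zeta and exp (- \<open>log_zeta\<close>) has derivative zero on a convex
  half-plane, hence is constant, and it tends to 1 along the integers.\<close>

lemma dirichlet_one_eq_exp:
  assumes s: "Re s > 1"
  shows "dirichlet (\<lambda>_. 1) s = exp (log_zeta s)"
proof -
  define S where "S = {z. Re z > 1}"
  define q where "q = (\<lambda>z. dirichlet (\<lambda>_. 1) z * exp (- log_zeta z))"
  have 1: "((dirichlet (\<lambda>_. 1)) has_field_derivative - dirichlet (\<lambda>n. ln (real n)) z) (at z)" if "z \<in> S" for z
    using DERIV_dirichlet[OF dirichlet_abs_const[of 1], of z] that by (simp add: S_def)
  have "(\<lambda>n. mangoldt n / ln (real n) * ln (real n)) = mangoldt"
    by (rule ext, rename_tac n, case_tac "n > 1") (auto simp: not_less le_Suc_eq)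
  then have 2: "(log_zeta has_field_derivative - dirichlet mangoldt z) (at z)" if "z \<in> S" for z
    using DERIV_dirichlet[OF dirichlet_abs_log_zeta, of z] that by (simp add: S_def log_zeta_def)
  have "(q has_field_derivative 0) (at z)" if z: "z \<in> S" for z
    unfolding q_def using z dirichlet_mangoldt_mult[of z]
    by (auto intro!: derivative_eq_intros 1 2 simp: S_def algebra_simps)
  moreover have "convex S" unfolding S_def by (rule convex_halfspace_Re_gt)
  ultimately have "\<exists>c. \<forall>z\<in>S. q z = c"
    using has_field_derivative_zero_constant[of S q] has_field_derivative_at_within[of q 0 _ S] by simp
  then obtain c where "\<And>z. z \<in> S \<Longrightarrow> q z = c" by auto
  then have const: "q z = q w" if "z \<in> S" "w \<in> S" for z w
    using that by simp
  have "(\<lambda>m. q (of_nat m)) \<longlonglongrightarrow> of_real 1 * exp (- of_real (mangoldt 1 / ln (real 1)))"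
    unfolding q_def log_zeta_def by (intro tendsto_intros tendsto_dirichlet dirichlet_abs_const dirichlet_abs_log_zeta)
  moreover have "(\<lambda>m. q (of_nat m)) \<longlonglongrightarrow> q s"
  proof (rule tendsto_eventually)
    show "\<forall>\<^sub>F m in sequentially. q (of_nat m) = q s"
      using eventually_ge_at_top[of "2::nat"]
      by eventually_elim (rule const, use s in \<open>auto simp: S_def\<close>)
  qed
  ultimately have "q s = of_real 1 * exp (- of_real (mangoldt 1 / ln (real 1)))" by (rule LIMSEQ_unique[rotated])
  then have "q s = 1" by simp
  then show ?thesis by (simp add: q_def exp_minus field_simps)
qed

lemma Re_log_zeta:
  assumes "x > 1"
  shows "Re (log_zeta (Complex x t)) = (\<Sum>n. mangoldt n / ln (real n) * real n powr (-x) * cos (t * ln (real n)))"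
    and "summable (\<lambda>n. mangoldt n / ln (real n) * real n powr (-x) * cos (t * ln (real n)))"
proof -
  let ?f = "\<lambda>n. of_real (mangoldt n / ln (real n)) * of_nat n powr (- Complex x t)"
  have sm: "summable ?f"
    by (rule summable_norm_cancel[OF dirichlet_abs_summable_norm[OF dirichlet_abs_log_zeta]]) (use assms in auto)
  have eq: "Re (?f n) = mangoldt n / ln (real n) * real n powr (-x) * cos (t * ln (real n))" for n
  proof (cases "n = 0")
    case False
    then have "of_nat n powr (- Complex x t) = exp (- Complex x t * of_real (ln (real n)))"
      by (simp add: powr_def Ln_of_nat)
    also have "Re \<dots> = real n powr (-x) * cos (t * ln (real n))"
      using False by (simp add: Re_exp powr_def)
    finally show ?thesis
      by (simp del: complex_minus of_real_divide of_real_mangoldt)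
  qed auto
  show "Re (log_zeta (Complex x t)) = (\<Sum>n. mangoldt n / ln (real n) * real n powr (-x) * cos (t * ln (real n)))"
    unfolding log_zeta_def dirichlet_def Re_suminf[OF sm] by (simp only: eq)
  show "summable (\<lambda>n. mangoldt n / ln (real n) * real n powr (-x) * cos (t * ln (real n)))"
    using summable_Re[OF sm] by (simp only: eq)
qed

text \<open>The inequality 3 + 4 cos a + cos 2a = 2 (1 + cos a)^2 >= 0 is summed with the
  nonnegative weights of \<open>log_zeta\<close> and exponentiated. It is useful because a pole of
  order 3 cannot compensate for a zero of order 4.\<close>

lemma three_four_one:
  assumes x: "x > 1"
  shows "norm (dirichlet (\<lambda>_. 1) (Complex x 0)) ^ 3 * norm (dirichlet (\<lambda>_. 1) (Complex x t)) ^ 4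
           * norm (dirichlet (\<lambda>_. 1) (Complex x (2 * t))) \<ge> 1"
proof -
  let ?w = "\<lambda>n. mangoldt n / ln (real n) * real n powr (-x)"
  have "0 \<le> 3 * Re (log_zeta (Complex x 0)) + 4 * Re (log_zeta (Complex x t)) + Re (log_zeta (Complex x (2 * t)))"
  proof -
    have "(\<lambda>n. 3 * (?w n * cos (0 * ln (real n))) + 4 * (?w n * cos (t * ln (real n))) + ?w n * cos (2 * t * ln (real n)))
       sums (3 * Re (log_zeta (Complex x 0)) + 4 * Re (log_zeta (Complex x t)) + Re (log_zeta (Complex x (2 * t))))"
      unfolding Re_log_zeta(1)[OF x]
      by (intro sums_add sums_mult summable_sums Re_log_zeta(2) x)
    moreover have "3 * (?w n * cos (0 * ln (real n))) + 4 * (?w n * cos (t * ln (real n))) + ?w n * cos (2 * t * ln (real n)) \<ge> 0" for n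
    proof -
      have "3 + 4 * cos y + cos (2 * y) = 2 * (1 + cos y)\<^sup>2" for y :: real
        unfolding cos_double_cos by (simp add: power2_eq_square algebra_simps)
      from this[of "t * ln (real n)"] have *: "3 + 4 * cos (t * ln (real n)) + cos (2 * t * ln (real n)) \<ge> 0"
        by (simp add: mult.assoc)
      have "?w n \<ge> 0" by (cases "n = 0") (auto simp: mangoldt_nonneg)
      from mult_nonneg_nonneg[OF this *] show ?thesis by (simp add: algebra_simps)
    qed
    ultimately show ?thesis by (rule sums_le[OF _ sums_zero, rotated])
  qed
  then have "1 \<le> exp (3 * Re (log_zeta (Complex x 0)) + 4 * Re (log_zeta (Complex x t)) + Re (log_zeta (Complex x (2 * t))))"
    by simp
  also have "\<dots> = norm (dirichlet (\<lambda>_. 1) (Complex x 0)) ^ 3 * norm (dirichlet (\<lambda>_. 1) (Complex x t)) ^ 4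
           * norm (dirichlet (\<lambda>_. 1) (Complex x (2 * t)))"
    using x exp_of_nat_mult[of 3 "Re (log_zeta (Complex x 0))"] exp_of_nat_mult[of 4 "Re (log_zeta (Complex x t))"]
    by (simp add: dirichlet_one_eq_exp exp_add)
  finally show ?thesis .
qed

subsection \<open>Analytic continuation of zeta\<close>

text \<open>For n >= 1 this is s - 1 times the difference between n^(-s) and the integral of u^(-s)
  over [n, n + 1]; the factor s - 1 clears the denominator of the integral.\<close>

definition zeta_term :: "nat \<Rightarrow> complex \<Rightarrow> complex" where
  "zeta_term n s = (s - 1) * of_nat n powr (-s) + of_nat (Suc n) powr (1 - s) - of_nat n powr (1 - s)"

text \<open>The entire terms sum to \<open>(s - 1) \<zeta>(s)\<close>, so that the pole of zeta never has to be treated separately.\<close>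

definition zeta_cleared :: "complex \<Rightarrow> complex" where
  "zeta_cleared s = 1 + (\<Sum>n. zeta_term (Suc n) s)"

text \<open>Put x = |s| / n. Up to constants the trivial bound is n^(- Re s) and the mean value
  bound is x times that, and min(1, x) <= x^a for 0 <= a <= 1; hence the case distinction at |s| =
  n.\<close>

lemma powr_diff_bound:
  assumes n: "n \<ge> 1" and s: "Re s > 0" and a: "0 \<le> a" "a \<le> 1" and u: "real n \<le> u" "u \<le> real n + 1"
  shows "norm (of_nat n powr (-s) - of_real u powr (-s) :: complex) \<le> 2 * norm s powr a * real n powr (- Re s - a)"
proof -
  have n0: "real n > 0" using n by simp
  define S where "S = complex_of_real ` {real n..real n + 1}"
  have conv: "convex S"
    unfolding S_def by (rule convex_linear_image) (auto simp: linear_iff scaleR_conv_of_real)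
  have norm_S: "norm (z powr w) = Re z powr Re w" "z \<noteq> 0" "z \<notin> \<real>\<^sub>\<le>\<^sub>0" "Re z \<ge> real n" if "z \<in> S" for z w
    using that n0 by (auto simp: S_def norm_powr_real_powr)
  have nS: "of_nat n \<in> S" "of_real u \<in> S" using u by (auto simp: S_def image_iff intro!: bexI[of _ "real n"])
  have 1: "norm (of_nat n powr (-s) - of_real u powr (-s) :: complex) \<le> 2 * real n powr (- Re s)"
  proof -
    have "norm (of_nat n powr (-s) - of_real u powr (-s) :: complex) \<le> real n powr (- Re s) + u powr (- Re s)"
      using u n0 norm_triangle_ineq4[of "of_nat n powr (-s)" "of_real u powr (-s) :: complex"] by (simp add: norm_powr_real_powr norm_of_nat_powr)
    also have "u powr (- Re s) \<le> real n powr (- Re s)"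
      using u n0 s by (intro powr_mono2') auto
    finally show ?thesis by simp
  qed
  have 2: "norm (of_nat n powr (-s) - of_real u powr (-s) :: complex) \<le> norm s * real n powr (- Re s - 1)"
  proof -
    have "norm (of_nat n powr (-s) - of_real u powr (-s) :: complex) \<le> (norm s * real n powr (- Re s - 1)) * norm (of_nat n - complex_of_real u)"
    proof (rule field_differentiable_bound[OF conv _ _ nS])
      fix z assume z: "z \<in> S"
      show "((\<lambda>z. z powr (-s)) has_field_derivative (-s) * z powr (-s - 1)) (at z within S)"
        using norm_S(3)[OF z] by (rule has_field_derivative_at_within[OF has_field_derivative_powr])
      have "Re z powr (- Re s - 1) \<le> real n powr (- Re s - 1)"
        using norm_S(4)[OF z] n0 s by (intro powr_mono2') auto
      then show "norm ((-s) * z powr (-s - 1)) \<le> norm s * real n powr (- Re s - 1)"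
        using norm_S(1)[OF z, of "- s - 1"] by (simp add: norm_mult mult_left_mono)
    qed
    also have "norm (of_nat n - complex_of_real u) \<le> 1"
      using u norm_of_real[of "real n - u", where 'a = complex] by simp
    finally show ?thesis by (simp add: mult_left_mono)
  qed
  show ?thesis
  proof (cases "norm s \<le> real n")
    case True
    have "norm s * real n powr (- Re s - 1) = (norm s / real n) powr 1 * real n powr (- Re s)"
      using n0 by (simp add: powr_diff)
    also have "\<dots> \<le> (norm s / real n) powr a * real n powr (- Re s)"
      using True n0 a by (intro mult_right_mono powr_mono') auto
    also have "\<dots> = norm s powr a * real n powr (- Re s - a)"
      using n0 by (simp add: powr_divide powr_diff)
    finally have "norm s * real n powr (- Re s - 1) \<le> norm s powr a * real n powr (- Re s - a)" .
    moreover have "0 \<le> norm s powr a * real n powr (- Re s - a)" by simp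
    ultimately show ?thesis using 2 unfolding mult.assoc by linarith
  next
    case False
    have "1 \<le> (norm s / real n) powr a"
      using False n0 a by (intro ge_one_powr_ge_zero) auto
    then have "1 * real n powr (- Re s) \<le> (norm s / real n) powr a * real n powr (- Re s)"
      by (intro mult_right_mono) auto
    also have "\<dots> = norm s powr a * real n powr (- Re s - a)"
      using n0 by (simp add: powr_divide powr_diff)
    finally show ?thesis using 1 by simp
  qed
qed

text \<open>Interpolating with exponent \<open>a\<close> between the trivial and the mean value bound gains convergence
to the left of \<open>Re s = 1\<close> at the cost of a factor \<open>|s|^a\<close> only.\<close>

lemma zeta_term_bound:
  assumes n: "n \<ge> 1" and s: "Re s > 0" and a: "0 \<le> a" "a \<le> 1"
  shows "norm (zeta_term n s) \<le> norm (s - 1) * (2 * norm s powr a * real n powr (- Re s - a))"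
proof -
  have n0: "real n > 0" using n by simp
  define S where "S = complex_of_real ` {real n..real n + 1}"
  have conv: "convex S"
    unfolding S_def by (rule convex_linear_image) (auto simp: linear_iff scaleR_conv_of_real)
  have nS: "of_nat (Suc n) \<in> S" "of_nat n \<in> S"
    by (auto simp: S_def image_iff intro: bexI[of _ "real n"] bexI[of _ "real n + 1"])
  \<comment> \<open>Chosen so that the derivative is s - 1 times a difference to which
    \<open>powr_diff_bound\<close> applies, while the increment from n to n + 1 is
    \<open>zeta_term n s\<close>.\<close>
  let ?\<phi> = "\<lambda>z. (s - 1) * of_nat n powr (-s) * z + z powr (1 - s)"
  have "norm (?\<phi> (of_nat (Suc n)) - ?\<phi> (of_nat n))
     \<le> (norm (s - 1) * (2 * norm s powr a * real n powr (- Re s - a))) * norm (of_nat (Suc n) - of_nat n :: complex)"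
  proof (rule field_differentiable_bound[OF conv _ _ nS])
    fix z assume z: "z \<in> S"
    then obtain u where u: "z = of_real u" "real n \<le> u" "u \<le> real n + 1" by (auto simp: S_def)
    have "z \<notin> \<real>\<^sub>\<le>\<^sub>0" using u n0 by auto
    then show "(?\<phi> has_field_derivative (s - 1) * (of_nat n powr (-s) - z powr (-s))) (at z within S)"
      by (auto intro!: derivative_eq_intros has_field_derivative_at_within[OF has_field_derivative_powr] simp: algebra_simps)
    show "norm ((s - 1) * (of_nat n powr (-s) - z powr (-s))) \<le> norm (s - 1) * (2 * norm s powr a * real n powr (- Re s - a))"
      using powr_diff_bound[OF n s a u(2,3)] u(1) by (simp add: norm_mult mult_left_mono)
  qed
  moreover have "?\<phi> (of_nat (Suc n)) - ?\<phi> (of_nat n) = zeta_term n s" by (simp add: zeta_term_def algebra_simps)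
  ultimately show ?thesis by (simp del: of_nat_Suc) simp
qed

lemma summable_Suc_powr: "x > 1 \<Longrightarrow> summable (\<lambda>n. real (Suc n) powr (-x))"
  by (subst summable_Suc_iff) (simp add: summable_real_powr_iff)

lemma holomorphic_zeta_cleared: "zeta_cleared holomorphic_on {s. Re s > 0}"
proof -
  have "(\<lambda>s. \<Sum>n. zeta_term (Suc n) s) holomorphic_on {s. Re s > 0}"
  proof (rule holomorphic_uniform_sequence)
    show "open {s. Re s > 0}" by (rule open_halfspace_Re_gt)
    show "(\<lambda>s. \<Sum>i<n. zeta_term (Suc i) s) holomorphic_on {s. Re s > 0}" for n
      unfolding zeta_term_def by (intro holomorphic_intros) (auto simp del: of_nat_Suc)
    fix x assume x: "x \<in> {s. Re s > 0}"
    define d where "d = Re x / 2"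
    have d: "d > 0" using x by (simp add: d_def)
    have sub: "d \<le> Re z \<and> norm z \<le> norm x + d" if "z \<in> cball x d" for z
    proof -
      have "norm (x - z) \<le> d" using that by (simp add: dist_norm)
      then show ?thesis using abs_Re_le_cmod[of "x - z"] norm_triangle_ineq4[of x "x - z"] d_def by auto
    qed
    have "uniform_limit (cball x d) (\<lambda>n s. \<Sum>i<n. zeta_term (Suc i) s) (\<lambda>s. \<Sum>n. zeta_term (Suc n) s) sequentially"
    proof (rule Weierstrass_m_test)
      show "summable (\<lambda>n. ((norm x + d) + 1) * (2 * (norm x + d) powr 1 * real (Suc n) powr (- (d + 1))))"
        using d by (intro summable_mult summable_Suc_powr) auto
      fix n z assume z: "z \<in> cball x d"
      \<comment> \<open>Growth in z does not matter on a disc, so the full exponent a = 1 is used;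
        it gives convergence throughout Re z > 0.\<close>
      have "norm (zeta_term (Suc n) z) \<le> norm (z - 1) * (2 * norm z powr 1 * real (Suc n) powr (- Re z - 1))"
        using sub[OF z] d by (intro zeta_term_bound) auto
      also have "\<dots> \<le> ((norm x + d) + 1) * (2 * (norm x + d) powr 1 * real (Suc n) powr (- (d + 1)))"
        using sub[OF z] d norm_triangle_ineq4[of z 1]
        by (intro mult_mono powr_mono powr_mono2) auto
      finally show "norm (zeta_term (Suc n) z) \<le> ((norm x + d) + 1) * (2 * (norm x + d) powr 1 * real (Suc n) powr (- (d + 1)))" .
    qed
    then show "\<exists>d>0. cball x d \<subseteq> {s. Re s > 0} \<and>
        uniform_limit (cball x d) (\<lambda>n s. \<Sum>i<n. zeta_term (Suc i) s) (\<lambda>s. \<Sum>n. zeta_term (Suc n) s) sequentially"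
      using sub d by (intro exI[of _ d]) force
  qed
  then show ?thesis unfolding zeta_cleared_def by (intro holomorphic_intros)
qed

lemma zeta_cleared_1 [simp]: "zeta_cleared 1 = 1"
  by (simp add: zeta_cleared_def zeta_term_def del: of_nat_Suc)

lemma zeta_cleared_eq:
  assumes s: "Re s > 1" shows "zeta_cleared s = (s - 1) * dirichlet (\<lambda>_. 1) s"
proof -
  have sm: "summable (\<lambda>n. of_nat n powr (-s) :: complex)"
    using summable_norm_cancel[OF dirichlet_abs_summable_norm[OF dirichlet_abs_const[of 1] s]] by simp
  have "(\<lambda>n. of_nat n powr (-s) :: complex) sums dirichlet (\<lambda>_. 1) s"
    using summable_sums[OF sm] by (simp add: dirichlet_def)
  then have "(\<lambda>n. of_nat (Suc n) powr (-s) :: complex) sums dirichlet (\<lambda>_. 1) s"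
    by (subst sums_Suc_iff) simp
  then have 1: "(\<lambda>n. (s - 1) * of_nat (Suc n) powr (-s)) sums ((s - 1) * dirichlet (\<lambda>_. 1) s)"
    by (rule sums_mult)
  have "(\<lambda>n. of_nat (Suc n) powr (1 - s) :: complex) \<longlonglongrightarrow> 0"
  proof (rule tendsto_norm_zero_cancel)
    have "(\<lambda>n. real (Suc n) powr (1 - Re s)) \<longlonglongrightarrow> 0"
      using s by (intro LIMSEQ_Suc[where f = "\<lambda>n. real n powr (1 - Re s)"] tendsto_neg_powr filterlim_real_sequentially) auto
    then show "(\<lambda>n. norm (of_nat (Suc n) powr (1 - s) :: complex)) \<longlonglongrightarrow> 0"
      by (simp add: norm_of_nat_powr del: of_nat_Suc)
  qed
  from telescope_sums[OF this] have 2: "(\<lambda>n. of_nat (Suc (Suc n)) powr (1 - s) - of_nat (Suc n) powr (1 - s) :: complex) sums (0 - 1)"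
    by (simp del: of_nat_Suc) simp
  from sums_add[OF 1 2] have "(\<lambda>n. zeta_term (Suc n) s) sums ((s - 1) * dirichlet (\<lambda>_. 1) s - 1)"
    by (simp add: zeta_term_def add_diff_eq del: of_nat_Suc)
  then show ?thesis by (simp add: zeta_cleared_def sums_iff)
qed

text \<open>Exponent a = 2e in \<open>zeta_term_bound\<close>: for Re s >= 1 - e the terms decay
  like n^(-(1 + e)), at the price |s|^(2e). The factor \<open>norm (s - 1)\<close> is retained
  because \<open>zeta_regular\<close> arises by dividing by s - 1.\<close>

lemma zeta_cleared_bound:
  assumes e: "0 < e" "e \<le> 1/2"
  obtains C where "C \<ge> 0" "\<And>s. Re s \<ge> 1 - e \<Longrightarrow> norm (zeta_cleared s - 1) \<le> C * norm (s - 1) * norm s powr (2 * e)"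
proof -
  define C where "C = 2 * (\<Sum>n. real (Suc n) powr (-(1 + e)))"
  have sm: "summable (\<lambda>n. real (Suc n) powr (-(1 + e)))" using e by (intro summable_Suc_powr) auto
  show ?thesis
  proof
    show "C \<ge> 0" unfolding C_def using sm by (intro mult_nonneg_nonneg suminf_nonneg) auto
    fix s assume s: "Re s \<ge> 1 - e"
    have s0: "Re s > 0" using s e by simp
    have bd: "norm (zeta_term (Suc n) s) \<le> norm (s - 1) * (2 * norm s powr (2 * e)) * real (Suc n) powr (-(1 + e))" for n
    proof -
      have "norm (zeta_term (Suc n) s) \<le> norm (s - 1) * (2 * norm s powr (2 * e) * real (Suc n) powr (- Re s - 2 * e))"
        using s0 e by (intro zeta_term_bound) auto
      also have "\<dots> \<le> norm (s - 1) * (2 * norm s powr (2 * e) * real (Suc n) powr (-(1 + e)))"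
        using s e by (intro mult_left_mono powr_mono) auto
      finally show ?thesis by (simp add: mult_ac)
    qed
    have "norm (zeta_cleared s - 1) = norm (\<Sum>n. zeta_term (Suc n) s)" by (simp add: zeta_cleared_def)
    also have "\<dots> \<le> (\<Sum>n. norm (s - 1) * (2 * norm s powr (2 * e)) * real (Suc n) powr (-(1 + e)))"
      by (intro norm_suminf_le bd summable_mult sm)
    also have "\<dots> = C * norm (s - 1) * norm s powr (2 * e)"
      using suminf_mult[OF sm, of "norm (s - 1) * (2 * norm s powr (2 * e))"] by (simp add: C_def mult_ac)
    finally show "norm (zeta_cleared s - 1) \<le> C * norm (s - 1) * norm s powr (2 * e)" .
  qed
qed

text \<open>\<open>\<zeta>(s) - 1/(s - 1)\<close>, with the removable singularity filled in.\<close>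

definition zeta_regular :: "complex \<Rightarrow> complex" where
  "zeta_regular = (\<lambda>z. if z = 1 then deriv zeta_cleared 1 else (zeta_cleared z - zeta_cleared 1) / (z - 1))"

lemma holomorphic_zeta_regular: "zeta_regular holomorphic_on {s. Re s > 0}"
  unfolding zeta_regular_def
  by (rule pole_lemma[OF holomorphic_zeta_cleared]) (auto simp: interior_open open_halfspace_Re_gt)

lemma zeta_cleared_zeta_regular: "zeta_cleared s = 1 + (s - 1) * zeta_regular s"
  by (auto simp: zeta_regular_def)

abbreviation (input) hgt :: "complex \<Rightarrow> real" where "hgt s \<equiv> 2 + \<bar>Im s\<bar>"

text \<open>Since the exponent 2e can be made at most \<eta>, the growth near the line is
  arbitrarily slow. Cauchy's estimate for the derivative needs discs of radius e / 2 inside the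
  region of the first bound, whence the smaller range of \<open>Re s\<close> and the final halving
  of \<open>e\<close>.\<close>

lemma zeta_regular_bound:
  assumes "\<eta> > 0"
  obtains C e where "C > 0" "0 < e" "e < 1/2"
    "\<And>s. 1 - e \<le> Re s \<Longrightarrow> Re s \<le> 4 \<Longrightarrow> norm (zeta_regular s) \<le> C * hgt s powr \<eta>"
    "\<And>s. 1 - e \<le> Re s \<Longrightarrow> Re s \<le> 3 \<Longrightarrow> norm (deriv zeta_regular s) \<le> C * hgt s powr \<eta>"
proof -
  define e where "e = min (1/3) (\<eta> / 2)"
  have e: "0 < e" "e \<le> 1/2" "e < 1" "2 * e \<le> \<eta>" using assms by (auto simp: e_def)
  obtain C0 where C0: "C0 \<ge> 0" "\<And>s. Re s \<ge> 1 - e \<Longrightarrow> norm (zeta_cleared s - 1) \<le> C0 * norm (s - 1) * norm s powr (2 * e)"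
    using zeta_cleared_bound[OF e(1,2)] by blast
  define C1 where "C1 = C0 * 2 powr \<eta>"
  have ns: "norm s \<le> 2 * hgt s" if "0 \<le> Re s" "Re s \<le> 4" for s
    using cmod_le[of s] that by auto
  have H1: "norm (zeta_regular s) \<le> C1 * hgt s powr \<eta>" if s: "1 - e \<le> Re s" "Re s \<le> 4" "s \<noteq> 1" for s
  proof -
    have "norm (s - 1) * norm (zeta_regular s) = norm (zeta_cleared s - 1)"
      by (simp add: zeta_cleared_zeta_regular norm_mult)
    also have "\<dots> \<le> norm (s - 1) * (C0 * norm s powr (2 * e))"
      using C0(2)[OF s(1)] by (simp add: mult_ac)
    finally have 1: "norm (zeta_regular s) \<le> C0 * norm s powr (2 * e)"
      using s(3) by simp
    have "norm s powr (2 * e) \<le> (2 * hgt s) powr (2 * e)"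
      using ns[of s] s e by (intro powr_mono2) auto
    also have "(2 * hgt s) powr (2 * e) \<le> (2 * hgt s) powr \<eta>"
      using e by (intro powr_mono) auto
    also have "(2 * hgt s) powr \<eta> = 2 powr \<eta> * hgt s powr \<eta>" by (rule powr_mult)
    finally have "C0 * norm s powr (2 * e) \<le> C0 * (2 powr \<eta> * hgt s powr \<eta>)" by (rule mult_left_mono) (rule C0(1))
    then show ?thesis using 1 by (simp add: C1_def mult.assoc)
  qed
  have H2: "norm (zeta_regular s) \<le> C1 * hgt s powr \<eta>" if s: "1 - e \<le> Re s" "Re s \<le> 4" for s
  proof (cases "s = 1")
    case False then show ?thesis using H1 s by auto
  next
    \<comment> \<open>The bound came from cancelling s - 1; at s = 1 it follows by continuity from
      the points 1 + 1/(n + 1).\<close>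
    case True
    have "continuous_on {s. Re s > 0} zeta_regular" by (rule holomorphic_on_imp_continuous_on[OF holomorphic_zeta_regular])
    then have "isCont zeta_regular 1" by (rule continuous_on_interior) (auto simp: interior_open open_halfspace_Re_gt)
    then have lim: "(\<lambda>n. zeta_regular (of_real (1 + 1 / real (Suc n)))) \<longlonglongrightarrow> zeta_regular 1"
      by (rule isCont_tendsto_compose) (use tendsto_of_real[OF tendsto_add[OF tendsto_const[of 1] LIMSEQ_inverse_real_of_nat], where 'a = complex] in \<open>simp add: inverse_eq_divide\<close>)
    have "norm (zeta_regular (of_real (1 + y))) \<le> C1 * 2 powr \<eta>" if "0 < y" "y \<le> 1" for y
      using H1[of "of_real (1 + y)"] e that by (simp add: complex_eq_iff)
    note this[of "1 / real (Suc _)"]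
    then have bd: "norm (zeta_regular (of_real (1 + 1 / real (Suc n)))) \<le> C1 * 2 powr \<eta>" for n
      by (simp del: of_nat_Suc of_real_add of_real_divide)
    have "norm (zeta_regular 1) \<le> C1 * 2 powr \<eta>"
      using LIMSEQ_le_const2[OF tendsto_norm[OF lim]] bd by blast
    then show ?thesis using True by simp
  qed
  define C where "C = max 1 (max C1 (C1 * 2 powr \<eta> / (e / 2)))"
  have "C1 \<ge> 0" using C0 by (simp add: C1_def)
  have C: "C > 0" "C1 \<le> C" "C1 * 2 powr \<eta> / (e / 2) \<le> C" by (auto simp: C_def)
  show ?thesis
  proof
    show "0 < C" "0 < e / 2" "e / 2 < 1 / 2" using C e by auto
    fix s assume s: "1 - e / 2 \<le> Re s" 
    {
      assume "Re s \<le> 4"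
      then have "norm (zeta_regular s) \<le> C1 * hgt s powr \<eta>" using H2[of s] s e by auto
      also have "\<dots> \<le> C * hgt s powr \<eta>" using C by (intro mult_right_mono) auto
      finally show "norm (zeta_regular s) \<le> C * hgt s powr \<eta>" .
    next
      assume s4: "Re s \<le> 3"
      have sub: "1 - e \<le> Re z \<and> Re z \<le> 4 \<and> hgt z \<le> 2 * hgt s" if "norm (s - z) \<le> e / 2" for z
        using that s s4 e abs_Re_le_cmod[of "s - z"] abs_Im_le_cmod[of "s - z"] by auto
      have pos: "cball s (e / 2) \<subseteq> {s. Re s > 0}"
      proof
        fix z assume "z \<in> cball s (e / 2)"
        then show "z \<in> {s. Re s > 0}" using sub[of z] e by (simp add: dist_norm)
      qed
      have "norm ((deriv ^^ 1) zeta_regular s) \<le> fact 1 * (C1 * 2 powr \<eta> * hgt s powr \<eta>) / (e / 2) ^ 1"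
      proof (rule Cauchy_inequality)
        show "zeta_regular holomorphic_on ball s (e / 2)"
          using pos ball_subset_cball by (intro holomorphic_on_subset[OF holomorphic_zeta_regular]) blast
        show "continuous_on (cball s (e / 2)) zeta_regular"
          by (rule continuous_on_subset[OF holomorphic_on_imp_continuous_on[OF holomorphic_zeta_regular] pos])
        show "0 < e / 2" using e by simp
        fix z assume z: "norm (s - z) = e / 2"
        have "norm (zeta_regular z) \<le> C1 * hgt z powr \<eta>" using H2[of z] sub[of z] z by auto
        also have "\<dots> \<le> C1 * (2 * hgt s) powr \<eta>"
          using sub[of z] z assms \<open>C1 \<ge> 0\<close> by (intro mult_left_mono powr_mono2) auto
        also have "(2 * hgt s) powr \<eta> = 2 powr \<eta> * hgt s powr \<eta>" by (rule powr_mult)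
        finally show "norm (zeta_regular z) \<le> C1 * 2 powr \<eta> * hgt s powr \<eta>" by (simp add: mult.assoc)
      qed
      then have "norm (deriv zeta_regular s) \<le> (C1 * 2 powr \<eta> / (e / 2)) * hgt s powr \<eta>" by (simp add: mult_ac)
      also have "\<dots> \<le> C * hgt s powr \<eta>" using C by (intro mult_right_mono) auto
      finally show "norm (deriv zeta_regular s) \<le> C * hgt s powr \<eta>" .
    }
  qed
qed

subsection \<open>A lower bound for zeta near the line of real part one\<close>

text \<open>Mertens' argument made quantitative. To the right of 1 + \<rho> the 3-4-1 inequality
  bounds |zeta| below by about \<rho>^(3/4) times the height to the power -\<eta>/4; moving left
  from 1 + \<rho> by at most 2\<rho> costs at most \<rho> times the height to the power \<eta>. As
  3/4 < 1, a small \<rho> makes the loss smaller than the bound, which then holds slightly to the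
  left of the line as well.\<close>

lemma zeta_cleared_lower_bound_pre:
  assumes "\<eta> > 0"
  obtains c where "c > 0"
    "\<And>s. 1 - c * hgt s powr (- 5 * \<eta>) \<le> Re s \<Longrightarrow> Re s \<le> 3 \<Longrightarrow> norm (zeta_cleared s) \<ge> c * hgt s powr (- 4 * \<eta>)"
proof -
  obtain C e where C: "C > 0" "0 < e" "e < 1/2"
    and H: "\<And>s. 1 - e \<le> Re s \<Longrightarrow> Re s \<le> 4 \<Longrightarrow> norm (zeta_regular s) \<le> C * hgt s powr \<eta>"
    and H': "\<And>s. 1 - e \<le> Re s \<Longrightarrow> Re s \<le> 3 \<Longrightarrow> norm (deriv zeta_regular s) \<le> C * hgt s powr \<eta>"
    using zeta_regular_bound[OF assms] by blast
  \<comment> \<open>Within distance \<open>r\<close> of 1 the height is at most 3, so (s - 1) times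
    \<open>zeta_regular s\<close> has norm at most 1/2 and \<open>zeta_cleared\<close> stays close
    to its value 1.\<close>
  define r where "r = min (1/2) (1 / (2 * C * 3 powr \<eta>))"
  have r: "0 < r" "r \<le> 1/2" "r * (C * 3 powr \<eta>) \<le> 1/2" using C by (auto simp: r_def min_def field_simps)
  have T1: "hgt s powr \<eta> \<ge> 1" for s using assms by (intro ge_one_powr_ge_zero) auto
  have near: "norm (zeta_cleared s) \<ge> 1/2" if "norm (s - 1) \<le> r" "1 - e \<le> Re s" for s
  proof -
    have b: "\<bar>Im s\<bar> \<le> 1" "Re s \<le> 4" using that r abs_Im_le_cmod[of "s - 1"] abs_Re_le_cmod[of "s - 1"] by auto
    have "norm (zeta_regular s) \<le> C * hgt s powr \<eta>" using H b that by auto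
    also have "\<dots> \<le> C * 3 powr \<eta>" using C b assms by (intro mult_left_mono powr_mono2) auto
    finally have "norm (s - 1) * norm (zeta_regular s) \<le> r * (C * 3 powr \<eta>)" using that r by (intro mult_mono) auto
    then have "norm ((s - 1) * zeta_regular s) \<le> 1/2" using r by (simp add: norm_mult)
    then show ?thesis using norm_diff_ineq[of 1 "(s - 1) * zeta_regular s"] by (simp add: zeta_cleared_zeta_regular)
  qed
  \<comment> \<open>The continued zeta function itself, since the 3-4-1 inequality concerns zeta and
    not \<open>zeta_cleared\<close>.\<close>
  define Z where "Z = (\<lambda>s. zeta_regular s + 1 / (s - 1))"
  have FZ: "zeta_cleared s = (s - 1) * Z s" if "s \<noteq> 1" for s using that by (simp add: Z_def zeta_cleared_zeta_regular field_simps)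
  have Zd: "Z s = dirichlet (\<lambda>_. 1) s" if "Re s > 1" for s
  proof -
    have "s \<noteq> 1" using that by auto
    then show ?thesis using FZ[of s] zeta_cleared_eq[OF that] by auto
  qed
  define C2 where "C2 = 2 * (C * 2 powr \<eta>) + 1"
  define C1 where "C1 = C * 2 powr \<eta> + 1 / r"
  have C12: "C1 > 0" "C2 > 0" using C r by (auto simp: C1_def C2_def intro!: add_nonneg_pos)
  have Zreal: "norm (Z (Complex x 0)) \<le> C2 / (x - 1)" if x: "1 < x" "x \<le> 3" for x
  proof -
    have "Complex x 0 - 1 = of_real (x - 1)" by (simp add: complex_eq_iff)
    then have 1: "norm (1 / (Complex x 0 - 1)) = 1 / (x - 1)"
      using x by (simp add: norm_divide del: of_real_diff)
    have "norm (Z (Complex x 0)) \<le> norm (zeta_regular (Complex x 0)) + norm (1 / (Complex x 0 - 1))"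
      unfolding Z_def by (rule norm_triangle_ineq)
    also have "\<dots> \<le> C * 2 powr \<eta> + 1 / (x - 1)" using H[of "Complex x 0"] x C unfolding 1 by simp
    also have "\<dots> = (C * 2 powr \<eta> * (x - 1) + 1) / (x - 1)" using x by (simp add: field_simps)
    also have "\<dots> \<le> C2 / (x - 1)"
    proof -
      have "C * 2 powr \<eta> * (x - 1) \<le> C * 2 powr \<eta> * 2" using x C by (intro mult_left_mono) auto
      then show ?thesis using x by (intro divide_right_mono) (auto simp: C2_def)
    qed
    finally show ?thesis .
  qed
  have Z2: "norm (Z (Complex x (2 * t))) \<le> C1 * hgt (Complex x t) powr \<eta>"
    if x: "1 < x" "x \<le> 3" "norm (Complex x (2 * t) - 1) \<ge> r" for x t
  proof -
    have "norm (Z (Complex x (2 * t))) \<le> norm (zeta_regular (Complex x (2 * t))) + norm (1 / (Complex x (2 * t) - 1))"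
      unfolding Z_def by (rule norm_triangle_ineq)
    also have "norm (zeta_regular (Complex x (2 * t))) \<le> C * hgt (Complex x (2 * t)) powr \<eta>"
      using H[of "Complex x (2 * t)"] x C by auto
    also have "\<dots> \<le> C * (2 * hgt (Complex x t)) powr \<eta>"
      using C assms by (intro mult_left_mono powr_mono2) (auto simp: abs_mult)
    also have "(2 * hgt (Complex x t)) powr \<eta> = 2 powr \<eta> * hgt (Complex x t) powr \<eta>" by (rule powr_mult)
    also have "norm (1 / (Complex x (2 * t) - 1)) \<le> 1 / r"
      using x r unfolding norm_divide by (intro frac_le) auto
    also have "1 / r \<le> 1 / r * hgt (Complex x t) powr \<eta>"
      using mult_left_mono[OF T1[of "Complex x t"], of "1 / r"] r by simp
    finally show ?thesis by (simp add: C1_def algebra_simps)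
  qed
  \<comment> \<open>\<open>D ^ 4\<close> dominates the constant of the 3-4-1 product, so that only
    fourth powers have to be compared and no fourth root is taken.\<close>
  define D where "D = max 1 (C2 ^ 3 * C1)"
  have D: "D \<ge> 1" "C2 ^ 3 * C1 \<le> D ^ 4"
    using power_increasing[of 1 4 D] by (auto simp: D_def)
  define C3 where "C3 = C + 4 / r\<^sup>2"
  have C3: "C3 > 0" using C r by (auto simp: C3_def intro!: add_pos_nonneg)
  \<comment> \<open>The bound by \<open>e\<close> keeps all points in the domain of the estimates
    for \<open>zeta_regular\<close>; \<open>r / 2\<close> forces |Im s| >= r / 2 for points close to
    the line but outside the disc about 1; \<open>1 / (4 * C3 * D)\<close> makes the loss of the
    horizontal move at most half of the lower bound.\<close>
  define l where "l = Min {1/2, 1 / (4 * C3 * D), e, r / 2}"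
  have l: "0 < l" "l \<le> 1 / 2" "l \<le> 1 / (4 * C3 * D)" "l \<le> e" "l \<le> r / 2"
    using C3 C r D by (auto simp: l_def)
  define b where "b = (\<lambda>s. hgt s powr (-\<eta>))"
  have b: "0 < b s" "b s \<le> 1" "b s * hgt s powr \<eta> = 1" for s
  proof -
    have "b s = 1 / hgt s powr \<eta>" by (simp add: b_def powr_minus_divide)
    then show "0 < b s" "b s \<le> 1" "b s * hgt s powr \<eta> = 1" using T1[of s] by auto
  qed
  have bpow: "hgt s powr (- 4 * \<eta>) = b s ^ 4" "hgt s powr (- 5 * \<eta>) = b s ^ 5" for s
    by (auto simp: b_def powr_powr[symmetric] powr_power)
  \<comment> \<open>The exponents are forced: \<rho>^3 b = (l^3 b^4)^4 is an exact fourth power, and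
    the loss, of order \<rho> / b = l^4 b^4, is smaller than l^3 b^4 by the factor l.\<close>
  define \<rho> where "\<rho> = (\<lambda>s. l ^ 4 * b s ^ 5)"
  have \<rho>: "0 < \<rho> s" "\<rho> s \<le> l" for s
  proof -
    show "0 < \<rho> s" using l b[of s] by (simp add: \<rho>_def)
    have "l ^ 4 * b s ^ 5 \<le> l ^ 1 * 1" using l b[of s] power_decreasing[of 1 4 l]
      by (intro mult_mono power_le_one) auto
    then show "\<rho> s \<le> l" by (simp add: \<rho>_def)
  qed
  have Zlow: "norm (Z s) \<ge> l ^ 3 * b s ^ 4 / D"
    if s: "1 + \<rho> s \<le> Re s" "Re s \<le> 3" "norm (Complex (Re s) (2 * Im s) - 1) \<ge> r" for s
  proof -
    define x t where "x = Re s" "t = Im s"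
    have st: "s = Complex x t" by (simp add: x_t_def)
    have x: "1 < x" "x \<le> 3" "\<rho> s \<le> x - 1" using s \<rho>[of s] by (auto simp: x_t_def)
    let ?h = "hgt s powr \<eta>"
    have "1 \<le> norm (Z (Complex x 0)) ^ 3 * norm (Z s) ^ 4 * norm (Z (Complex x (2 * t)))"
      using three_four_one[OF x(1), of t] x by (simp add: Zd st)
    also have "\<dots> \<le> (C2 / (x - 1)) ^ 3 * norm (Z s) ^ 4 * (C1 * ?h)"
      using Zreal[OF x(1,2)] Z2[OF x(1,2), of t] s(3) C12 x
      by (intro mult_mono power_mono mult_nonneg_nonneg) (auto simp: st)
    finally have 2: "1 \<le> (C2 / (x - 1)) ^ 3 * norm (Z s) ^ 4 * (C1 * ?h)" .
    have "(l ^ 3 * b s ^ 4 / D) ^ 4 \<le> norm (Z s) ^ 4"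
    proof -
      have "(\<rho> s) ^ 3 * b s \<le> (x - 1) ^ 3 * b s"
        using x \<rho>[of s] b[of s] by (intro mult_right_mono power_mono) auto
      also have "\<dots> \<le> (x - 1) ^ 3 * b s * ((C2 / (x - 1)) ^ 3 * norm (Z s) ^ 4 * (C1 * ?h))"
        using mult_left_mono[OF 2, of "(x - 1) ^ 3 * b s"] x b[of s] by simp
      also have "\<dots> = (C2 ^ 3 * C1) * norm (Z s) ^ 4 * (b s * ?h)" using x by (simp add: power_divide)
      also have "\<dots> \<le> D ^ 4 * norm (Z s) ^ 4"
        unfolding b(3) using D by (simp add: mult_right_mono)
      finally have "(\<rho> s) ^ 3 * b s / D ^ 4 \<le> norm (Z s) ^ 4"
        using D by (simp add: field_simps)
      also have "(\<rho> s) ^ 3 * b s = (l ^ 3 * b s ^ 4) ^ 4"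
        by (simp add: \<rho>_def power_mult_distrib power_mult[symmetric] power_Suc2[symmetric] del: power_Suc)
      finally show ?thesis by (simp add: power_divide)
    qed
    then show ?thesis using power_le_imp_le_base[of "l ^ 3 * b s ^ 4 / D" 3 "norm (Z s)"] by simp
  qed
  have Zlip: "norm (Z s - Z s') \<le> C3 * hgt s powr \<eta> * \<bar>Re s - Re s'\<bar>"
    if s: "Im s = Im s'" "\<bar>Im s\<bar> \<ge> r / 2" "1 - e \<le> Re s" "Re s \<le> 3" "1 - e \<le> Re s'" "Re s' \<le> 3" for s s'
  proof -
    let ?S = "{z. Im z = Im s \<and> Re z \<ge> 1 - e \<and> Re z \<le> 3}"
    have S: "?S = {z. Im z \<ge> Im s} \<inter> {z. Im z \<le> Im s} \<inter> {z. Re z \<ge> 1 - e} \<inter> {z. Re z \<le> 3}" by auto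
    have conv: "convex ?S" unfolding S
      by (intro convex_Int convex_halfspace_Re_ge convex_halfspace_Re_le convex_halfspace_Im_ge convex_halfspace_Im_le)
    have "norm (Z s - Z s') \<le> (C3 * hgt s powr \<eta>) * norm (s - s')"
    proof (rule field_differentiable_bound[OF conv])
      fix z assume z: "z \<in> ?S"
      have z1: "z \<noteq> 1" using z s r by auto
      have "zeta_regular field_differentiable at z"
        using holomorphic_zeta_regular by (rule holomorphic_on_imp_differentiable_at) (use z C in \<open>auto simp: open_halfspace_Re_gt\<close>)
      then have "(zeta_regular has_field_derivative deriv zeta_regular z) (at z)" by (simp add: field_differentiable_derivI)
      then show "(Z has_field_derivative (deriv zeta_regular z - 1 / (z - 1)\<^sup>2)) (at z within ?S)"
        unfolding Z_def using z1
        by (auto intro!: derivative_eq_intros intro: has_field_derivative_at_within simp: power2_eq_square field_simps)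
      have "norm (deriv zeta_regular z - 1 / (z - 1)\<^sup>2) \<le> norm (deriv zeta_regular z) + norm (1 / (z - 1)\<^sup>2)"
        by (rule norm_triangle_ineq4)
      also have "norm (deriv zeta_regular z) \<le> C * hgt s powr \<eta>" using H'[of z] z by auto
      also have "norm (1 / (z - 1)\<^sup>2) \<le> 1 / (r / 2)\<^sup>2"
      proof -
        have "r / 2 \<le> norm (z - 1)" using abs_Im_le_cmod[of "z - 1"] z s by auto
        then have "(r / 2)\<^sup>2 \<le> norm (z - 1) ^ 2" using r by (intro power_mono) auto
        then show ?thesis unfolding norm_divide norm_power using r by (intro frac_le) auto
      qed
      also have "1 / (r / 2)\<^sup>2 = 4 / r\<^sup>2" by (simp add: power_divide)
      also have "4 / r\<^sup>2 \<le> 4 / r\<^sup>2 * hgt s powr \<eta>"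
        using mult_left_mono[OF T1[of s], of "4 / r\<^sup>2"] by simp
      finally show "norm (deriv zeta_regular z - 1 / (z - 1)\<^sup>2) \<le> C3 * hgt s powr \<eta>"
        by (simp add: C3_def algebra_simps)
    qed (use s in auto)
    also have "norm (s - s') = \<bar>Re s - Re s'\<bar>" using s(1) by (simp add: cmod_def)
    finally show ?thesis .
  qed
  define c where "c = Min {1/2, l ^ 4, r * l ^ 3 / (2 * D)}"
  have c: "0 < c" "c \<le> 1/2" "c \<le> l ^ 4" "c \<le> r * l ^ 3 / (2 * D)"
    using l r D by (auto simp: c_def)
  show ?thesis
  proof
    show "c > 0" by (rule c)
    fix s assume s: "1 - c * hgt s powr (- 5 * \<eta>) \<le> Re s" "Re s \<le> 3"
    have "c * b s ^ 5 \<le> \<rho> s" unfolding \<rho>_def using c b(1)[of s] by (intro mult_right_mono) auto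
    with s have s1: "1 - \<rho> s \<le> Re s" unfolding bpow by auto
    have s2: "1 - e \<le> Re s" using s1 \<rho>[of s] l by auto
    have b4: "0 < b s ^ 4" "b s ^ 4 \<le> 1" using b[of s] by (auto intro: power_le_one)
    show "norm (zeta_cleared s) \<ge> c * hgt s powr (- 4 * \<eta>)"
    proof (cases "norm (s - 1) \<le> r")
      case True
      have "c * b s ^ 4 \<le> (1/2) * 1" using c b4 by (intro mult_mono) auto
      then show ?thesis using near[OF True s2] unfolding bpow by simp
    next
      case False
      have "norm (Z s) \<ge> l ^ 3 * b s ^ 4 / (2 * D)"
      proof (cases "1 + \<rho> s \<le> Re s")
        case True
        \<comment> \<open>Doubling the imaginary part only moves the point away from 1, so the third
          factor of the 3-4-1 product is also evaluated outside the disc.\<close>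
        have "norm (s - 1) \<le> norm (Complex (Re s) (2 * Im s) - 1)"
          unfolding cmod_def by (auto simp: power2_eq_square)
        then have "norm (Z s) \<ge> l ^ 3 * b s ^ 4 / D" using Zlow[OF True s(2)] False by auto
        moreover have "l ^ 3 * b s ^ 4 / (2 * D) \<le> l ^ 3 * b s ^ 4 / D"
          using D l b4 by (intro divide_left_mono) auto
        ultimately show ?thesis by simp
      next
        case F2: False
        have "norm (s - 1) \<le> \<bar>Re s - 1\<bar> + \<bar>Im s\<bar>" using cmod_le[of "s - 1"] by simp
        moreover have "\<bar>Re s - 1\<bar> \<le> r / 2" using s1 F2 \<rho>(2)[of s] l(5) by linarith
        ultimately have t: "\<bar>Im s\<bar> \<ge> r / 2" using False by auto
        \<comment> \<open>The point of the same height on the abscissa 1 + \<rho>: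
          \<open>Zlow\<close> holds there and \<open>Zlip\<close> carries the bound back to
          \<open>s\<close>.\<close>
        define s' where "s' = Complex (1 + \<rho> s) (Im s)"
        have bs': "b s' = b s" "\<rho> s' = \<rho> s" by (auto simp: b_def \<rho>_def s'_def)
        have "norm (Z s') \<ge> l ^ 3 * b s' ^ 4 / D"
        proof (rule Zlow)
          show "1 + \<rho> s' \<le> Re s'" "Re s' \<le> 3" using \<rho>[of s] l unfolding bs' by (auto simp: s'_def)
          have "r \<le> \<bar>2 * Im s\<bar>" using t by simp
          also have "\<dots> \<le> norm (Complex (Re s') (2 * Im s') - 1)"
            using abs_Im_le_cmod[of "Complex (Re s') (2 * Im s') - 1"] by (simp add: s'_def)
          finally show "r \<le> norm (Complex (Re s') (2 * Im s') - 1)" .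
        qed
        moreover have "norm (Z s - Z s') \<le> C3 * hgt s powr \<eta> * \<bar>Re s - Re s'\<bar>"
          using t s s2 \<rho>[of s] l C by (intro Zlip) (auto simp: s'_def)
        moreover have "C3 * hgt s powr \<eta> * \<bar>Re s - Re s'\<bar> \<le> C3 * hgt s powr \<eta> * (2 * \<rho> s)"
          using s1 F2 C3 by (intro mult_left_mono) (auto simp: s'_def)
        moreover have "C3 * hgt s powr \<eta> * (2 * \<rho> s) \<le> l ^ 3 * b s ^ 4 / (2 * D)"
        proof -
          have "C3 * hgt s powr \<eta> * (2 * \<rho> s) = 2 * C3 * l ^ 4 * b s ^ 4 * (b s * hgt s powr \<eta>)"
            by (simp add: \<rho>_def power_numeral_reduce)
          also have "\<dots> = (l ^ 3 * b s ^ 4) * (2 * C3 * l)" unfolding b(3) by (simp add: power_numeral_reduce)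
          also have "\<dots> \<le> (l ^ 3 * b s ^ 4) * (1 / (2 * D))"
            using l b4 C3 D by (intro mult_left_mono) (auto simp: field_simps)
          finally show ?thesis by simp
        qed
        moreover have "norm (Z s) \<ge> norm (Z s') - norm (Z s - Z s')"
          using norm_triangle_ineq2[of "Z s'" "Z s"] by (simp add: norm_minus_commute)
        moreover have "l ^ 3 * b s' ^ 4 / D = l ^ 3 * b s ^ 4 / (2 * D) + l ^ 3 * b s ^ 4 / (2 * D)"
          using D unfolding bs' by (simp add: field_simps)
        ultimately show ?thesis by linarith
      qed
      then have "r * (l ^ 3 * b s ^ 4 / (2 * D)) \<le> norm (s - 1) * norm (Z s)"
        using False r l b4 D by (intro mult_mono) auto
      moreover have "c * b s ^ 4 \<le> r * l ^ 3 / (2 * D) * b s ^ 4" using c b4 by (intro mult_right_mono) auto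
      moreover have "norm (zeta_cleared s) = norm (s - 1) * norm (Z s)" using False r by (subst FZ) (auto simp: norm_mult)
      ultimately show ?thesis unfolding bpow by simp
    qed
  qed
qed

lemma zeta_cleared_lower_bound:
  assumes "\<eta> > 0"
  obtains c where "c > 0"
    "\<And>s. 1 - c * hgt s powr (- \<eta>) \<le> Re s \<Longrightarrow> Re s \<le> 3 \<Longrightarrow> norm (zeta_cleared s) \<ge> c * hgt s powr (- \<eta>)"
proof -
  obtain c where c: "c > 0"
    "\<And>s. 1 - c * hgt s powr (- 5 * (\<eta> / 5)) \<le> Re s \<Longrightarrow> Re s \<le> 3 \<Longrightarrow> norm (zeta_cleared s) \<ge> c * hgt s powr (- 4 * (\<eta> / 5))"
    using zeta_cleared_lower_bound_pre[of "\<eta> / 5"] assms by auto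
  show ?thesis
  proof
    show "c > 0" by (rule c)
    fix s assume s: "1 - c * hgt s powr (- \<eta>) \<le> Re s" "Re s \<le> 3"
    have "c * hgt s powr (- \<eta>) \<le> c * hgt s powr (- 4 * (\<eta> / 5))"
      using assms c by (intro mult_left_mono powr_mono) auto
    also have "\<dots> \<le> norm (zeta_cleared s)" using c(2)[of s] s by simp
    finally show "norm (zeta_cleared s) \<ge> c * hgt s powr (- \<eta>)" .
  qed
qed

text \<open>This is \<open>-\<zeta>'/\<zeta> - \<zeta>\<close>, written so that it is holomorphic at \<open>s = 1\<close>.\<close>

definition mangoldt_defect :: "complex \<Rightarrow> complex" where
  "mangoldt_defect s = - (deriv zeta_cleared s / zeta_cleared s) - zeta_regular s"

lemma mangoldt_defect_eq_dirichlet: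
  assumes s: "Re s > 1"
  shows "mangoldt_defect s = dirichlet (\<lambda>n. mangoldt n - 1) s"
proof -
  let ?Z = "dirichlet (\<lambda>_. 1)"
  have s1: "s \<noteq> 1" using s by auto
  have Z0: "?Z s \<noteq> 0" using dirichlet_one_eq_exp[OF s] by simp
  have "((\<lambda>s. (s - 1) * ?Z s) has_field_derivative (?Z s - (s - 1) * dirichlet (\<lambda>n. ln (real n)) s)) (at s)"
    using DERIV_dirichlet[OF dirichlet_abs_const[of 1] s] by (auto intro!: derivative_eq_intros)
  then have "(zeta_cleared has_field_derivative (?Z s - (s - 1) * dirichlet (\<lambda>n. ln (real n)) s)) (at s)"
    by (rule has_field_derivative_transform_within_open[where S = "{z. Re z > 1}"])
       (use s in \<open>auto simp: open_halfspace_Re_gt zeta_cleared_eq\<close>)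
  then have "deriv zeta_cleared s = ?Z s - (s - 1) * dirichlet (\<lambda>n. ln (real n)) s" by (rule DERIV_imp_deriv)
  then have 1: "deriv zeta_cleared s = ?Z s - (s - 1) * (dirichlet mangoldt s * ?Z s)"
    by (simp add: dirichlet_mangoldt_mult[OF s])
  have 2: "zeta_regular s = ((s - 1) * ?Z s - 1) / (s - 1)" using s1 by (simp add: zeta_regular_def zeta_cleared_eq[OF s])
  define w where "w = s - 1"
  have w: "w \<noteq> 0" using s1 by (simp add: w_def)
  have 3: "(?Z s - w * (dirichlet mangoldt s * ?Z s)) / (w * ?Z s) = 1 / w - dirichlet mangoldt s"
    using w Z0 by (simp add: diff_divide_distrib)
  have 4: "(w * ?Z s - 1) / w = ?Z s - 1 / w" using w by (simp add: diff_divide_distrib)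
  have "mangoldt_defect s = dirichlet mangoldt s - ?Z s"
    unfolding mangoldt_defect_def 1 2 zeta_cleared_eq[OF s] w_def[symmetric] 3 4 by simp
  then show ?thesis by (simp add: dirichlet_diff dirichlet_abs_mangoldt dirichlet_abs_const s)
qed

lemma holomorphic_mangoldt_defect: "mangoldt_defect holomorphic_on {s. Re s > 0 \<and> zeta_cleared s \<noteq> 0}"
proof -
  have "deriv zeta_cleared holomorphic_on {s. Re s > 0}"
    by (intro holomorphic_deriv holomorphic_zeta_cleared open_halfspace_Re_gt)
  then show ?thesis unfolding mangoldt_defect_def[abs_def]
    using holomorphic_zeta_cleared holomorphic_zeta_regular
    by (intro holomorphic_on_diff holomorphic_on_minus holomorphic_on_divide)
       (auto elim!: holomorphic_on_subset)
qed

text \<open>The exponent 2 does not depend on \<open>k\<close>: Cauchy's estimate is applied on discs whose radius is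
about \<open>|Im s|^{-1/(k+2)}\<close>.\<close>

lemma dirichlet_mangoldt_minus_one_bound:
  obtains C where "C > 0" "\<And>s. 1 < Re s \<Longrightarrow> Re s \<le> 2 \<Longrightarrow>
    norm (dirichlet (\<lambda>n. (mangoldt n - 1) * ln (real n) ^ k) s) \<le> C * hgt s ^ 2"
proof -
  \<comment> \<open>With M = h^\<eta>, the function is at most B M^2 h on a disc of radius of order
    1/M, so its k-th derivative is at most a constant times M^(k + 2) h; this \<eta> makes it
    h^2.\<close>
  define \<eta> where "\<eta> = 1 / (real k + 2)"
  have \<eta>: "0 < \<eta>" "\<eta> \<le> 1" by (auto simp: \<eta>_def)
  obtain c where c: "c > 0"
    "\<And>s. 1 - c * hgt s powr (- \<eta>) \<le> Re s \<Longrightarrow> Re s \<le> 3 \<Longrightarrow> norm (zeta_cleared s) \<ge> c * hgt s powr (- \<eta>)"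
    using zeta_cleared_lower_bound[OF \<eta>(1)] by blast
  obtain C e where C: "C > 0" "0 < e" "e < 1/2"
    and H: "\<And>s. 1 - e \<le> Re s \<Longrightarrow> Re s \<le> 4 \<Longrightarrow> norm (zeta_regular s) \<le> C * hgt s powr \<eta>"
    and H': "\<And>s. 1 - e \<le> Re s \<Longrightarrow> Re s \<le> 3 \<Longrightarrow> norm (deriv zeta_regular s) \<le> C * hgt s powr \<eta>"
    using zeta_regular_bound[OF \<eta>(1)] by blast
  \<comment> \<open>Halving \<open>c\<close> allows for heights up to 2h on the disc: as 2^(-\<eta>)
    >= 1/2, every point of the disc still lies in the region of the lower bound.\<close>
  define c' where "c' = min (c / 2) e"
  have c': "c' > 0" "c' \<le> c / 2" "c' \<le> e" using c C by (auto simp: c'_def)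
  define B where "B = 12 * C / c + 2 * C"
  have B: "B > 0" using C c by (auto simp: B_def intro!: add_pos_pos)
  show ?thesis
  proof
    show "fact k * B / c' ^ k > 0" using B c' by simp
    fix s :: complex assume s: "1 < Re s" "Re s \<le> 2"
    define h where "h = hgt s"
    define M where "M = h powr \<eta>"
    have h: "h \<ge> 2" by (simp add: h_def)
    have M: "M \<ge> 1" unfolding M_def using h \<eta> by (intro ge_one_powr_ge_zero) auto
    have hM: "h powr (- \<eta>) = 1 / M" by (simp add: M_def powr_minus_divide)
    define r where "r = c' / M"
    have r: "0 < r" "r \<le> e" "r \<le> c / (2 * M)"
    proof -
      show "0 < r" using c' M by (simp add: r_def)
      have "c' / M \<le> c' / 1" using c' M by (intro divide_left_mono) auto
      then show "r \<le> e" using c' by (simp add: r_def)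
      have "c' / M \<le> c / 2 / M" using c' M by (intro divide_right_mono) auto
      then show "r \<le> c / (2 * M)" by (simp add: r_def)
    qed
    have sub: "1 - r \<le> Re z \<and> Re z \<le> 3 \<and> hgt z \<le> 2 * h \<and> norm (z - 1) \<le> 2 * h" if "norm (s - z) \<le> r" for z
    proof -
      have "\<bar>Re s - Re z\<bar> \<le> r" "\<bar>Im s - Im z\<bar> \<le> r"
        using that abs_Re_le_cmod[of "s - z"] abs_Im_le_cmod[of "s - z"] by auto
      moreover have "norm (z - 1) \<le> \<bar>Re z - 1\<bar> + \<bar>Im z\<bar>" using cmod_le[of "z - 1"] by simp
      ultimately show ?thesis using s r C unfolding h_def by auto
    qed
    have low: "norm (zeta_cleared z) \<ge> c / (2 * M)" if z: "norm (s - z) \<le> r" for z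
    proof -
      have "1 / (2 * M) \<le> 2 powr (- \<eta>) * (1 / M)"
        using powr_mono[of "-1" "-\<eta>" "2::real"] \<eta> M by (simp add: powr_minus_divide field_simps)
      also have "\<dots> = (2 * h) powr (- \<eta>)" unfolding hM[symmetric] by (rule powr_mult[symmetric])
      also have "\<dots> \<le> hgt z powr (- \<eta>)" using sub[OF z] \<eta> h by (intro powr_mono2') auto
      finally have "c * (1 / (2 * M)) \<le> c * hgt z powr (- \<eta>)" using c by (intro mult_left_mono) auto
      moreover from this have "1 - c * hgt z powr (- \<eta>) \<le> Re z" using sub[OF z] r by simp
      ultimately show ?thesis using c(2)[of z] sub[OF z] by simp
    qed
    have hz: "hgt z powr \<eta> \<le> 2 * M" if z: "norm (s - z) \<le> r" for z
    proof -
      have "hgt z powr \<eta> \<le> (2 * h) powr \<eta>" using sub[OF z] \<eta> h by (intro powr_mono2) auto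
      also have "\<dots> = 2 powr \<eta> * M" unfolding M_def by (rule powr_mult)
      also have "2 powr \<eta> * M \<le> 2 powr 1 * M" using \<eta> M by (intro mult_right_mono powr_mono) auto
      finally show ?thesis by simp
    qed
    have Gb: "norm (mangoldt_defect z) \<le> B * M ^ 2 * h" if z: "norm (s - z) \<le> r" for z
    proof -
      have Re_z: "1 - e \<le> Re z" "Re z \<le> 3" using sub[OF z] r by auto
      have hd: "zeta_regular field_differentiable at z"
        using holomorphic_zeta_regular by (rule holomorphic_on_imp_differentiable_at) (use Re_z C in \<open>auto simp: open_halfspace_Re_gt\<close>)
      have F: "zeta_cleared = (\<lambda>s. 1 + (s - 1) * zeta_regular s)" by (rule ext) (rule zeta_cleared_zeta_regular)
      have "(zeta_regular has_field_derivative deriv zeta_regular z) (at z)"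
        using hd by (simp add: field_differentiable_derivI)
      then have "(zeta_cleared has_field_derivative (zeta_regular z + (z - 1) * deriv zeta_regular z)) (at z)"
        unfolding F by (auto intro!: derivative_eq_intros)
      then have "deriv zeta_cleared z = zeta_regular z + (z - 1) * deriv zeta_regular z" by (rule DERIV_imp_deriv)
      then have "norm (deriv zeta_cleared z) \<le> norm (zeta_regular z) + norm (z - 1) * norm (deriv zeta_regular z)"
        using norm_triangle_ineq[of "zeta_regular z" "(z - 1) * deriv zeta_regular z"] by (simp add: norm_mult)
      also have "\<dots> \<le> C * (2 * M) + (2 * h) * (C * (2 * M))"
      proof (intro add_mono mult_mono)
        show "norm (zeta_regular z) \<le> C * (2 * M)" using H[of z] Re_z hz[OF z] C mult_left_mono[of "hgt z powr \<eta>" "2 * M" C] by linarith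
        show "norm (deriv zeta_regular z) \<le> C * (2 * M)" using H'[of z] Re_z hz[OF z] C mult_left_mono[of "hgt z powr \<eta>" "2 * M" C] by linarith
      qed (use sub[OF z] h in auto)
      also have "\<dots> \<le> 6 * C * M * h"
        using mult_left_mono[of 1 h "2 * C * M"] h C M by (simp add: algebra_simps)
      finally have 1: "norm (deriv zeta_cleared z) \<le> 6 * C * M * h" .
      have F0: "norm (zeta_cleared z) > 0" using low[OF z] c M by (smt (verit) divide_pos_pos)
      have "norm (deriv zeta_cleared z / zeta_cleared z) \<le> (6 * C * M * h) / (c / (2 * M))"
        unfolding norm_divide using 1 low[OF z] c M h C by (intro frac_le) auto
      also have "\<dots> = 12 * C / c * M ^ 2 * h" using c M by (simp add: field_simps power2_eq_square)
      finally have 2: "norm (deriv zeta_cleared z / zeta_cleared z) \<le> 12 * C / c * M ^ 2 * h" .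
      have "norm (zeta_regular z) \<le> 2 * C * M" using H[of z] Re_z hz[OF z] C mult_left_mono[of "hgt z powr \<eta>" "2 * M" C] by linarith
      also have "2 * C * M \<le> 2 * C * (M ^ 2 * h)"
      proof -
        have "M * 1 \<le> M * (M * h)" using M h mult_mono[of 1 M 1 h] by (intro mult_left_mono) auto
        then have "M \<le> M ^ 2 * h" by (simp add: power2_eq_square mult_ac)
        then show ?thesis using C by (simp add: mult_left_mono)
      qed
      finally have 3: "norm (zeta_regular z) \<le> 2 * C * (M ^ 2 * h)" .
      have "norm (mangoldt_defect z) \<le> norm (deriv zeta_cleared z / zeta_cleared z) + norm (zeta_regular z)"
        unfolding mangoldt_defect_def using norm_triangle_ineq4[of "- (deriv zeta_cleared z / zeta_cleared z)" "zeta_regular z"] by simp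
      also have "\<dots> \<le> B * M ^ 2 * h" using 2 3 by (simp add: B_def algebra_simps)
      finally show ?thesis .
    qed
    have dom: "cball s r \<subseteq> {s. Re s > 0 \<and> zeta_cleared s \<noteq> 0}"
    proof
      fix z assume "z \<in> cball s r"
      then have z: "norm (s - z) \<le> r" by (simp add: dist_norm)
      have "0 < c / (2 * M)" using c M by simp
      then show "z \<in> {s. Re s > 0 \<and> zeta_cleared s \<noteq> 0}" using sub[OF z] low[OF z] r C by auto
    qed
    have "norm ((deriv ^^ k) mangoldt_defect s) \<le> fact k * (B * M ^ 2 * h) / r ^ k"
    proof (rule Cauchy_inequality)
      show "mangoldt_defect holomorphic_on ball s r"
        using dom ball_subset_cball by (intro holomorphic_on_subset[OF holomorphic_mangoldt_defect]) blast
      show "continuous_on (cball s r) mangoldt_defect"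
        by (rule continuous_on_subset[OF holomorphic_on_imp_continuous_on[OF holomorphic_mangoldt_defect] dom])
    qed (use r Gb in auto)
    also have "(deriv ^^ k) mangoldt_defect s = (deriv ^^ k) (dirichlet (\<lambda>n. mangoldt n - 1)) s"
    proof (rule higher_deriv_cong_ev)
      have "\<forall>\<^sub>F z in nhds s. z \<in> {z. Re z > 1}"
        using s by (intro eventually_nhds_in_open open_halfspace_Re_gt) auto
      then show "\<forall>\<^sub>F z in nhds s. mangoldt_defect z = dirichlet (\<lambda>n. mangoldt n - 1) z"
        by eventually_elim (auto intro: mangoldt_defect_eq_dirichlet)
    qed auto
    also have "\<dots> = (-1) ^ k * dirichlet (\<lambda>n. (mangoldt n - 1) * ln (real n) ^ k) s"
      by (intro higher_deriv_dirichlet dirichlet_abs_diff dirichlet_abs_mangoldt dirichlet_abs_const s)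
    also have "norm \<dots> = norm (dirichlet (\<lambda>n. (mangoldt n - 1) * ln (real n) ^ k) s)"
      by (simp add: norm_mult norm_power)
    also have "fact k * (B * M ^ 2 * h) / r ^ k = fact k * B / c' ^ k * (M ^ (k + 2) * h)"
      using c' M by (simp add: r_def power_divide power_add power2_eq_square field_simps)
    also have "M ^ (k + 2) = h"
    proof -
      have "real (k + 2) * \<eta> = 1" by (simp add: \<eta>_def)
      moreover have "M ^ (k + 2) = h powr (real (k + 2) * \<eta>)"
        using h unfolding M_def by (subst powr_power) (auto simp: mult.commute)
      ultimately show ?thesis using h by simp
    qed
    finally show "norm (dirichlet (\<lambda>n. (mangoldt n - 1) * ln (real n) ^ k) s) \<le> fact k * B / c' ^ k * hgt s ^ 2"
      by (simp add: h_def power2_eq_square)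
  qed
qed

subsection \<open>A Gaussian Perron kernel\<close>

abbreviation (input) "stdN \<equiv> std_normal_distribution"

lemma integrable_stdN_iff:
  fixes f :: "real \<Rightarrow> 'b :: {banach, second_countable_topology}"
  assumes "f \<in> borel_measurable borel"
  shows "integrable stdN f \<longleftrightarrow> integrable lborel (\<lambda>x. std_normal_density x *\<^sub>R f x)"
  using assms by (intro integrable_density) auto

lemma integral_stdN:
  fixes f :: "real \<Rightarrow> 'b :: {banach, second_countable_topology}"
  assumes "f \<in> borel_measurable borel"
  shows "integral\<^sup>L stdN f = (LBINT x. std_normal_density x *\<^sub>R f x)"
  using assms by (intro integral_density) auto

text \<open>Completing the square: an exponential tilt by \<open>a\<close> shifts the mean of the
  normal law to \<open>a\<close>. All exponential moments follow.\<close>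

lemma std_normal_density_exp: "std_normal_density x * exp (a * x) = exp (a\<^sup>2 / 2) * normal_density a 1 x"
  by (simp add: normal_density_def exp_add[symmetric] power2_eq_square field_simps)

lemma exp_stdN:
  shows "integrable stdN (\<lambda>x. exp (a * x))" "(LINT x|stdN. exp (a * x)) = exp (a\<^sup>2 / 2)"
proof -
  show "integrable stdN (\<lambda>x. exp (a * x))"
    by (subst integrable_stdN_iff) (auto simp: std_normal_density_exp integrable_normal_density)
  show "(LINT x|stdN. exp (a * x)) = exp (a\<^sup>2 / 2)"
    by (subst integral_stdN) (auto simp: std_normal_density_exp integral_normal_density)
qed

lemma prob_space_stdN: "prob_space stdN"
  using real_dist_normal_dist unfolding real_distribution_def by auto

lemma set_integrable_exp_lessThan:
  fixes V \<sigma> :: real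
  assumes "\<sigma> > 0"
  shows "set_integrable lborel {..<V} (\<lambda>u. exp (\<sigma> * u))" "(LBINT u:{..<V}. exp (\<sigma> * u)) = exp (\<sigma> * V) / \<sigma>"
proof -
  have 1: "((\<lambda>u. exp (\<sigma> * u) / \<sigma>) \<longlongrightarrow> 0 / \<sigma>) at_bot"
    using assms by (intro tendsto_divide tendsto_const filterlim_compose[OF exp_at_bot]
       filterlim_tendsto_pos_mult_at_bot[OF tendsto_const _ filterlim_ident]) auto
  have 2: "((\<lambda>u. exp (\<sigma> * u) / \<sigma>) \<longlongrightarrow> exp (\<sigma> * V) / \<sigma>) (at_left V)"
    using assms by (intro tendsto_intros) auto
  note * = interval_integral_FTC_nonneg[of "-\<infinity>" "ereal V" "\<lambda>u. exp (\<sigma> * u) / \<sigma>" "\<lambda>u. exp (\<sigma> * u)" 0 "exp (\<sigma> * V) / \<sigma>"]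
  have "set_integrable lborel (einterval (-\<infinity>) V) (\<lambda>u. exp (\<sigma> * u))"
    by (rule *) (use 1 2 assms in \<open>auto intro!: derivative_eq_intros simp: ereal_tendsto_simps\<close>)
  then show "set_integrable lborel {..<V} (\<lambda>u. exp (\<sigma> * u))" by (simp add: )
  have "(LBINT u=-\<infinity>..ereal V. exp (\<sigma> * u)) = exp (\<sigma> * V) / \<sigma> - 0"
    by (rule *) (use 1 2 assms in \<open>auto intro!: derivative_eq_intros simp: ereal_tendsto_simps\<close>)
  then show "(LBINT u:{..<V}. exp (\<sigma> * u)) = exp (\<sigma> * V) / \<sigma>"
    by (simp add: interval_lebesgue_integral_def)
qed

lemma set_integrable_cexp_lessThan:
  fixes V :: real and c :: complex
  assumes "Re c > 0"
  shows "set_integrable lborel {..<V} (\<lambda>u. exp (c * of_real u))"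
    "(LBINT u:{..<V}. exp (c * of_real u)) = exp (c * of_real V) / c"
proof -
  have n: "norm (exp (c * of_real u)) = exp (Re c * u)" for u by simp
  show si: "set_integrable lborel {..<V} (\<lambda>u. exp (c * of_real u))"
    unfolding set_integrable_def
    by (rule Bochner_Integration.integrable_bound[OF set_integrable_exp_lessThan(1)[OF assms, of V, unfolded set_integrable_def]])
       (auto simp: indicator_def)
  have c: "c \<noteq> 0" using assms by auto
  have 1: "((\<lambda>u. exp (c * of_real u) / c) \<longlongrightarrow> 0) at_bot"
  proof (rule tendsto_norm_zero_cancel)
    have "((\<lambda>u. exp (Re c * u) / norm c) \<longlongrightarrow> 0 / norm c) at_bot"
      using assms c by (intro tendsto_divide tendsto_const filterlim_compose[OF exp_at_bot]
        filterlim_tendsto_pos_mult_at_bot[OF tendsto_const _ filterlim_ident]) auto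
    then show "((\<lambda>u. norm (exp (c * of_real u) / c)) \<longlongrightarrow> 0) at_bot" by (simp add: norm_divide)
  qed
  have 2: "((\<lambda>u. exp (c * of_real u) / c) \<longlongrightarrow> exp (c * of_real V) / c) (at_left V)"
    using c by (intro tendsto_intros) auto
  have "(LBINT u=-\<infinity>..ereal V. exp (c * of_real u)) = exp (c * of_real V) / c - 0"
  proof (rule interval_integral_FTC_integrable)
    fix x :: real
    have "((\<lambda>z. exp (c * z) / c) has_field_derivative exp (c * of_real x)) (at (of_real x))"
      using c by (auto intro!: derivative_eq_intros)
    then show "((\<lambda>u. exp (c * of_real u) / c) has_vector_derivative exp (c * of_real x)) (at x)"
      by (rule has_vector_derivative_real_field)
  qed (use 1 2 si in \<open>auto intro!: continuous_intros simp: ereal_tendsto_simps\<close>)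
  then show "(LBINT u:{..<V}. exp (c * of_real u)) = exp (c * of_real V) / c"
    by (simp add: interval_lebesgue_integral_def)
qed

text \<open>A smooth step of width \<open>\<delta>\<close> at 0, with limit \<open>exp ((\<sigma> \<delta>)^2 / 2)\<close> at infinity.\<close>

definition gauss_step :: "real \<Rightarrow> real \<Rightarrow> real \<Rightarrow> real" where
  "gauss_step \<sigma> \<delta> V = (LINT w|stdN. indicator {..<V / \<delta>} w * exp (\<sigma> * \<delta> * w))"

text \<open>Chernoff's bound on both sides of the step: the indicator is at most exp (V/\<delta> -
  w) and its complement at most exp (w - V/\<delta>). The moments have parameters \<sigma>\<delta> -
  1 and \<sigma>\<delta> + 1, of absolute value at most 2, whence the constant exp 2.\<close>

lemma gauss_step_bounds:
  assumes "\<delta> > 0" "\<sigma> > 0" "\<sigma> * \<delta> \<le> 1"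
  shows "\<bar>gauss_step \<sigma> \<delta> V - exp ((\<sigma> * \<delta>)\<^sup>2 / 2) * of_bool (V \<ge> 0)\<bar> \<le> exp 2 * exp (- \<bar>V\<bar> / \<delta>)"
proof -
  let ?a = "\<sigma> * \<delta>"
  have int: "integrable stdN (\<lambda>w. indicator A w * exp (?a * w))" if "A \<in> sets borel" for A
    by (rule Bochner_Integration.integrable_bound[OF exp_stdN(1)[of ?a]]) (use that in \<open>auto simp: indicator_def\<close>)
  show ?thesis
  proof (cases "V \<ge> 0")
    case False
    have "gauss_step \<sigma> \<delta> V \<le> (LINT w|stdN. exp (V / \<delta>) * exp ((?a - 1) * w))"
      unfolding gauss_step_def
    proof (rule integral_mono)
      fix w
      show "indicator {..<V / \<delta>} w * exp (?a * w) \<le> exp (V / \<delta>) * exp ((?a - 1) * w)"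
        by (auto simp: indicator_def exp_add[symmetric] algebra_simps)
    qed (auto intro!: int exp_stdN)
    also have "\<dots> = exp (V / \<delta>) * exp ((?a - 1)\<^sup>2 / 2)" by (simp add: exp_stdN)
    also have "\<dots> \<le> exp (V / \<delta>) * exp 2"
    proof -
      have "?a > 0" using assms by simp
      then have "(?a - 1)\<^sup>2 \<le> 1" using assms(3) by (simp add: abs_square_le_1)
      then show ?thesis by simp
    qed
    finally show ?thesis using False 
      by (auto simp: gauss_step_def mult.commute intro!: integral_nonneg_AE)
  next
    case True
    have "exp (?a\<^sup>2 / 2) - gauss_step \<sigma> \<delta> V = (LINT w|stdN. exp (?a * w) - indicator {..<V / \<delta>} w * exp (?a * w))"
      unfolding gauss_step_def by (subst Bochner_Integration.integral_diff) (auto intro!: int exp_stdN simp: exp_stdN)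
    also have "\<dots> \<le> (LINT w|stdN. exp (- V / \<delta>) * exp ((?a + 1) * w))"
    proof (rule integral_mono)
      fix w
      show "exp (?a * w) - indicator {..<V / \<delta>} w * exp (?a * w) \<le> exp (- V / \<delta>) * exp ((?a + 1) * w)"
        by (auto simp: indicator_def exp_add[symmetric] algebra_simps)
    qed (auto intro!: int exp_stdN)
    also have "\<dots> = exp (- V / \<delta>) * exp ((?a + 1)\<^sup>2 / 2)" by (simp add: exp_stdN)
    also have "\<dots> \<le> exp (- V / \<delta>) * exp 2"
    proof -
      have "(?a + 1)\<^sup>2 \<le> 2 ^ 2" using assms by (intro power_mono) auto
      then show ?thesis by simp
    qed
    finally have 1: "exp (?a\<^sup>2 / 2) - gauss_step \<sigma> \<delta> V \<le> exp 2 * exp (- V / \<delta>)" by (simp add: mult.commute)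
    have "gauss_step \<sigma> \<delta> V \<le> (LINT w|stdN. exp (?a * w))"
      unfolding gauss_step_def by (intro integral_mono int exp_stdN) (auto simp: indicator_def)
    then have "gauss_step \<sigma> \<delta> V \<le> exp (?a\<^sup>2 / 2)" by (simp add: exp_stdN)
    then show ?thesis using 1 True by simp
  qed
qed

text \<open>For c = \<open>Complex \<sigma> (\<tau> / \<delta>)\<close>, exp (c V) / c is the
  integral of exp (c u) over u < V. After interchanging, the integral over \<tau> is the
  characteristic function of the normal law at u / \<delta>, again a Gaussian; u = \<delta> w then
  produces \<open>gauss_step\<close>, and sqrt (2 pi) accounts for the normalisation of the
  density.\<close>

lemma Gaussian_Perron:
  assumes "\<delta> > 0" "\<sigma> > 0"
  shows "(LINT \<tau>|stdN. exp (Complex \<sigma> (\<tau> / \<delta>) * of_real V) / Complex \<sigma> (\<tau> / \<delta>))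
     = of_real (\<delta> * sqrt (2 * pi) * gauss_step \<sigma> \<delta> V)"
proof -
  let ?f = "\<lambda>\<tau> u. indicator {..<V} u *\<^sub>R exp (Complex \<sigma> (\<tau> / \<delta>) * of_real u)"
  interpret N: prob_space stdN by (rule prob_space_stdN)
  interpret P: pair_sigma_finite stdN lborel ..
  have meas: "(\<lambda>(\<tau>, u). ?f \<tau> u) \<in> borel_measurable (stdN \<Otimes>\<^sub>M lborel)"
    unfolding complex_eq Complex_eq by measurable
  have in1: "integrable lborel (?f \<tau>)" for \<tau>
    using set_integrable_cexp_lessThan(1)[of "Complex \<sigma> (\<tau> / \<delta>)" V] assms by (simp add: set_integrable_def)
  have int: "integrable (stdN \<Otimes>\<^sub>M lborel) (\<lambda>(\<tau>, u). ?f \<tau> u)"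
  proof (rule P.Fubini_integrable[OF meas])
    have "(LBINT u. norm (?f \<tau> u)) = exp (\<sigma> * V) / \<sigma>" for \<tau>
      using set_integrable_exp_lessThan(2)[OF assms(2), of V] by (simp add: set_lebesgue_integral_def)
    then show "integrable stdN (\<lambda>\<tau>. LBINT u. norm (case (\<tau>, u) of (\<tau>, u) \<Rightarrow> ?f \<tau> u))" by simp
    show "AE \<tau> in stdN. integrable lborel (\<lambda>u. case (\<tau>, u) of (\<tau>, u) \<Rightarrow> ?f \<tau> u)"
      using in1 by simp
  qed
  have "(LINT \<tau>|stdN. exp (Complex \<sigma> (\<tau> / \<delta>) * of_real V) / Complex \<sigma> (\<tau> / \<delta>)) = (LINT \<tau>|stdN. (LBINT u. ?f \<tau> u))"
    using set_integrable_cexp_lessThan(2)[of "Complex \<sigma> (_ / \<delta>)" V] assms by (simp add: set_lebesgue_integral_def)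
  also have "\<dots> = (LBINT u. (LINT \<tau>|stdN. ?f \<tau> u))"
    using P.Fubini_integral[OF int] by simp
  also have "\<dots> = (LBINT u. of_real (indicator {..<V} u * (exp (\<sigma> * u) * exp (- (u / \<delta>)\<^sup>2 / 2))))"
  proof (rule Bochner_Integration.integral_cong[OF refl])
    fix u :: real
    have eq: "?f \<tau> u = of_real (indicator {..<V} u * exp (\<sigma> * u)) * iexp (u / \<delta> * \<tau>)" for \<tau>
      by (simp add: Complex_eq scaleR_conv_of_real ring_distribs exp_add mult_ac exp_of_real[symmetric])
    have "(LINT \<tau>|stdN. ?f \<tau> u) = of_real (indicator {..<V} u * exp (\<sigma> * u)) * (LINT \<tau>|stdN. iexp (u / \<delta> * \<tau>))"
      unfolding eq by (rule integral_mult_right_zero)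
    also have "(LINT \<tau>|stdN. iexp (u / \<delta> * \<tau>)) = of_real (exp (- (u / \<delta>)\<^sup>2 / 2))"
      using fun_cong[OF char_std_normal_distribution, of "u / \<delta>"] by (simp add: char_def)
    finally show "(LINT \<tau>|stdN. ?f \<tau> u) = of_real (indicator {..<V} u * (exp (\<sigma> * u) * exp (- (u / \<delta>)\<^sup>2 / 2)))"
      by simp
  qed
  also have "\<dots> = of_real (LBINT u. indicator {..<V} u * (exp (\<sigma> * u) * exp (- (u / \<delta>)\<^sup>2 / 2)))"
    by (rule integral_complex_of_real)
  also have "(LBINT u. indicator {..<V} u * (exp (\<sigma> * u) * exp (- (u / \<delta>)\<^sup>2 / 2)))
     = \<delta> * (LBINT w. indicator {..<V / \<delta>} w * (exp (\<sigma> * \<delta> * w) * exp (- w\<^sup>2 / 2)))"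
    by (subst lborel_integral_real_affine[where c = \<delta> and t = 0])
       (use assms in \<open>auto simp: indicator_def field_simps intro!: arg_cong[where f = "\<lambda>x. \<delta> * x"] Bochner_Integration.integral_cong\<close>)
  also have "(LBINT w. indicator {..<V / \<delta>} w * (exp (\<sigma> * \<delta> * w) * exp (- w\<^sup>2 / 2)))
     = sqrt (2 * pi) * (LBINT w. std_normal_density w *\<^sub>R (indicator {..<V / \<delta>} w * exp (\<sigma> * \<delta> * w)))"
    by (subst integral_mult_right_zero[symmetric]) 
       (auto simp: std_normal_density_def intro!: Bochner_Integration.integral_cong)
  also have "(LBINT w. std_normal_density w *\<^sub>R (indicator {..<V / \<delta>} w * exp (\<sigma> * \<delta> * w))) = gauss_step \<sigma> \<delta> V"
    unfolding gauss_step_def by (subst integral_stdN) auto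
  finally show ?thesis by (simp add: mult_ac)
qed

subsection \<open>The prime number theorem with a logarithmic-power error term\<close>

lemma one_plus_ln_power_le_powr:
  fixes e :: real
  assumes "e > 0"
  obtains C where "C > 0" "\<And>r. r \<ge> 1 \<Longrightarrow> (1 + ln r) ^ j \<le> C * r powr e"
proof
  define c where "c = 1 + (real j + 1) / e"
  have c: "c > 0" using assms by (auto simp: c_def intro!: add_pos_nonneg)
  show "c ^ j > 0" using c by simp
  fix r :: real assume r: "r \<ge> 1"
  define a where "a = e / (real j + 1)"
  have a: "a > 0" "a * real j \<le> e" using assms by (auto simp: a_def field_simps)
  have "1 \<le> r powr a" using r a by (intro ge_one_powr_ge_zero) auto
  moreover have "ln r \<le> r powr a / a" using r a by (intro ln_powr_bound) auto
  moreover have "c * r powr a = r powr a + r powr a / a"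
    by (simp add: c_def a_def algebra_simps)
  ultimately have "1 + ln r \<le> c * r powr a" by linarith
  then have "(1 + ln r) ^ j \<le> (c * r powr a) ^ j" using r by (intro power_mono) auto
  also have "\<dots> = c ^ j * r powr (a * real j)"
    using r by (simp add: power_mult_distrib powr_power mult.commute)
  also have "\<dots> \<le> c ^ j * r powr e" using c r a by (intro mult_left_mono powr_mono) auto
  finally show "(1 + ln r) ^ j \<le> c ^ j * r powr e" .
qed

lemma second_moment_stdN: "integrable stdN (\<lambda>x. x ^ 2)" "(LINT x|stdN. x ^ 2) = 1"
  using integrable_std_normal_distribution_moment[of 2] std_normal_distribution_even_moments(1)[of 1]
  by auto

text \<open>The hypothesis on \<open>k\<close> removes the term \<open>n = 0\<close>, for which \<open>ln 0 = 0\<close>.\<close>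

lemma smoothed_sum_bound:
  assumes "k \<ge> 1"
  obtains C where "C > 0" "\<And>U \<delta>. U \<ge> 1 \<Longrightarrow> 0 < \<delta> \<Longrightarrow> \<delta> \<le> 1 \<Longrightarrow>
     \<bar>\<Sum>n. (mangoldt n - 1) * ln (real n) ^ k * gauss_step (1 + 1 / U) \<delta> (U - ln (real n))\<bar> \<le> C * exp U / \<delta> ^ 3"
proof -
  obtain C where C: "C > 0" "\<And>s. 1 < Re s \<Longrightarrow> Re s \<le> 2 \<Longrightarrow>
    norm (dirichlet (\<lambda>n. (mangoldt n - 1) * ln (real n) ^ k) s) \<le> C * hgt s ^ 2"
    by (rule dirichlet_mangoldt_minus_one_bound[of k]) blast
  interpret N: prob_space stdN by (rule prob_space_stdN)
  show ?thesis
  proof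
    show "10 * exp 1 * C > 0" using C by simp
    fix U \<delta> :: real assume U: "U \<ge> 1" and \<delta>: "0 < \<delta>" "\<delta> \<le> 1"
    \<comment> \<open>At this distance from the line, exp (\<sigma> U) exceeds exp U only by the
      factor e.\<close>
    define \<sigma> where "\<sigma> = 1 + 1 / U"
    have \<sigma>: "\<sigma> > 1" "\<sigma> \<le> 2" using U by (auto simp: \<sigma>_def)
    define b where "b = (\<lambda>n. (mangoldt n - 1) * ln (real n) ^ k)"
    have b0: "b 0 = 0" using assms by (simp add: b_def)
    have db: "dirichlet_abs b" unfolding b_def by (intro dirichlet_abs_ln_pow dirichlet_abs_diff dirichlet_abs_mangoldt dirichlet_abs_const)
    let ?s = "\<lambda>\<tau>. Complex \<sigma> (\<tau> / \<delta>)"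
    define f where "f = (\<lambda>n \<tau>. of_real (b n) * of_nat n powr (- ?s \<tau>) * (exp (?s \<tau> * of_real U) / ?s \<tau>))"
    have sne: "?s \<tau> \<noteq> 0" "norm (?s \<tau>) \<ge> 1" for \<tau>
      using \<sigma> abs_Re_le_cmod[of "?s \<tau>"] by (auto simp: complex_eq_iff)
    have E: "norm (exp (?s \<tau> * of_real U) / ?s \<tau>) \<le> exp (\<sigma> * U)" for \<tau>
      using divide_left_mono[of 1 "norm (?s \<tau>)" "exp (\<sigma> * U)"] sne[of \<tau>] by (simp add: norm_divide)
    define M where "M = (\<lambda>n. \<bar>b n\<bar> * real n powr (-\<sigma>) * exp (\<sigma> * U))"
    have fM: "norm (f n \<tau>) \<le> M n" for n \<tau>
      using mult_left_mono[OF E[of \<tau>], of "\<bar>b n\<bar> * real n powr (-\<sigma>)"]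
      unfolding f_def M_def norm_mult[of "_ * _" "_ / _"]
      by (simp add: norm_mult norm_of_nat_powr del: times_divide_eq_right)
    have sM: "summable M" unfolding M_def using db \<sigma> by (intro summable_mult2) (auto simp: dirichlet_abs_def)
    have f_eq: "f n \<tau> = of_real (b n) * (exp (?s \<tau> * of_real (U - ln (real n))) / ?s \<tau>)" for n \<tau>
      using b0 by (cases "n = 0") (auto simp: f_def powr_def Ln_of_nat exp_diff exp_minus field_simps)
    have f_meas: "f n \<in> borel_measurable borel" for n
      unfolding f_eq[abs_def] Complex_eq by measurable
    have f_int: "integrable stdN (f n)" for n
      by (rule N.integrable_const_bound[where B = "M n"]) (use fM f_meas in auto)
    have int_f: "(LINT \<tau>|stdN. f n \<tau>) = of_real (\<delta> * sqrt (2 * pi) * (b n * gauss_step \<sigma> \<delta> (U - ln (real n))))" for n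
    proof -
      have "(LINT \<tau>|stdN. f n \<tau>) = of_real (b n) * (LINT \<tau>|stdN. exp (?s \<tau> * of_real (U - ln (real n))) / ?s \<tau>)"
        unfolding f_eq by (rule integral_mult_right_zero)
      also have "(LINT \<tau>|stdN. exp (?s \<tau> * of_real (U - ln (real n))) / ?s \<tau>) = of_real (\<delta> * sqrt (2 * pi) * gauss_step \<sigma> \<delta> (U - ln (real n)))"
        using \<sigma> by (intro Gaussian_Perron \<delta>) auto
      finally show ?thesis by (simp add: mult_ac)
    qed
    have int_le: "(LINT \<tau>|stdN. norm (f n \<tau>)) \<le> M n" for n
      using integral_mono[of stdN "\<lambda>\<tau>. norm (f n \<tau>)" "\<lambda>_. M n"] f_int fM N.prob_space by simp
    have sint: "summable (\<lambda>n. LINT \<tau>|stdN. norm (f n \<tau>))"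
      by (rule summable_comparison_test'[OF sM, of 0]) (use int_le in auto)
    have "summable (\<lambda>n. LINT \<tau>|stdN. f n \<tau>)"
      by (rule summable_comparison_test'[OF sint, of 0]) (auto simp: integral_norm_bound)
    then have smg: "summable (\<lambda>n. \<delta> * sqrt (2 * pi) * (b n * gauss_step \<sigma> \<delta> (U - ln (real n))))"
      unfolding int_f by (simp only: summable_of_real_iff)
    have smf: "summable (\<lambda>n. norm (f n \<tau>))" for \<tau>
      by (rule summable_comparison_test'[OF sM, of 0]) (use fM in auto)
    have "(LINT \<tau>|stdN. (\<Sum>n. f n \<tau>)) = (\<Sum>n. LINT \<tau>|stdN. f n \<tau>)"
      by (rule integral_suminf[OF f_int _ sint]) (simp add: smf)
    also have "\<dots> = (\<Sum>n. of_real (\<delta> * sqrt (2 * pi) * (b n * gauss_step \<sigma> \<delta> (U - ln (real n)))))"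
      by (simp only: int_f)
    also have "\<dots> = of_real (\<Sum>n. \<delta> * sqrt (2 * pi) * (b n * gauss_step \<sigma> \<delta> (U - ln (real n))))"
      by (rule suminf_of_real[OF smg, symmetric])
    finally have main: "of_real (\<Sum>n. \<delta> * sqrt (2 * pi) * (b n * gauss_step \<sigma> \<delta> (U - ln (real n)))) = (LINT \<tau>|stdN. (\<Sum>n. f n \<tau>))" ..
    have sum_f: "(\<Sum>n. f n \<tau>) = dirichlet b (?s \<tau>) * (exp (?s \<tau> * of_real U) / ?s \<tau>)" for \<tau>
      unfolding f_def dirichlet_def using \<sigma>
      by (intro suminf_mult2[symmetric] summable_norm_cancel[OF dirichlet_abs_summable_norm[OF db]]) auto
    \<comment> \<open>The squared height costs (8 + 2\<tau>^2) / \<delta>^2, with Gaussian mean 10 /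
      \<delta>^2. Dividing by the factor \<delta> sqrt (2 pi) of \<open>Gaussian_Perron\<close>
      leads to the third power of 1 / \<delta>.\<close>
    have "norm (LINT \<tau>|stdN. (\<Sum>n. f n \<tau>)) \<le> (LINT \<tau>|stdN. C * exp (\<sigma> * U) / \<delta> ^ 2 * (8 + 2 * \<tau> ^ 2))"
    proof (rule Bochner_Integration.integral_norm_bound_integral)
      show "integrable stdN (\<lambda>\<tau>. C * exp (\<sigma> * U) / \<delta> ^ 2 * (8 + 2 * \<tau> ^ 2))"
        using second_moment_stdN by (intro integrable_mult_right Bochner_Integration.integrable_add N.integrable_const) auto
      show "integrable stdN (\<lambda>\<tau>. \<Sum>n. f n \<tau>)"
        by (intro integrable_suminf f_int sint) (simp add: smf)
      fix \<tau> :: real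
      have "norm (\<Sum>n. f n \<tau>) \<le> (C * hgt (?s \<tau>) ^ 2) * exp (\<sigma> * U)"
        unfolding sum_f norm_mult using C(2)[of "?s \<tau>"] E[of \<tau>] \<sigma> C(1)
        by (intro mult_mono) (auto simp: b_def)
      also have "hgt (?s \<tau>) ^ 2 \<le> ((2 + \<bar>\<tau>\<bar>) / \<delta>) ^ 2"
        using \<delta> by (intro power_mono) (auto simp: field_simps abs_divide)
      also have "\<dots> \<le> (8 + 2 * \<tau> ^ 2) / \<delta> ^ 2"
      proof -
        have "(2 + \<bar>\<tau>\<bar>) ^ 2 \<le> 8 + 2 * \<tau> ^ 2"
          using zero_le_power2[of "2 - \<bar>\<tau>\<bar>"] by (simp add: power2_eq_square algebra_simps)
        then show ?thesis by (simp add: power_divide divide_right_mono)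
      qed
      finally show "norm (\<Sum>n. f n \<tau>) \<le> C * exp (\<sigma> * U) / \<delta> ^ 2 * (8 + 2 * \<tau> ^ 2)"
        using C(1) by (simp add: mult_ac)
    qed
    also have "\<dots> = C * exp (\<sigma> * U) / \<delta> ^ 2 * 10"
      using second_moment_stdN N.prob_space by simp
    also have "exp (\<sigma> * U) = exp 1 * exp U" using U by (simp add: \<sigma>_def ring_distribs exp_add)
    finally have 1: "\<bar>\<Sum>n. \<delta> * sqrt (2 * pi) * (b n * gauss_step \<sigma> \<delta> (U - ln (real n)))\<bar> \<le> 10 * exp 1 * C * exp U / \<delta> ^ 2"
      unfolding main[symmetric] norm_of_real by (simp add: mult_ac)
    have c1: "sqrt (2 * pi) \<ge> 1" using pi_ge_two by (intro real_le_rsqrt) auto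
    have "(\<Sum>n. \<delta> * sqrt (2 * pi) * (b n * gauss_step \<sigma> \<delta> (U - ln (real n)))) = \<delta> * sqrt (2 * pi) * (\<Sum>n. b n * gauss_step \<sigma> \<delta> (U - ln (real n)))"
      using smg \<delta> by (intro suminf_mult) (simp add: summable_cmult_iff)
    with 1 have "\<delta> * sqrt (2 * pi) * \<bar>\<Sum>n. b n * gauss_step \<sigma> \<delta> (U - ln (real n))\<bar> \<le> 10 * exp 1 * C * exp U / \<delta> ^ 2"
      using \<delta> by (simp add: abs_mult)
    moreover have "\<delta> * 1 * \<bar>\<Sum>n. b n * gauss_step \<sigma> \<delta> (U - ln (real n))\<bar> \<le> \<delta> * sqrt (2 * pi) * \<bar>\<Sum>n. b n * gauss_step \<sigma> \<delta> (U - ln (real n))\<bar>"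
      using \<delta> c1 by (intro mult_right_mono mult_left_mono) auto
    ultimately have "\<delta> * \<bar>\<Sum>n. b n * gauss_step \<sigma> \<delta> (U - ln (real n))\<bar> \<le> 10 * exp 1 * C * exp U / \<delta> ^ 2" by simp
    then have "\<bar>\<Sum>n. b n * gauss_step \<sigma> \<delta> (U - ln (real n))\<bar> \<le> 10 * exp 1 * C * exp U / \<delta> ^ 2 / \<delta>"
      using \<delta> by (simp only: pos_le_divide_eq mult.commute)
    also have "\<dots> = 10 * exp 1 * C * exp U / \<delta> ^ 3" by (simp add: power_numeral_reduce)
    finally show "\<bar>\<Sum>n. (mangoldt n - 1) * ln (real n) ^ k * gauss_step (1 + 1 / U) \<delta> (U - ln (real n))\<bar> \<le> 10 * exp 1 * C * exp U / \<delta> ^ 3"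
      by (simp add: b_def \<sigma>_def mult.assoc)
  qed
qed

section \<open>From the smoothed sum to a sharp cutoff\<close>

text \<open>A discrete form of the integral of x^m over [0, N]; the induction step is Bernoulli's
  inequality for (1 + 1/N)^(m + 1).\<close>

lemma sum_power_le: "(\<Sum>n<N. real n ^ m) * (real m + 1) \<le> real N ^ (m + 1)"
proof (induction N)
  case (Suc N)
  have "real N ^ (m + 1) + real N ^ m * (real m + 1) \<le> (real N + 1) ^ (m + 1)"
  proof (cases "N = 0")
    case False
    have "1 + real (m + 1) * (1 / real N) \<le> (1 + 1 / real N) ^ (m + 1)"
      by (rule Bernoulli_inequality) (rule order_trans[of _ 0], auto)
    then have *: "real N ^ (m + 1) * (1 + real (m + 1) * (1 / real N)) \<le> real N ^ (m + 1) * (1 + 1 / real N) ^ (m + 1)"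
      by (intro mult_left_mono) auto
    have "real N ^ (m + 1) + real N ^ m * (real m + 1) = real N ^ (m + 1) * (1 + real (m + 1) * (1 / real N))"
      using False by (simp add: field_simps)
    also have "\<dots> \<le> real N ^ (m + 1) * (1 + 1 / real N) ^ (m + 1)" by (rule *)
    also have "\<dots> = (real N * (1 + 1 / real N)) ^ (m + 1)" by (rule power_mult_distrib[symmetric])
    also have "real N * (1 + 1 / real N) = real N + 1" using False by (simp add: field_simps)
    finally show ?thesis .
  next
    case True
    then show ?thesis by (cases m) auto
  qed
  then show ?case using Suc by (simp add: algebra_simps)
qed auto

text \<open>The companion for the integral of x^(-p) beyond N, uniform in \<open>K\<close> so that
  it bounds infinite tails; Bernoulli's inequality compares each term with a telescoping
  difference.\<close>

lemma sum_inverse_power_le: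
  assumes "N \<ge> 1" "p \<ge> 2"
  shows "(\<Sum>i<K. (1 / real (N + Suc i)) ^ p) \<le> (1 / real N) ^ (p - 1) / (real p - 1)"
proof -
  have step: "(1 / real (n + 1)) ^ p * (real p - 1) \<le> (1 / real n) ^ (p - 1) - (1 / real (n + 1)) ^ (p - 1)" if n: "n \<ge> 1" for n
  proof -
    have n1: "real (n + 1) > 0" "real n > 0" using n by auto
    have "1 + real (p - 1) * (1 / real n) \<le> (1 + 1 / real n) ^ (p - 1)"
      by (rule Bernoulli_inequality) (rule order_trans[of _ 0], auto)
    moreover have "real (p - 1) * (1 / real (n + 1)) \<le> real (p - 1) * (1 / real n)"
      using n by (intro mult_left_mono divide_left_mono) auto
    ultimately have "real (p - 1) * (1 / real (n + 1)) \<le> (1 + 1 / real n) ^ (p - 1) - 1" by simp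
    then have "(1 / real (n + 1)) ^ (p - 1) * (real (p - 1) * (1 / real (n + 1))) \<le> (1 / real (n + 1)) ^ (p - 1) * ((1 + 1 / real n) ^ (p - 1) - 1)"
      by (intro mult_left_mono) auto
    also have "\<dots> = (1 / real (n + 1) * (1 + 1 / real n)) ^ (p - 1) - (1 / real (n + 1)) ^ (p - 1)"
      by (simp only: right_diff_distrib power_mult_distrib mult_1_right)
    also have "1 / real (n + 1) * (1 + 1 / real n) = 1 / real n" using n1 by (simp add: field_simps)
    also have "(1 / real (n + 1)) ^ (p - 1) * (real (p - 1) * (1 / real (n + 1))) = (1 / real (n + 1)) ^ p * (real p - 1)"
      using assms by (cases p) (auto simp: of_nat_diff)
    finally show ?thesis .
  qed
  have "(\<Sum>i<K. (1 / real (N + Suc i)) ^ p) * (real p - 1) \<le> (1 / real N) ^ (p - 1) - (1 / real (N + K)) ^ (p - 1)"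
  proof (induction K)
    case (Suc K)
    show ?case using Suc step[of "N + K"] assms by (simp add: algebra_simps)
  qed auto
  also have "\<dots> \<le> (1 / real N) ^ (p - 1)" by simp
  finally show ?thesis using assms by (simp add: pos_le_divide_eq)
qed

text \<open>This measures the cost of replacing the smooth step of width 1/m by a sharp one. For
  integral \<open>m\<close> the exponential is the m-th power of n/N or N/n, so the sum has
  effective length N/m on either side of N.\<close>

lemma log_weighted_tail:
  fixes k :: nat
  obtains C :: real where "C > 0" "\<And>N m. N \<ge> 1 \<Longrightarrow> m \<ge> 4 \<Longrightarrow>
     summable (\<lambda>n. (1 + ln (real n)) ^ k * exp (- \<bar>ln (real N) - ln (real n)\<bar> * real m) * of_bool (n \<ge> 1)) \<and>
     (\<Sum>n. (1 + ln (real n)) ^ k * exp (- \<bar>ln (real N) - ln (real n)\<bar> * real m) * of_bool (n \<ge> 1))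
       \<le> C * (1 + ln (real N)) ^ k * (1 + real N / real m)"
proof -
  obtain C :: real where C: "C > 0" "\<And>r. r \<ge> 1 \<Longrightarrow> (1 + ln r) ^ k \<le> C * r powr 1"
    by (rule one_plus_ln_power_le_powr[OF zero_less_one, of k]) blast
  define C' where "C' = 3 * max 1 C"
  show ?thesis
  proof
    show "C' > 0" by (simp add: C'_def)
    fix N m :: nat assume N: "N \<ge> 1" and m: "m \<ge> 4"
    define g where "g = (\<lambda>n. (1 + ln (real n)) ^ k * exp (- \<bar>ln (real N) - ln (real n)\<bar> * real m) * of_bool (n \<ge> 1))"
    define A where "A = (1 + ln (real N)) ^ k"
    have A: "A > 0" using N by (auto simp: A_def intro!: zero_less_power add_pos_nonneg)
    have exp_m: "exp (real m * (ln (real a) - ln (real b))) = (real a / real b) ^ m" if "a \<ge> 1" "b \<ge> 1" for a b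
      using that by (simp add: exp_of_nat_mult exp_diff)
    have low: "g n \<le> A * (real n / real N) ^ m" if "n \<le> N" "n \<ge> 1" for n
    proof -
      have "- \<bar>ln (real N) - ln (real n)\<bar> * real m = real m * (ln (real n) - ln (real N))"
        using that by (simp add: algebra_simps)
      then have "exp (- \<bar>ln (real N) - ln (real n)\<bar> * real m) = (real n / real N) ^ m"
        using that N exp_m[of n N] by (simp only:)
      then have "g n = (1 + ln (real n)) ^ k * (real n / real N) ^ m"
        unfolding g_def using that by simp
      also have "\<dots> \<le> A * (real n / real N) ^ m"
        unfolding A_def using that by (intro mult_right_mono power_mono) auto
      finally show ?thesis .
    qed
    \<comment> \<open>Beyond N, 1 + log n is at most the product of 1 + log N and 1 + log (n/N); the
      k-th power of the latter is absorbed by one factor n/N, which leaves the exponent m -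
      1.\<close>
    have up: "g n \<le> A * C * (real N / real n) ^ (m - 1)" if "n > N" for n
    proof -
      have n: "real n > 0" using that by simp
      have "- \<bar>ln (real N) - ln (real n)\<bar> * real m = real m * (ln (real N) - ln (real n))"
        using that N by (simp add: algebra_simps)
      then have "exp (- \<bar>ln (real N) - ln (real n)\<bar> * real m) = (real N / real n) ^ m"
        using that N exp_m[of N n] by (simp only:)
      then have "g n = (1 + ln (real n)) ^ k * (real N / real n) ^ m"
        unfolding g_def using that N by simp
      also have "(1 + ln (real n)) ^ k \<le> A * (1 + ln (real n / real N)) ^ k"
      proof -
        have "1 + ln (real n) \<le> (1 + ln (real N)) * (1 + ln (real n / real N))"
        proof -
          have "0 \<le> ln (real N) * ln (real n / real N)" using that N by (intro mult_nonneg_nonneg ln_ge_zero) auto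
          moreover have "ln (real n / real N) = ln (real n) - ln (real N)" using that N by (simp add: ln_div)
          moreover have "(1 + ln (real N)) * (1 + ln (real n / real N)) = 1 + ln (real N) + ln (real n / real N) + ln (real N) * ln (real n / real N)"
            by (simp only: distrib_left distrib_right mult_1 mult_1_right add.assoc)
          ultimately show ?thesis by linarith
        qed
        then have "(1 + ln (real n)) ^ k \<le> ((1 + ln (real N)) * (1 + ln (real n / real N))) ^ k"
          using that N by (intro power_mono) auto
        then show ?thesis by (simp add: power_mult_distrib A_def)
      qed
      also have "A * (1 + ln (real n / real N)) ^ k \<le> A * (C * (real n / real N))"
        using C(2)[of "real n / real N"] that N A by (intro mult_left_mono) auto
      also have "A * (C * (real n / real N)) * (real N / real n) ^ m = A * C * (real N / real n) ^ (m - 1)"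
        using that N m by (cases m) (auto simp: field_simps)
      finally show ?thesis by (simp add: mult_right_mono)
    qed
    have g0: "g n \<ge> 0" for n by (cases "n = 0") (auto simp: g_def)
    have bound: "(\<Sum>n<K. g n) \<le> C' * A * (1 + real N / real m)" for K
    proof -
      have "(\<Sum>n<K. g n) \<le> (\<Sum>n<Suc N + K. g n)"
        by (rule sum_mono2) (auto simp: g0)
      also have "\<dots> = (\<Sum>n<Suc N. g n) + (\<Sum>i<K. g (Suc N + i))"
        by (induction K) auto
      also have "(\<Sum>n<Suc N. g n) \<le> A * (1 + real N / real m)"
      proof -
        have "(\<Sum>n<Suc N. g n) \<le> (\<Sum>n<Suc N. A * (real n / real N) ^ m)"
        proof (rule sum_mono)
          fix n assume "n \<in> {..<Suc N}"
          then show "g n \<le> A * (real n / real N) ^ m"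
            using low[of n] m A by (cases "n = 0") (auto simp: g_def)
        qed
        also have "\<dots> = A * ((\<Sum>n<N. real n ^ m) / real N ^ m + 1)"
          using N by (simp add: sum_distrib_left[symmetric] power_divide sum_divide_distrib[symmetric] algebra_simps add_divide_distrib)
        also have "(\<Sum>n<N. real n ^ m) \<le> real N ^ (m + 1) / real m"
        proof -
          have "(\<Sum>n<N. real n ^ m) * real m \<le> (\<Sum>n<N. real n ^ m) * (real m + 1)"
            by (intro mult_left_mono sum_nonneg) auto
          then show ?thesis using sum_power_le[where N = N and m = m] m by (simp add: pos_le_divide_eq)
        qed
        also have "real N ^ (m + 1) / real m / real N ^ m = real N / real m" using N by simp
        finally have "(\<Sum>n<Suc N. g n) \<le> A * (real N / real m + 1)" using A by (simp add: divide_right_mono mult_left_mono)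
        then show ?thesis by (simp add: add.commute)
      qed
      also have "(\<Sum>i<K. g (Suc N + i)) \<le> 2 * (A * C) * (real N / real m)"
      proof -
        have "(\<Sum>i<K. g (Suc N + i)) \<le> (\<Sum>i<K. A * C * real N ^ (m - 1) * (1 / real (N + Suc i)) ^ (m - 1))"
        proof (rule sum_mono)
          fix i
          show "g (Suc N + i) \<le> A * C * real N ^ (m - 1) * (1 / real (N + Suc i)) ^ (m - 1)"
            using up[of "N + Suc i"] by (simp add: power_divide del: of_nat_Suc of_nat_add)
        qed
        also have "\<dots> = A * C * real N ^ (m - 1) * (\<Sum>i<K. (1 / real (N + Suc i)) ^ (m - 1))"
          by (simp add: sum_distrib_left)
        also have "\<dots> \<le> A * C * real N ^ (m - 1) * ((1 / real N) ^ (m - 1 - 1) / (real (m - 1) - 1))"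
          using A C(1) N m by (intro mult_left_mono sum_inverse_power_le) auto
        also have "\<dots> = A * C * (real N / (real m - 2))"
        proof -
          define q where "q = m - 2"
          have q: "m = Suc (Suc q)" using m by (simp add: q_def)
          show ?thesis using N by (simp add: q power_one_over field_simps)
        qed
        also have "real N / (real m - 2) \<le> 2 * (real N / real m)"
          using m mult_left_mono[of 4 "real m" "real N"] by (simp add: field_simps)
        finally have "(\<Sum>i<K. g (Suc N + i)) \<le> A * C * (2 * (real N / real m))" using A C(1) by (simp add: mult_left_mono)
        then show ?thesis by (simp only: mult_ac)
      qed
      also have "A * (1 + real N / real m) + 2 * (A * C) * (real N / real m) \<le> C' * A * (1 + real N / real m)"
      proof -
        have "A * (1 + real N / real m) \<le> max 1 C * A * (1 + real N / real m)"
          using A by (intro mult_right_mono) auto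
        moreover have "C * A * (real N / real m) \<le> max 1 C * A * (1 + real N / real m)"
          using A C(1) by (intro mult_mono) auto
        moreover have "2 * (A * C) * (real N / real m) = 2 * (C * A * (real N / real m))" by simp
        moreover have "C' * A * (1 + real N / real m) = 3 * (max 1 C * A * (1 + real N / real m))"
          by (simp add: C'_def)
        ultimately show ?thesis by linarith
      qed
      finally show ?thesis by simp
    qed
    have "summable g" by (rule summableI_nonneg_bounded[OF g0 bound])
    moreover have "suminf g \<le> C' * A * (1 + real N / real m)"
      using bound \<open>summable g\<close> by (intro suminf_le_const) auto
    ultimately show "summable (\<lambda>n. (1 + ln (real n)) ^ k * exp (- \<bar>ln (real N) - ln (real n)\<bar> * real m) * of_bool (n \<ge> 1)) \<and>
     (\<Sum>n. (1 + ln (real n)) ^ k * exp (- \<bar>ln (real N) - ln (real n)\<bar> * real m) * of_bool (n \<ge> 1))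
       \<le> C' * (1 + ln (real N)) ^ k * (1 + real N / real m)"
      by (simp add: g_def A_def)
  qed
qed

text \<open>\<open>smoothed_sum_bound\<close> with U = log N and \<delta> = 1/m contributes N m^3;
  sharpening the step contributes the rest, with exponent k + 1 because |mangoldt n - 1| is bounded
  by 1 + log n. The limiting height \<mu> of the step is at least 1 and can be divided out.\<close>

lemma mangoldt_ln_sum_bound:
  assumes k: "k \<ge> 1"
  obtains C :: real where "C > 0" "\<And>N m. N \<ge> 3 \<Longrightarrow> m \<ge> 4 \<Longrightarrow>
    \<bar>\<Sum>n=1..N. (mangoldt n - 1) * ln (real n) ^ k\<bar> \<le> C * (real N * real m ^ 3 + (1 + ln (real N)) ^ (k + 1) * (1 + real N / real m))"
proof -
  obtain C1 :: real where C1: "C1 > 0" "\<And>U \<delta>. U \<ge> 1 \<Longrightarrow> 0 < \<delta> \<Longrightarrow> \<delta> \<le> 1 \<Longrightarrow>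
     \<bar>\<Sum>n. (mangoldt n - 1) * ln (real n) ^ k * gauss_step (1 + 1 / U) \<delta> (U - ln (real n))\<bar> \<le> C1 * exp U / \<delta> ^ 3"
    using smoothed_sum_bound[OF k] by blast
  define T where "T = (\<lambda>N m n. (1 + ln (real n)) ^ (k + 1) * exp (- \<bar>ln (real N) - ln (real n)\<bar> * real m) * of_bool (n \<ge> 1))"
  obtain C2 :: real where C2: "C2 > 0" "\<And>N m. N \<ge> 1 \<Longrightarrow> m \<ge> 4 \<Longrightarrow>
     summable (T N m) \<and> suminf (T N m) \<le> C2 * (1 + ln (real N)) ^ (k + 1) * (1 + real N / real m)"
    unfolding T_def by (rule log_weighted_tail[of "k + 1"]) blast
  show ?thesis
  proof
    show "C1 + exp 2 * C2 > 0" using C1(1) C2(1) by (simp add: add_pos_pos)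
    fix N m :: nat assume N: "N \<ge> 3" and m: "m \<ge> 4"
    define U where "U = ln (real N)"
    define \<delta> where "\<delta> = 1 / real m"
    define \<sigma> where "\<sigma> = 1 + 1 / U"
    define b where "b = (\<lambda>n. (mangoldt n - 1) * ln (real n) ^ k)"
    define \<mu> where "\<mu> = exp ((\<sigma> * \<delta>)\<^sup>2 / 2)"
    \<comment> \<open>Here N >= 3 > e is needed: \<open>smoothed_sum_bound\<close> requires U >=
      1.\<close>
    have "exp 1 \<le> real N" using exp_le N by linarith
    then have U: "U \<ge> 1" using N unfolding U_def by (subst ln_ge_iff) auto
    have \<delta>: "0 < \<delta>" "\<delta> \<le> 1 / 4" using m by (auto simp: \<delta>_def field_simps)
    have \<sigma>: "\<sigma> > 0" "\<sigma> \<le> 2" using U by (auto simp: \<sigma>_def add_pos_pos)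
    have "\<sigma> * \<delta> \<le> 2 * (1 / 4)" using \<sigma> \<delta> by (intro mult_mono) auto
    then have sd: "\<sigma> * \<delta> \<le> 1" by simp
    have b0: "b 0 = 0" using k by (simp add: b_def)
    have b_le: "\<bar>b n\<bar> \<le> (1 + ln (real n)) ^ (k + 1)" if "n \<ge> 1" for n
    proof -
      have "\<bar>mangoldt n - 1\<bar> \<le> 1 + ln (real n)"
        using mangoldt_le[of n] mangoldt_nonneg[of n] that by (simp add: abs_le_iff)
      moreover have "ln (real n) ^ k \<le> (1 + ln (real n)) ^ k" using that by (intro power_mono) auto
      ultimately have "\<bar>mangoldt n - 1\<bar> * ln (real n) ^ k \<le> (1 + ln (real n)) * (1 + ln (real n)) ^ k"
        using that by (intro mult_mono) auto
      then show ?thesis using that by (simp add: b_def abs_mult)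
    qed
    define e where "e = (\<lambda>n. b n * (gauss_step \<sigma> \<delta> (U - ln (real n)) - \<mu> * of_bool (n \<le> N)))"
    have e_le: "norm (e n) \<le> exp 2 * T N m n" for n
    proof (cases "n \<ge> 1")
      case False
      then have "n = 0" by simp
      then show ?thesis using b0 by (simp add: e_def T_def)
    next
      case True
      have "U - ln (real n) \<ge> 0 \<longleftrightarrow> n \<le> N" using True N by (simp add: U_def)
      then have "\<bar>gauss_step \<sigma> \<delta> (U - ln (real n)) - \<mu> * of_bool (n \<le> N)\<bar> \<le> exp 2 * exp (- \<bar>U - ln (real n)\<bar> * real m)"
        using gauss_step_bounds[OF \<delta>(1) \<sigma>(1) sd, of "U - ln (real n)"] by (simp add: \<mu>_def \<delta>_def)
      then have "\<bar>b n\<bar> * \<bar>gauss_step \<sigma> \<delta> (U - ln (real n)) - \<mu> * of_bool (n \<le> N)\<bar> \<le> (1 + ln (real n)) ^ (k + 1) * (exp 2 * exp (- \<bar>U - ln (real n)\<bar> * real m))"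
        using b_le[OF True] by (intro mult_mono) auto
      then show ?thesis using True by (simp add: e_def T_def U_def abs_mult mult_ac)
    qed
    have sT: "summable (T N m)" "suminf (T N m) \<le> C2 * (1 + ln (real N)) ^ (k + 1) * (1 + real N / real m)"
      using C2(2)[of N m] N m by auto
    have se: "summable e" by (rule summable_comparison_test'[OF summable_mult[OF sT(1), of "exp 2"], of 0]) (rule e_le)
    have "norm (suminf e) \<le> (\<Sum>n. exp 2 * T N m n)" by (intro norm_suminf_le e_le summable_mult sT)
    also have "\<dots> = exp 2 * suminf (T N m)" by (rule suminf_mult[OF sT(1)])
    also have "\<dots> \<le> exp 2 * (C2 * (1 + ln (real N)) ^ (k + 1) * (1 + real N / real m))"
      using sT by simp
    finally have e_sum: "\<bar>suminf e\<bar> \<le> exp 2 * C2 * ((1 + ln (real N)) ^ (k + 1) * (1 + real N / real m))" by (simp add: mult.assoc)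
    have "(\<lambda>n. \<mu> * b n * of_bool (n \<le> N)) sums (\<Sum>n\<in>{1..N}. \<mu> * b n * of_bool (n \<le> N))"
      using b0 by (intro sums_finite) (auto simp: not_le Suc_le_eq)
    also have "(\<Sum>n\<in>{1..N}. \<mu> * b n * of_bool (n \<le> N)) = \<mu> * (\<Sum>n\<in>{1..N}. b n)"
      by (simp add: sum_distrib_left)
    finally have fin: "(\<lambda>n. \<mu> * b n * of_bool (n \<le> N)) sums (\<mu> * (\<Sum>n\<in>{1..N}. b n))" .
    have "(\<lambda>n. e n + \<mu> * b n * of_bool (n \<le> N)) sums (suminf e + \<mu> * (\<Sum>n\<in>{1..N}. b n))"
      by (intro sums_add summable_sums se fin)
    moreover have "e n + \<mu> * b n * of_bool (n \<le> N) = b n * gauss_step \<sigma> \<delta> (U - ln (real n))" for n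
      by (simp add: e_def algebra_simps)
    ultimately have "(\<Sum>n. b n * gauss_step \<sigma> \<delta> (U - ln (real n))) = suminf e + \<mu> * (\<Sum>n\<in>{1..N}. b n)"
      by (simp add: sums_iff)
    moreover have "\<bar>\<Sum>n. b n * gauss_step \<sigma> \<delta> (U - ln (real n))\<bar> \<le> C1 * (real N * real m ^ 3)"
      using C1(2)[of U \<delta>] U \<delta> N by (simp add: b_def \<sigma>_def U_def \<delta>_def power_divide)
    ultimately have "\<bar>\<mu> * (\<Sum>n\<in>{1..N}. b n)\<bar> \<le> C1 * (real N * real m ^ 3) + exp 2 * C2 * ((1 + ln (real N)) ^ (k + 1) * (1 + real N / real m))"
      using e_sum by linarith
    moreover have "1 * \<bar>\<Sum>n\<in>{1..N}. b n\<bar> \<le> \<mu> * \<bar>\<Sum>n\<in>{1..N}. b n\<bar>"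
      by (intro mult_right_mono) (auto simp: \<mu>_def)
    moreover have "\<bar>\<mu> * (\<Sum>n\<in>{1..N}. b n)\<bar> = \<mu> * \<bar>\<Sum>n\<in>{1..N}. b n\<bar>" by (simp add: abs_mult \<mu>_def)
    moreover have "C1 * (real N * real m ^ 3) + exp 2 * C2 * ((1 + ln (real N)) ^ (k + 1) * (1 + real N / real m))
        \<le> (C1 + exp 2 * C2) * (real N * real m ^ 3 + (1 + ln (real N)) ^ (k + 1) * (1 + real N / real m))"
    proof -
      have "0 \<le> exp 2 * C2 * (real N * real m ^ 3)" "0 \<le> C1 * ((1 + ln (real N)) ^ (k + 1) * (1 + real N / real m))"
        using C1(1) C2(1) U by (auto intro!: mult_nonneg_nonneg zero_le_power add_nonneg_nonneg simp: U_def)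
      then show ?thesis by (simp only: distrib_left distrib_right)
    qed
    ultimately show "\<bar>\<Sum>n=1..N. (mangoldt n - 1) * ln (real n) ^ k\<bar> \<le> (C1 + exp 2 * C2) * (real N * real m ^ 3 + (1 + ln (real N)) ^ (k + 1) * (1 + real N / real m))"
      unfolding b_def by linarith
  qed
qed

text \<open>Taking m of size (1 + log N)^q balances N m^3 against (log N)^(4q) N/m: both become N
  (log N)^(3q), which is q logarithms short of the exponent 4q by which the later partial summation
  divides.\<close>

lemma mangoldt_ln_sum_bound':
  assumes q: "q \<ge> 1"
  obtains C :: real where "C > 0" "\<And>N. N \<ge> 2 \<Longrightarrow>
    \<bar>\<Sum>n=1..N. (mangoldt n - 1) * ln (real n) ^ (4 * q - 1)\<bar> \<le> C * real N * (1 + ln (real N)) ^ (3 * q)"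
proof -
  have k: "4 * q - 1 \<ge> 1" "4 * q - 1 + 1 = 4 * q" using q by auto
  obtain C :: real where C: "C > 0" "\<And>N m. N \<ge> 3 \<Longrightarrow> m \<ge> 4 \<Longrightarrow>
    \<bar>\<Sum>n=1..N. (mangoldt n - 1) * ln (real n) ^ (4 * q - 1)\<bar> \<le> C * (real N * real m ^ 3 + (1 + ln (real N)) ^ (4 * q) * (1 + real N / real m))"
    using mangoldt_ln_sum_bound[OF k(1)] unfolding k(2) by blast
  obtain C1 :: real where C1: "C1 > 0" "\<And>r::real. r \<ge> 1 \<Longrightarrow> (1 + ln r) ^ (4 * q) \<le> C1 * r powr 1"
    by (rule one_plus_ln_power_le_powr[OF zero_less_one, of "4 * q"]) blast
  define C2 where "C2 = 1 + C * (217 + C1)"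
  show ?thesis
  proof
    show "C2 > 0" using C C1 by (simp add: C2_def add_pos_pos)
    fix N :: nat assume N: "N \<ge> 2"
    define L where "L = ln (real N)"
    have L: "L > 0" using N by (simp add: L_def)
    define X where "X = (1 + L) ^ q"
    have X: "X \<ge> 1" using L by (simp add: X_def one_le_power)
    have X3: "(1 + L) ^ (3 * q) = X ^ 3" "(1 + L) ^ (4 * q) = X ^ 4"
      by (simp_all add: X_def power_mult[symmetric] mult.commute)
    have X31: "X ^ 3 \<ge> 1" using X by (rule one_le_power)
    show "\<bar>\<Sum>n=1..N. (mangoldt n - 1) * ln (real n) ^ (4 * q - 1)\<bar> \<le> C2 * real N * (1 + ln (real N)) ^ (3 * q)"
    proof (cases "N = 2")
      case True
      have "(\<Sum>n=1..N. (mangoldt n - 1) * ln (real n) ^ (4 * q - 1)) = (ln 2 - 1) * ln 2 ^ (4 * q - 1)"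
        using q by (simp add: True numeral_2_eq_2 mangoldt_prime[OF two_is_prime_nat, unfolded numeral_2_eq_2])
      also have "\<bar>\<dots>\<bar> \<le> 1 * 1"
        unfolding abs_mult power_abs using ln_2_less_1 ln_gt_zero[of "2::real"]
        by (intro mult_mono power_le_one) auto
      also have "\<dots> \<le> 1 * real N * X ^ 3" using mult_mono[of 1 "real N" 1 "X ^ 3"] X31 N by simp
      also have "\<dots> \<le> C2 * real N * X ^ 3" using X C C1 by (intro mult_right_mono) (auto simp: C2_def)
      finally show ?thesis using X3 by (simp add: L_def)
    next
      case False
      \<comment> \<open>The summand 4 ensures m >= 4, and since X >= 1 the result is at most 6 X;
        hence 6^3 = 216, and 217 together with the balancing term.\<close>
      define m where "m = nat \<lceil>X\<rceil> + 4"
      have m: "m \<ge> 4" "X \<le> real m" "real m \<le> 6 * X"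
        using X by (simp_all add: m_def) linarith+
      have "X ^ 4 * (real N / real m) \<le> X ^ 4 * (real N / X)"
        using m X by (intro mult_left_mono divide_left_mono) auto
      also have "\<dots> = real N * X ^ 3" using X by (simp add: power_numeral_reduce)
      finally have "X ^ 4 * (real N / real m) \<le> real N * X ^ 3" .
      moreover have "X ^ 4 \<le> C1 * real N" using C1(2)[of "real N"] N by (simp add: X3[symmetric] L_def)
      moreover have "(1 + ln (real N)) ^ (4 * q) * (1 + real N / real m) = X ^ 4 + X ^ 4 * (real N / real m)"
        by (simp add: X3 L_def[symmetric] ring_distribs)
      ultimately have 1: "(1 + ln (real N)) ^ (4 * q) * (1 + real N / real m) \<le> C1 * real N + real N * X ^ 3" by linarith
      have "real m ^ 3 \<le> (6 * X) ^ 3" using m by (intro power_mono) auto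
      then have 2: "real N * real m ^ 3 \<le> 216 * (real N * X ^ 3)"
        using mult_left_mono[of "real m ^ 3" "(6 * X) ^ 3" "real N"] by (simp add: power_mult_distrib)
      have 3: "C1 * real N \<le> C1 * (real N * X ^ 3)"
        using mult_left_mono[OF X31, of "C1 * real N"] C1(1) by simp
      have "\<bar>\<Sum>n=1..N. (mangoldt n - 1) * ln (real n) ^ (4 * q - 1)\<bar> \<le> C * (real N * real m ^ 3 + (1 + ln (real N)) ^ (4 * q) * (1 + real N / real m))"
        using C(2)[of N m] m N False by auto
      also have "\<dots> \<le> C * ((217 + C1) * (real N * X ^ 3))"
        using 1 2 3 C(1) by (intro mult_left_mono) (auto simp: algebra_simps)
      also have "\<dots> \<le> C2 * (real N * X ^ 3)"
        using X N by (auto simp: C2_def algebra_simps intro!: mult_nonneg_nonneg)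
      finally show ?thesis using X3 by (simp add: L_def)
    qed
  qed
qed

lemma Abel_sum_bound:
  fixes b w :: "nat \<Rightarrow> real"
  assumes w: "\<And>n. n \<ge> 2 \<Longrightarrow> w (Suc n) \<le> w n" "\<And>n. n \<ge> 2 \<Longrightarrow> w n \<ge> 0"
    and B: "\<And>n. 2 \<le> n \<Longrightarrow> n \<le> N \<Longrightarrow> \<bar>\<Sum>i=2..n. b i\<bar> \<le> M * real n" and M: "M \<ge> 0" and N: "N \<ge> 2"
  shows "\<bar>\<Sum>n=2..N. b n * w n\<bar> \<le> 2 * M * (\<Sum>n=2..N. w n)"
proof -
  define S where "S = (\<lambda>n. \<Sum>i=2..n. b i)"
  have "\<bar>(\<Sum>n=2..K. b n * w n) - S K * w K\<bar> \<le> M * ((\<Sum>n=2..K. w n) + w 2 - real K * w K)" if "2 \<le> K" "K \<le> N" for K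
    using that
  proof (induction K rule: dec_induct)
    case base
    then show ?case by (simp add: S_def)
  next
    case (step n)
    have 1: "(\<Sum>n=2..Suc n. b n * w n) - S (Suc n) * w (Suc n) = ((\<Sum>n=2..n. b n * w n) - S n * w n) + S n * (w n - w (Suc n))"
      using step by (simp add: S_def algebra_simps)
    have 2: "\<bar>S n * (w n - w (Suc n))\<bar> \<le> M * real n * (w n - w (Suc n))"
      unfolding abs_mult using step w[of n] B[of n] by (intro mult_mono) (auto simp: S_def)
    have 3: "M * ((\<Sum>n=2..Suc n. w n) + w 2 - real (Suc n) * w (Suc n)) = M * ((\<Sum>n=2..n. w n) + w 2 - real n * w n) + M * real n * (w n - w (Suc n))"
      using step by (simp add: algebra_simps)
    show ?case unfolding 1 3 using 2 step by linarith
  qed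
  from this[of N] have 1: "\<bar>(\<Sum>n=2..N. b n * w n) - S N * w N\<bar> \<le> M * ((\<Sum>n=2..N. w n) + w 2 - real N * w N)" using N by auto
  have 2: "\<bar>S N * w N\<bar> \<le> M * real N * w N"
    unfolding abs_mult using B[of N] w N by (intro mult_mono) (auto simp: S_def)
  have "w 2 \<le> (\<Sum>n=2..N. w n)" using w N member_le_sum[of 2 "{2..N}" w] by auto
  then have "M * w 2 \<le> M * (\<Sum>n=2..N. w n)" using M by (rule mult_left_mono)
  with 1 2 show ?thesis by (simp add: algebra_simps)
qed

text \<open>Split at sqrt N: below there are at most sqrt N bounded terms, and above log n exceeds
  (log N)/2.\<close>

lemma sum_inverse_ln_power:
  obtains C :: real where "C > 0" "\<And>N. N \<ge> 2 \<Longrightarrow> (\<Sum>n=2..N. 1 / ln (real n) ^ j) \<le> C * real N / ln (real N) ^ j"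
proof -
  obtain C1 :: real where C1: "C1 > 0" "\<And>r::real. r \<ge> 1 \<Longrightarrow> (1 + ln r) ^ j \<le> C1 * r powr (1/2)"
    by (rule one_plus_ln_power_le_powr[of "1/2" j]) (simp, blast)
  define C where "C = C1 / ln 2 ^ j + 2 ^ j"
  show ?thesis
  proof
    show "C > 0" using C1 by (simp add: C_def add_pos_pos)
    fix N :: nat assume N: "N \<ge> 2"
    define L where "L = ln (real N)"
    have L: "L > 0" using N by (simp add: L_def)
    have "(\<Sum>n=2..N. 1 / ln (real n) ^ j) \<le> (\<Sum>n=2..N. of_bool (n\<^sup>2 \<le> N) * (1 / ln 2 ^ j) + 2 ^ j / L ^ j)"
    proof (rule sum_mono)
      fix n assume n: "n \<in> {2..N}"
      have l2: "0 < ln (2::real)" "ln 2 \<le> ln (real n)" using n by auto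
      show "1 / ln (real n) ^ j \<le> of_bool (n\<^sup>2 \<le> N) * (1 / ln 2 ^ j) + 2 ^ j / L ^ j"
      proof (cases "n\<^sup>2 \<le> N")
        case True
        have "1 / ln (real n) ^ j \<le> 1 / ln 2 ^ j"
          using l2 by (intro frac_le power_mono) auto
        then show ?thesis using True L by (simp add: add_increasing2)
      next
        case False
        have "L \<le> ln (real (n\<^sup>2))" unfolding L_def using False N n by (subst ln_le_cancel_iff) auto
        also have "\<dots> = 2 * ln (real n)" using n by (simp add: ln_realpow)
        finally have "(L / 2) ^ j \<le> ln (real n) ^ j" using L by (intro power_mono) auto
        then have "1 / ln (real n) ^ j \<le> 1 / (L / 2) ^ j" using L l2 by (intro frac_le) auto
        then show ?thesis using False by (simp add: power_divide)
      qed
    qed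
    also have "\<dots> = real (card {n\<in>{2..N}. n\<^sup>2 \<le> N}) * (1 / ln 2 ^ j) + real (N - 1) * (2 ^ j / L ^ j)"
    proof -
      have "(\<Sum>n=2..N. of_bool (n\<^sup>2 \<le> N)) = real (card {n\<in>{2..N}. n\<^sup>2 \<le> N})"
        by (simp add: sum.If_cases of_bool_def Int_def)
      then show ?thesis by (simp only: sum.distrib sum_distrib_right[symmetric]) simp
    qed
    also have "\<dots> \<le> (C1 * real N / L ^ j) * (1 / ln 2 ^ j) + real N * (2 ^ j / L ^ j)"
    proof (intro add_mono mult_right_mono)
      have "card {n\<in>{2..N}. n\<^sup>2 \<le> N} \<le> card {1..nat \<lfloor>sqrt (real N)\<rfloor>}"
      proof (intro card_mono subsetI)
        fix n assume "n \<in> {n\<in>{2..N}. n\<^sup>2 \<le> N}"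
        then have "1 \<le> n" "real n ^ 2 \<le> real N" by (auto simp flip: of_nat_power)
        moreover from this have "real n \<le> sqrt (real N)" by (intro real_le_rsqrt)
        ultimately show "n \<in> {1..nat \<lfloor>sqrt (real N)\<rfloor>}" by (auto simp: le_nat_iff le_floor_iff)
      qed auto
      then have "real (card {n\<in>{2..N}. n\<^sup>2 \<le> N}) \<le> sqrt (real N)"
        by (simp add: le_nat_iff le_floor_iff)
      then have "real (card {n\<in>{2..N}. n\<^sup>2 \<le> N}) * L ^ j \<le> sqrt (real N) * L ^ j"
        using L by (intro mult_right_mono) auto
      also have "\<dots> \<le> C1 * real N"
      proof -
        have "L ^ j \<le> (1 + L) ^ j" using L by (intro power_mono) auto
        also have "\<dots> \<le> C1 * sqrt (real N)" using C1(2)[of "real N"] N by (simp add: L_def powr_half_sqrt)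
        finally have "sqrt (real N) * L ^ j \<le> sqrt (real N) * (C1 * sqrt (real N))" by (intro mult_left_mono) auto
        then show ?thesis by (simp add: mult_ac)
      qed
      finally show "real (card {n\<in>{2..N}. n\<^sup>2 \<le> N}) \<le> C1 * real N / L ^ j"
        using L by (simp add: pos_le_divide_eq)
    qed (use N L in auto)
    also have "\<dots> = C * real N / L ^ j" by (simp add: C_def ring_distribs add_divide_distrib mult_ac)
    finally show "(\<Sum>n=2..N. 1 / ln (real n) ^ j) \<le> C * real N / ln (real N) ^ j" by (simp add: L_def)
  qed
qed

text \<open>Partial summation against (log n)^(-4q): the partial sums cost (log N)^(3q), the sum of
  the weights gains (log N)^(4q).\<close>

lemma mangoldt_over_ln_sum_bound:
  assumes q: "q \<ge> 1"
  obtains C :: real where "C > 0" "\<And>N. N \<ge> 2 \<Longrightarrow>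
    \<bar>\<Sum>n=2..N. (mangoldt n - 1) / ln (real n)\<bar> \<le> C * real N / ln (real N) ^ q"
proof -
  obtain C1 :: real where C1: "C1 > 0" "\<And>N. N \<ge> 2 \<Longrightarrow>
    \<bar>\<Sum>n=1..N. (mangoldt n - 1) * ln (real n) ^ (4 * q - 1)\<bar> \<le> C1 * real N * (1 + ln (real N)) ^ (3 * q)"
    using mangoldt_ln_sum_bound'[OF q] by blast
  obtain C2 :: real where C2: "C2 > 0" "\<And>N. N \<ge> 2 \<Longrightarrow> (\<Sum>n=2..N. 1 / ln (real n) ^ (4 * q)) \<le> C2 * real N / ln (real N) ^ (4 * q)"
    by (rule sum_inverse_ln_power[of "4 * q"]) blast
  define c where "c = 1 + 1 / ln (2::real)"
  have c: "c > 0" by (auto simp: c_def intro!: add_pos_pos)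
  show ?thesis
  proof
    show "2 * C1 * C2 * c ^ (3 * q) > 0" using C1 C2 c by simp
    fix N :: nat assume N: "N \<ge> 2"
    define L where "L = ln (real N)"
    have L: "L > 0" "L \<ge> ln 2" using N by (simp_all add: L_def)
    define b where "b = (\<lambda>n. (mangoldt n - 1) * ln (real n) ^ (4 * q - 1))"
    have "\<bar>\<Sum>n=2..N. b n * (1 / ln (real n) ^ (4 * q))\<bar> \<le> 2 * (C1 * (1 + L) ^ (3 * q)) * (\<Sum>n=2..N. 1 / ln (real n) ^ (4 * q))"
    proof (rule Abel_sum_bound[OF _ _ _ _ N])
      fix n :: nat assume n: "n \<ge> 2"
      show "1 / ln (real (Suc n)) ^ (4 * q) \<le> 1 / ln (real n) ^ (4 * q)"
        using n by (intro frac_le power_mono) auto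
      show "0 \<le> 1 / ln (real n) ^ (4 * q)" using n by simp
      assume "n \<le> N"
      have "(\<Sum>i=2..n. b i) = (\<Sum>i=1..n. b i)"
        by (rule sum.mono_neutral_left) (use q in \<open>auto simp: b_def not_le\<close>)
      also have "\<bar>\<dots>\<bar> \<le> C1 * real n * (1 + ln (real n)) ^ (3 * q)"
        unfolding b_def using C1(2)[OF n] .
      also have "\<dots> \<le> C1 * real n * (1 + L) ^ (3 * q)"
        unfolding L_def using n \<open>n \<le> N\<close> C1 by (intro mult_left_mono power_mono) auto
      finally show "\<bar>\<Sum>i=2..n. b i\<bar> \<le> C1 * (1 + L) ^ (3 * q) * real n" by (simp add: mult_ac)
    qed (use C1 L in auto)
    also have "\<dots> \<le> 2 * (C1 * (c * L) ^ (3 * q)) * (C2 * real N / L ^ (4 * q))"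
    proof (intro mult_mono)
      have "1 + L \<le> c * L" using L by (simp add: c_def field_simps)
      then show "(1 + L) ^ (3 * q) \<le> (c * L) ^ (3 * q)" using L by (intro power_mono) auto
      show "(\<Sum>n=2..N. 1 / ln (real n) ^ (4 * q)) \<le> C2 * real N / L ^ (4 * q)"
        using C2(2)[OF N] by (simp add: L_def)
    qed (use C1 C2 c L in \<open>auto intro!: sum_nonneg\<close>)
    also have "\<dots> = 2 * C1 * C2 * c ^ (3 * q) * real N / L ^ q"
    proof -
      have "L ^ (4 * q) = L ^ (3 * q) * L ^ q" by (simp add: power_add[symmetric])
      then show ?thesis using L by (simp add: power_mult_distrib)
    qed
    also have "(\<Sum>n=2..N. b n * (1 / ln (real n) ^ (4 * q))) = (\<Sum>n=2..N. (mangoldt n - 1) / ln (real n))"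
    proof (rule sum.cong)
      fix n assume "n \<in> {2..N}"
      then have "ln (real n) > 0" by simp
      moreover have "ln (real n) ^ (4 * q) = ln (real n) ^ (4 * q - 1) * ln (real n)"
        using q by (simp add: power_Suc2[symmetric])
      ultimately show "b n * (1 / ln (real n) ^ (4 * q)) = (mangoldt n - 1) / ln (real n)"
        by (simp add: b_def)
    qed auto
    finally show "\<bar>\<Sum>n=2..N. (mangoldt n - 1) / ln (real n)\<bar> \<le> 2 * C1 * C2 * c ^ (3 * q) * real N / ln (real N) ^ q"
      by (simp add: L_def)
  qed
qed

section \<open>From prime powers to primes\<close>

text \<open>A proper prime power up to N has base at most sqrt N and exponent at most log N / log 2,
  so it suffices to count pairs, zero included in both coordinates.\<close>

lemma card_proper_primepow_le:
  assumes N: "N \<ge> 2"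
  shows "real (card {n\<in>{2..N}. primepow n \<and> \<not> prime n}) \<le> (sqrt (real N) + 1) * (ln (real N) / ln 2 + 1)"
proof -
  define s where "s = nat \<lfloor>sqrt (real N)\<rfloor>"
  define t where "t = nat \<lfloor>ln (real N) / ln 2\<rfloor>"
  have "{n\<in>{2..N}. primepow n \<and> \<not> prime n} \<subseteq> (\<lambda>(p, a). p ^ a) ` ({..s} \<times> {..t})"
  proof
    fix n assume "n \<in> {n\<in>{2..N}. primepow n \<and> \<not> prime n}"
    then have n: "n \<le> N" "primepow n" "\<not> prime n" by auto
    then obtain p a where pa: "prime p" "a > 0" "n = p ^ a" by (auto simp: primepow_def)
    have a: "a \<ge> 2" using pa n(3) by (cases "a = 1") auto
    have p: "p \<ge> 2" using pa(1) by (rule prime_ge_2_nat)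
    have "p ^ 2 \<le> p ^ a" using a p by (intro power_increasing) auto
    then have "real p ^ 2 \<le> real N" using pa n by (simp flip: of_nat_power)
    then have "real p \<le> sqrt (real N)" by (rule real_le_rsqrt)
    then have 1: "p \<le> s" by (simp add: s_def le_nat_iff le_floor_iff)
    have "2 ^ a \<le> p ^ a" using p by (intro power_mono) auto
    then have "(2::real) ^ a \<le> real N" using pa n by (metis dual_order.trans of_nat_le_iff of_nat_numeral of_nat_power)
    then have "ln ((2::real) ^ a) \<le> ln (real N)" using N by (subst ln_le_cancel_iff) auto
    then have "real a \<le> ln (real N) / ln 2" by (simp add: ln_realpow field_simps)
    then have "a \<le> t" by (simp add: t_def le_nat_iff le_floor_iff)
    with 1 show "n \<in> (\<lambda>(p, a). p ^ a) ` ({..s} \<times> {..t})" using pa by auto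
  qed
  then have "card {n\<in>{2..N}. primepow n \<and> \<not> prime n} \<le> card ((\<lambda>(p, a). p ^ a) ` ({..s} \<times> {..t}))"
    by (intro card_mono) auto
  also have "\<dots> \<le> card ({..s} \<times> {..t})" by (rule card_image_le) auto
  also have "\<dots> = (s + 1) * (t + 1)" by simp
  finally have "real (card {n\<in>{2..N}. primepow n \<and> \<not> prime n}) \<le> real ((s + 1) * (t + 1))" by linarith
  also have "\<dots> = (real s + 1) * (real t + 1)" by (simp add: algebra_simps)
  also have "\<dots> \<le> (sqrt (real N) + 1) * (ln (real N) / ln 2 + 1)"
    using N by (intro mult_mono) (auto simp: s_def t_def)
  finally show ?thesis .
qed

text \<open>mangoldt n / log n is 1 at primes, lies in [0, 1] at the other prime powers and vanishes
  elsewhere, so replacing it by the indicator of the primes costs O(sqrt N log N) in total.\<close>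

theorem prime_number_theorem_log_powers:
  obtains C :: real where "C > 0" "\<And>N. N \<ge> 2 \<Longrightarrow>
    \<bar>(\<Sum>n=2..N. of_bool (prime n) - 1 / ln (real n))\<bar> \<le> C * real N / ln (real N) ^ q"
proof -
  \<comment> \<open>\<open>mangoldt_over_ln_sum_bound\<close> asks for a positive exponent, while
    \<open>q\<close> may be 0; the extra logarithm is at least ln 2 and is dropped.\<close>
  define q' where "q' = Suc q"
  obtain C1 :: real where C1: "C1 > 0" "\<And>N. N \<ge> 2 \<Longrightarrow>
    \<bar>\<Sum>n=2..N. (mangoldt n - 1) / ln (real n)\<bar> \<le> C1 * real N / ln (real N) ^ q'"
    using mangoldt_over_ln_sum_bound[of q'] by (auto simp: q'_def)
  obtain C2 :: real where C2: "C2 > 0" "\<And>r::real. r \<ge> 1 \<Longrightarrow> (1 + ln r) ^ (q + 1) \<le> C2 * r powr (1/2)"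
    by (rule one_plus_ln_power_le_powr[of "1/2" "q + 1"]) (simp, blast)
  define C where "C = C1 / ln 2 + 2 * C2 / ln 2"
  show ?thesis
  proof
    show "C > 0" using C1 C2 by (simp add: C_def add_pos_pos)
    fix N :: nat assume N: "N \<ge> 2"
    define L where "L = ln (real N)"
    have L: "L > 0" "L \<ge> ln 2" using N by (simp_all add: L_def)
    define P where "P = {n\<in>{2..N}. primepow n \<and> \<not> prime n}"
    have ptw: "\<bar>mangoldt n / ln (real n) - of_bool (prime n)\<bar> \<le> of_bool (primepow n \<and> \<not> prime n)" if n: "n \<in> {2..N}" for n
    proof (cases "primepow n \<and> \<not> prime n")
      case True
      then show ?thesis using n mangoldt_le[of n] mangoldt_nonneg[of n] by (auto simp: abs_if field_simps)
    next
      case False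
      then show ?thesis using n by (cases "prime n") (auto simp: mangoldt_def)
    qed
    have "\<bar>\<Sum>n=2..N. mangoldt n / ln (real n) - of_bool (prime n)\<bar> \<le> (\<Sum>n=2..N. of_bool (primepow n \<and> \<not> prime n))"
      by (rule order_trans[OF sum_abs sum_mono]) (rule ptw)
    also have "\<dots> = real (card P)" by (simp add: P_def sum.If_cases of_bool_def Int_def)
    also have "\<dots> \<le> (sqrt (real N) + 1) * (L / ln 2 + 1)"
      unfolding P_def L_def by (rule card_proper_primepow_le[OF N])
    also have "\<dots> \<le> (2 * sqrt (real N)) * ((1 + L) / ln 2)"
      using N L ln_2_less_1 by (intro mult_mono) (auto simp: add_divide_distrib)
    also have "\<dots> \<le> 2 * C2 / ln 2 * real N / L ^ q"
    proof -
      have "(1 + L) * L ^ q \<le> (1 + L) * (1 + L) ^ q" using L by (intro mult_left_mono power_mono) auto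
      also have "\<dots> \<le> C2 * sqrt (real N)" using C2(2)[of "real N"] N by (simp add: L_def powr_half_sqrt)
      finally have "2 * sqrt (real N) / ln 2 * ((1 + L) * L ^ q) \<le> 2 * sqrt (real N) / ln 2 * (C2 * sqrt (real N))"
        by (intro mult_left_mono) auto
      also have "\<dots> = 2 * C2 / ln 2 * (sqrt (real N) * sqrt (real N))" by simp
      also have "sqrt (real N) * sqrt (real N) = real N" by simp
      finally show ?thesis using L by (simp add: field_simps)
    qed
    finally have 1: "\<bar>\<Sum>n=2..N. mangoldt n / ln (real n) - of_bool (prime n)\<bar> \<le> 2 * C2 / ln 2 * real N / L ^ q" .
    have 2: "\<bar>\<Sum>n=2..N. (mangoldt n - 1) / ln (real n)\<bar> \<le> C1 / ln 2 * real N / L ^ q"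
    proof -
      have "C1 * real N / L ^ q' = C1 * real N / L ^ q / L" by (simp add: q'_def)
      also have "\<dots> \<le> C1 * real N / L ^ q / ln 2" using L C1 by (intro divide_left_mono) auto
      finally show ?thesis using C1(2)[OF N] by (simp add: L_def mult_ac)
    qed
    have "(\<Sum>n=2..N. of_bool (prime n) - 1 / ln (real n)) =
        (\<Sum>n=2..N. (mangoldt n - 1) / ln (real n)) - (\<Sum>n=2..N. mangoldt n / ln (real n) - of_bool (prime n))"
      by (simp add: sum_subtractf[symmetric] diff_divide_distrib)
    then have "\<bar>(\<Sum>n=2..N. of_bool (prime n) - 1 / ln (real n))\<bar> \<le> C1 / ln 2 * real N / L ^ q + 2 * C2 / ln 2 * real N / L ^ q"
      using 1 2 by linarith
    also have "\<dots> = C * real N / L ^ q" by (simp add: C_def add_divide_distrib ring_distribs)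
    finally show "\<bar>(\<Sum>n=2..N. of_bool (prime n) - 1 / ln (real n))\<bar> \<le> C * real N / ln (real N) ^ q" by (simp add: L_def)
  qed
qed

subsection \<open>The local factors\<close>

text \<open>Young's inequality for the convolution of an l^2 with an l^1 sequence, from
  Cauchy-Schwarz with \<open>v\<close> split into two square roots. It serves both the Lipschitz
  bound for log I_0 and the upper bound for the local factors.\<close>

lemma Cauchy_product_square_sum:
  fixes u v :: "nat \<Rightarrow> real"
  assumes u: "\<And>i. u i \<ge> 0" "summable (\<lambda>i. (u i)\<^sup>2)" and v: "\<And>i. v i \<ge> 0" "summable v"
  shows "summable (\<lambda>a. (\<Sum>i\<le>a. u i * v (a - i))\<^sup>2)"
    and "(\<Sum>a. (\<Sum>i\<le>a. u i * v (a - i))\<^sup>2) \<le> (suminf v)\<^sup>2 * (\<Sum>i. (u i)\<^sup>2)"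
proof -
  have cp: "(\<lambda>a. \<Sum>i\<le>a. (u i)\<^sup>2 * v (a - i)) sums ((\<Sum>i. (u i)\<^sup>2) * suminf v)"
    using u v by (intro Cauchy_product_sums) auto
  have le: "(\<Sum>i\<le>a. u i * v (a - i))\<^sup>2 \<le> suminf v * (\<Sum>i\<le>a. (u i)\<^sup>2 * v (a - i))" for a
  proof -
    have "(\<Sum>i\<le>a. u i * v (a - i))\<^sup>2 = (\<Sum>i\<le>a. (u i * sqrt (v (a - i))) * sqrt (v (a - i)))\<^sup>2"
      using v by (simp add: mult.assoc)
    also have "\<dots> \<le> (\<Sum>i\<le>a. (u i * sqrt (v (a - i)))\<^sup>2) * (\<Sum>i\<le>a. (sqrt (v (a - i)))\<^sup>2)"
      by (rule Cauchy_Schwarz_ineq_sum)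
    also have "\<dots> = (\<Sum>i\<le>a. v (a - i)) * (\<Sum>i\<le>a. (u i)\<^sup>2 * v (a - i))"
      using v by (simp add: power_mult_distrib mult.commute)
    also have "(\<Sum>i\<le>a. v (a - i)) = (\<Sum>i\<le>a. v i)"
      by (rule sum.reindex_bij_witness[of _ "\<lambda>i. a - i" "\<lambda>i. a - i"]) auto
    also have "(\<Sum>i\<le>a. v i) * (\<Sum>i\<le>a. (u i)\<^sup>2 * v (a - i)) \<le> suminf v * (\<Sum>i\<le>a. (u i)\<^sup>2 * v (a - i))"
      using v by (intro mult_right_mono sum_le_suminf sum_nonneg mult_nonneg_nonneg) auto
    finally show ?thesis .
  qed
  have s: "(\<lambda>a. suminf v * (\<Sum>i\<le>a. (u i)\<^sup>2 * v (a - i))) sums (suminf v * ((\<Sum>i. (u i)\<^sup>2) * suminf v))"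
    by (rule sums_mult[OF cp])
  show sm: "summable (\<lambda>a. (\<Sum>i\<le>a. u i * v (a - i))\<^sup>2)"
    by (rule summable_comparison_test'[OF sums_summable[OF s], of 0]) (use le in auto)
  show "(\<Sum>a. (\<Sum>i\<le>a. u i * v (a - i))\<^sup>2) \<le> (suminf v)\<^sup>2 * (\<Sum>i. (u i)\<^sup>2)"
    using suminf_le[OF le sm sums_summable[OF s]] sums_unique[OF s] by (simp add: power2_eq_square mult_ac)
qed

text \<open>By Markov's inequality half of the mass of \<open>c\<close> sits on the first \<open>N\<close> terms.\<close>

lemma suminf_square_bounds:
  fixes c :: "nat \<Rightarrow> real"
  assumes c: "\<And>a. c a \<ge> 0" "c sums S" and m: "(\<lambda>a. real a * c a) sums S'" "S' \<le> M * S"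
    and N: "N \<ge> 1" "2 * M \<le> real N" and S: "S > 0"
  shows "summable (\<lambda>a. (c a)\<^sup>2)" "(\<Sum>a. (c a)\<^sup>2) \<le> S\<^sup>2" "S\<^sup>2 / (4 * real N) \<le> (\<Sum>a. (c a)\<^sup>2)"
proof -
  have sc: "summable c" "suminf c = S" using c by (auto simp: sums_iff)
  have cS: "c a \<le> S" for a
    using sum_le_suminf[OF sc(1), of "{a}"] c sc by auto
  have sS: "(\<lambda>a. S * c a) sums (S * S)" by (rule sums_mult[OF c(2)])
  have sq: "(c a)\<^sup>2 \<le> S * c a" for a using cS[of a] c(1)[of a] by (simp add: power2_eq_square mult_right_mono)
  show sm: "summable (\<lambda>a. (c a)\<^sup>2)"
    by (rule summable_comparison_test'[OF sums_summable[OF sS], of 0]) (use sq in auto)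
  show "(\<Sum>a. (c a)\<^sup>2) \<le> S\<^sup>2"
    using suminf_le[OF sq sm sums_summable[OF sS]] sums_unique[OF sS] by (simp add: power2_eq_square)
  have "S \<le> (\<Sum>a<N. c a) + S / 2"
  proof -
    have "(\<lambda>a. real N * (c a - of_bool (a < N) * c a)) sums (real N * (S - (\<Sum>a<N. c a)))"
    proof (intro sums_mult sums_diff c(2))
      have "(\<lambda>a. of_bool (a < N) * c a) sums (\<Sum>a<N. of_bool (a < N) * c a)"
        by (rule sums_finite) auto
      then show "(\<lambda>a. of_bool (a < N) * c a) sums (\<Sum>a<N. c a)" by simp
    qed
    from sums_le[OF _ this m(1)] have "real N * (S - (\<Sum>a<N. c a)) \<le> S'"
      using c(1) by (auto simp: mult_right_mono)
    also have "S' \<le> M * S" by (rule m)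
    also have "M * S \<le> real N / 2 * S" using N S by (intro mult_right_mono) auto
    finally show ?thesis using N by (simp add: field_simps)
  qed
  \<comment> \<open>Mass S/2 on \<open>N\<close> terms forces squares of total at least (S/2)^2 / N,
    by Cauchy-Schwarz with the constant sequence 1.\<close>
  then have "(S / 2)\<^sup>2 \<le> (\<Sum>a<N. 1 * c a)\<^sup>2" using S by (intro power_mono) auto
  also have "\<dots> \<le> (\<Sum>a<N. 1\<^sup>2) * (\<Sum>a<N. (c a)\<^sup>2)" by (rule Cauchy_Schwarz_ineq_sum)
  also have "\<dots> \<le> real N * (\<Sum>a. (c a)\<^sup>2)"
    using sum_le_suminf[OF sm, of "{..<N}"] by (simp add: mult_left_mono)
  finally show "S\<^sup>2 / (4 * real N) \<le> (\<Sum>a. (c a)\<^sup>2)" using N by (simp add: field_simps power2_eq_square)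
qed

section \<open>Size and regularity of log I_0\<close>

lemma exp_real_sums: "(\<lambda>a. s ^ a / fact a) sums exp (s :: real)"
  using exp_converges[of s] by (simp add: divide_inverse mult.commute)

text \<open>I_0 appears as a squared l^2 norm of the exponential coefficients, the form in which the
  Cauchy-Schwarz arguments apply.\<close>

lemma bessel_I0_eq: "bessel_I0 (2 * s) = (\<Sum>a. (s ^ a / fact a)\<^sup>2)"
  by (simp add: bessel_I0_def power_divide power_mult[symmetric] mult.commute)

text \<open>The coefficients are unnormalised Poisson weights of total mass e^s and mean s, so about
  2s of them carry half of the mass in \<open>suminf_square_bounds\<close>. Thus I_0(t) is e^t up to
  a factor linear in t.\<close>

lemma bessel_I0_facts:
  assumes s: "s \<ge> 0"
  shows "summable (\<lambda>a. (s ^ a / fact a)\<^sup>2)" "bessel_I0 (2 * s) \<le> exp (2 * s)"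
    "exp (2 * s) / (4 * (2 * s + 2)) \<le> bessel_I0 (2 * s)"
proof -
  define N where "N = nat \<lceil>2 * s\<rceil> + 1"
  have N: "N \<ge> 1" "2 * s \<le> real N" "real N \<le> 2 * s + 2" using s by (auto simp: N_def) linarith+
  have "(\<lambda>a. real (Suc a) * (s ^ Suc a / fact (Suc a))) sums (s * exp s)"
    using sums_mult[OF exp_real_sums[of s], of s] by (simp add: fact_Suc del: of_nat_Suc)
  then have m: "(\<lambda>a. real a * (s ^ a / fact a)) sums (s * exp s)"
    by (subst (asm) sums_Suc_iff) simp
  note * = suminf_square_bounds[OF _ exp_real_sums[of s] m order_refl N(1,2)]
  show "summable (\<lambda>a. (s ^ a / fact a)\<^sup>2)" by (rule *) (use s in auto)
  have "bessel_I0 (2 * s) \<le> (exp s)\<^sup>2" unfolding bessel_I0_eq by (rule *) (use s in auto)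
  then show "bessel_I0 (2 * s) \<le> exp (2 * s)" by (simp add: exp_double)
  have "exp (2 * s) / (4 * (2 * s + 2)) \<le> (exp s)\<^sup>2 / (4 * real N)"
    unfolding exp_double using N s by (intro divide_left_mono) auto
  also have "\<dots> \<le> bessel_I0 (2 * s)" unfolding bessel_I0_eq by (rule *) (use s in auto)
  finally show "exp (2 * s) / (4 * (2 * s + 2)) \<le> bessel_I0 (2 * s)" .
qed

lemma bessel_I0_ge_1: "t \<ge> 0 \<Longrightarrow> bessel_I0 t \<ge> 1"
  using sum_le_suminf[OF bessel_I0_facts(1)[of "t / 2"], of "{0}"] bessel_I0_eq[of "t / 2"] by auto

lemma ln_bessel_I0_bounds:
  assumes t: "t \<ge> 0"
  shows "0 \<le> ln (bessel_I0 t)" "ln (bessel_I0 t) \<le> t" "t - ln (4 * (t + 2)) \<le> ln (bessel_I0 t)"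
proof -
  have I: "bessel_I0 t \<ge> 1" using bessel_I0_ge_1[OF t] .
  then show "0 \<le> ln (bessel_I0 t)" by simp
  have "ln (bessel_I0 t) \<le> ln (exp t)" using I bessel_I0_facts(2)[of "t / 2"] t by (subst ln_le_cancel_iff) auto
  then show "ln (bessel_I0 t) \<le> t" by simp
  have "ln (exp t / (4 * (t + 2))) \<le> ln (bessel_I0 t)"
    using I bessel_I0_facts(3)[of "t / 2"] t by (subst ln_le_cancel_iff) auto
  then show "t - ln (4 * (t + 2)) \<le> ln (bessel_I0 t)" using t by (subst (asm) ln_div) auto
qed

text \<open>Replacing one of the two factorials by 1 leaves the series of exp (t^2 / 4). The
  quadratic order at 0 makes the C_j converge there and is responsible for the error k/y.\<close>

lemma ln_bessel_I0_le_square: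
  assumes t: "t \<ge> 0" shows "ln (bessel_I0 t) \<le> t\<^sup>2 / 4"
proof -
  have "(\<Sum>a. ((t / 2) ^ a / fact a)\<^sup>2) \<le> (\<Sum>a. (t\<^sup>2 / 4) ^ a / fact a)"
  proof (rule suminf_le)
    fix a
    have "((t / 2) ^ a / fact a)\<^sup>2 = (t\<^sup>2 / 4) ^ a / (fact a * fact a)"
      by (simp add: power_divide power2_eq_square power_mult_distrib) (simp add: power_mult_distrib[symmetric])
    also have "\<dots> \<le> (t\<^sup>2 / 4) ^ a / (fact a * 1)"
      by (intro divide_left_mono mult_left_mono fact_ge_1) auto
    finally show "((t / 2) ^ a / fact a)\<^sup>2 \<le> (t\<^sup>2 / 4) ^ a / fact a" by simp
  qed (use bessel_I0_facts(1)[of "t / 2"] exp_real_sums[of "t\<^sup>2 / 4"] t in \<open>auto simp: sums_iff\<close>)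
  also have "\<dots> = exp (t\<^sup>2 / 4)" using exp_real_sums[of "t\<^sup>2 / 4"] by (simp add: sums_iff)
  finally have "bessel_I0 t \<le> exp (t\<^sup>2 / 4)" using bessel_I0_eq[of "t / 2"] by simp
  then have "ln (bessel_I0 t) \<le> ln (exp (t\<^sup>2 / 4))" using bessel_I0_ge_1[OF t] by (subst ln_le_cancel_iff) auto
  then show ?thesis by simp
qed

text \<open>By the binomial theorem the coefficients at s + r are the convolution of those at s and
  at r, so \<open>Cauchy_product_square_sum\<close> gives I_0(t') <= exp (t' - t) I_0(t) without
  differentiating I_0. Monotonicity is termwise.\<close>

lemma ln_bessel_I0_Lipschitz:
  assumes "0 \<le> t" "t \<le> t'"
  shows "ln (bessel_I0 t) \<le> ln (bessel_I0 t')" "ln (bessel_I0 t') \<le> ln (bessel_I0 t) + (t' - t)"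
proof -
  define s r where "s = t / 2" and "r = (t' - t) / 2"
  have sr: "s \<ge> 0" "r \<ge> 0" using assms by (auto simp: s_def r_def)
  have tt: "t = 2 * s" "t' = 2 * (s + r)" by (auto simp: s_def r_def field_simps)
  have I1: "bessel_I0 t \<ge> 1" "bessel_I0 t' \<ge> 1" using assms by (auto intro!: bessel_I0_ge_1)
  have "bessel_I0 t \<le> bessel_I0 t'"
    unfolding tt bessel_I0_eq using sr
    by (intro suminf_le bessel_I0_facts power_mono divide_right_mono) auto
  then show "ln (bessel_I0 t) \<le> ln (bessel_I0 t')" using I1 by simp
  have binom: "(\<Sum>i\<le>a. (s ^ i / fact i) * (r ^ (a - i) / fact (a - i))) = (s + r) ^ a / fact a" for a
  proof -
    have "(s + r) ^ a / fact a = (\<Sum>i\<le>a. of_nat (a choose i) * s ^ i * r ^ (a - i)) / fact a"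
      by (simp add: binomial_ring)
    also have "\<dots> = (\<Sum>i\<le>a. (s ^ i / fact i) * (r ^ (a - i) / fact (a - i)))"
      unfolding sum_divide_distrib by (intro sum.cong) (auto simp: binomial_fact field_simps)
    finally show ?thesis ..
  qed
  have "(\<Sum>a. (\<Sum>i\<le>a. (s ^ i / fact i) * (r ^ (a - i) / fact (a - i)))\<^sup>2) \<le> (\<Sum>a. r ^ a / fact a)\<^sup>2 * (\<Sum>i. (s ^ i / fact i)\<^sup>2)"
    using sr bessel_I0_facts(1)[of s] exp_real_sums[of r] by (intro Cauchy_product_square_sum) (auto simp: sums_iff)
  then have "bessel_I0 t' \<le> (exp r)\<^sup>2 * bessel_I0 t"
    unfolding tt bessel_I0_eq binom using exp_real_sums[of r] by (simp add: sums_iff)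
  also have "(exp r)\<^sup>2 = exp (t' - t)" by (simp add: exp_double[symmetric] r_def)
  finally have "ln (bessel_I0 t') \<le> ln (exp (t' - t) * bessel_I0 t)" using I1 by (subst ln_le_cancel_iff) auto
  also have "\<dots> = (t' - t) + ln (bessel_I0 t)" using I1 by (subst ln_mult) auto
  finally show "ln (bessel_I0 t') \<le> ln (bessel_I0 t) + (t' - t)" by simp
qed

section \<open>Local factors by formal power series\<close>

lemma fps_mult_sums:
  fixes F G :: "real fps"
  assumes "summable (\<lambda>a. \<bar>fps_nth F a * x ^ a\<bar>)" "(\<lambda>a. fps_nth F a * x ^ a) sums s"
    and "summable (\<lambda>a. \<bar>fps_nth G a * x ^ a\<bar>)" "(\<lambda>a. fps_nth G a * x ^ a) sums t"
  shows "(\<lambda>a. fps_nth (F * G) a * x ^ a) sums (s * t)"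
proof -
  have "(\<lambda>a. \<Sum>i\<le>a. (fps_nth F i * x ^ i) * (fps_nth G (a - i) * x ^ (a - i))) sums (s * t)"
    using Cauchy_product_sums[of "\<lambda>a. fps_nth F a * x ^ a" "\<lambda>a. fps_nth G a * x ^ a"] assms by (simp add: sums_iff)
  moreover have "(\<Sum>i\<le>a. (fps_nth F i * x ^ i) * (fps_nth G (a - i) * x ^ (a - i))) = fps_nth (F * G) a * x ^ a" for a
    unfolding fps_mult_nth sum_distrib_right atMost_atLeast0
    by (intro sum.cong) (auto simp: power_add[symmetric] mult_ac)
  ultimately show ?thesis by simp
qed

lemma fps_power_nonneg_sums:
  fixes F :: "real fps"
  assumes nn: "\<And>a. fps_nth F a \<ge> 0" and x: "x \<ge> 0" and s: "(\<lambda>a. fps_nth F a * x ^ a) sums s"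
  shows "fps_nth (F ^ k) a \<ge> 0" "(\<lambda>a. fps_nth (F ^ k) a * x ^ a) sums (s ^ k)"
proof -
  have "(\<forall>a. fps_nth (F ^ k) a \<ge> 0) \<and> (\<lambda>a. fps_nth (F ^ k) a * x ^ a) sums (s ^ k)"
  proof (induction k)
    case 0
    have "(\<lambda>a. fps_nth (1::real fps) a * x ^ a) sums (\<Sum>a\<in>{0}. fps_nth (1::real fps) a * x ^ a)"
      by (rule sums_finite) auto
    then show ?case by simp
  next
    case (Suc k)
    then have ih: "\<And>a. fps_nth (F ^ k) a \<ge> 0" "(\<lambda>a. fps_nth (F ^ k) a * x ^ a) sums (s ^ k)" by auto
    have "(\<lambda>a. fps_nth (F * F ^ k) a * x ^ a) sums (s * s ^ k)"
      using ih nn x s by (intro fps_mult_sums) (auto simp: sums_iff)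
    moreover have "fps_nth (F * F ^ k) a \<ge> 0" for a
      using ih nn by (auto simp: fps_mult_nth intro!: sum_nonneg mult_nonneg_nonneg)
    ultimately show ?case by simp
  qed
  then show "fps_nth (F ^ k) a \<ge> 0" "(\<lambda>a. fps_nth (F ^ k) a * x ^ a) sums (s ^ k)" by auto
qed

text \<open>At x = 1/p the terms are d_k(p^a)^2 / p^(2a), by
  \<open>div_count_prime_power\<close>.\<close>

definition local_factor :: "nat \<Rightarrow> real \<Rightarrow> real" where
  "local_factor k x = (\<Sum>a. (real ((k + a - 1) choose a) * x ^ a)\<^sup>2)"

definition geo_fps :: "real fps" where "geo_fps = Abs_fps (\<lambda>_. 1)"

lemma geo_fps_sums: "0 \<le> x \<Longrightarrow> x < 1 \<Longrightarrow> (\<lambda>a. fps_nth geo_fps a * x ^ a) sums (1 / (1 - x))"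
  using geometric_sums[of x] by (simp add: geo_fps_def)

lemma geo_fps_power_nth: "k \<ge> 1 \<Longrightarrow> fps_nth (geo_fps ^ k) a = real ((k + a - 1) choose a)"
proof (induction k arbitrary: a rule: nat_induct_at_least)
  case base
  then show ?case by (simp add: geo_fps_def)
next
  case (Suc k)
  have "fps_nth (geo_fps ^ Suc k) a = (\<Sum>i\<le>a. fps_nth (geo_fps ^ k) i)"
    by (subst power_Suc2) (simp add: fps_mult_nth geo_fps_def atMost_atLeast0)
  also have "\<dots> = real (\<Sum>i\<le>a. (k - 1 + i) choose i)"
    unfolding Suc.IH of_nat_sum using Suc.hyps by (intro sum.cong) (auto simp: add_ac)
  also have "\<dots> = real (Suc (k - 1 + a) choose a)" by (simp only: sum_choose_lower)
  finally show ?case using Suc.hyps by simp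
qed

text \<open>This is e^(-X) / (1 - X), the exponential generating function of the derangement
  numbers; its coefficients are the partial sums of the series for 1/e.\<close>

definition exp_geo_fps :: "real fps" where "exp_geo_fps = fps_exp (-1) * geo_fps"

text \<open>Consecutive terms pair up as 1/(2m)! - 1/(2m + 1)! >= 0, and an even \<open>n\<close>
  leaves one further positive term.\<close>

lemma alternating_exp_sum_nonneg: "(\<Sum>i\<le>n. (-1) ^ i / fact i :: real) \<ge> 0"
proof -
  have even: "(\<Sum>i<2 * m. (-1) ^ i / fact i :: real) \<ge> 0" for m
  proof (induction m)
    case (Suc m)
    have "(fact (2 * m) :: real) \<le> fact (2 * m + 1)" by (intro fact_mono) auto
    then have "1 / fact (2 * m + 1) \<le> (1 / fact (2 * m) :: real)" by (intro divide_left_mono) auto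
    then show ?case using Suc by simp
  qed auto
  show ?thesis
  proof (cases "odd n")
    case True
    then obtain m where "Suc n = 2 * m" by (metis evenE even_Suc)
    then show ?thesis using even[of m] by (metis lessThan_Suc_atMost)
  next
    case False
    then obtain m where m: "n = 2 * m" by (auto elim: evenE)
    then have "(\<Sum>i\<le>n. (-1) ^ i / fact i :: real) = (\<Sum>i<2 * m. (-1) ^ i / fact i) + 1 / fact (2 * m)"
      by (simp add: lessThan_Suc_atMost[symmetric])
    then show ?thesis using even[of m] by simp
  qed
qed

lemma exp_geo_fps_nonneg: "fps_nth exp_geo_fps a \<ge> 0"
proof -
  have "fps_nth exp_geo_fps a = (\<Sum>i\<le>a. (-1) ^ i / fact i)"
    by (simp add: exp_geo_fps_def fps_mult_nth geo_fps_def atMost_atLeast0)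
  then show ?thesis using alternating_exp_sum_nonneg[of a] by simp
qed

lemma exp_geo_fps_sums:
  assumes "0 \<le> x" "x < 1"
  shows "(\<lambda>a. fps_nth exp_geo_fps a * x ^ a) sums (exp (-x) * (1 / (1 - x)))"
  unfolding exp_geo_fps_def
proof (rule fps_mult_sums)
  have "summable (\<lambda>a. norm ((-x) ^ a /\<^sub>R fact a))" by (rule summable_norm_exp)
  then show "summable (\<lambda>a. \<bar>fps_nth (fps_exp (-1)) a * x ^ a\<bar>)"
    by (simp add: abs_mult power_abs divide_inverse mult.commute)
  have "(\<lambda>a. (-x) ^ a / fact a) sums exp (-x)" by (rule exp_real_sums)
  then show "(\<lambda>a. fps_nth (fps_exp (-1)) a * x ^ a) sums exp (-x)"
    by (simp add: power_minus[of x] mult.commute)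
  show "(\<lambda>a. fps_nth geo_fps a * x ^ a) sums (1 / (1 - x))" by (rule geo_fps_sums[OF assms])
  then show "summable (\<lambda>a. \<bar>fps_nth geo_fps a * x ^ a\<bar>)" using assms by (simp add: geo_fps_def sums_iff)
qed

text \<open>In closed form: \<open>(1-X)^{-k} = e^{kX} (e^{-X}/(1-X))^k\<close>.\<close>

lemma exp_geo_fps_factor: "fps_exp (real k) * exp_geo_fps ^ k = geo_fps ^ k"
proof -
  have "fps_exp (real k) * fps_exp (- real k) = 1"
    by (simp add: fps_exp_add_mult[symmetric])
  then show ?thesis
    by (simp add: exp_geo_fps_def power_mult_distrib fps_exp_power_mult mult.assoc[symmetric])
qed

text \<open>The coefficients of (1 - X)^(-k), scaled by x^a, are the convolution of (k x)^i / i!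
  with the nonnegative \<open>v\<close>. As v 0 = 1, keeping one term of the convolution gives the
  lower bound; \<open>Cauchy_product_square_sum\<close> gives the upper one, with the squared total
  mass of \<open>v\<close>.\<close>

lemma local_factor_bounds:
  assumes k: "k \<ge> 1" and x: "0 \<le> x" "x < 1"
  shows "bessel_I0 (2 * (real k * x)) \<le> local_factor k x"
    "local_factor k x \<le> (exp (-x) * (1 / (1 - x))) ^ (2 * k) * bessel_I0 (2 * (real k * x))"
proof -
  define u where "u = (\<lambda>i. (real k * x) ^ i / fact i)"
  define v where "v = (\<lambda>j. fps_nth (exp_geo_fps ^ k) j * x ^ j)"
  note v_facts = fps_power_nonneg_sums[OF exp_geo_fps_nonneg x(1) exp_geo_fps_sums[OF x], of k]
  have v: "v j \<ge> 0" "v sums ((exp (-x) * (1 / (1 - x))) ^ k)" for j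
    using v_facts x by (auto simp: v_def)
  have u: "u i \<ge> 0" "summable (\<lambda>i. (u i)\<^sup>2)" for i
    using x bessel_I0_facts(1)[of "real k * x"] by (auto simp: u_def)
  have conv: "(\<Sum>i\<le>a. u i * v (a - i)) = real ((k + a - 1) choose a) * x ^ a" for a
  proof -
    have "real ((k + a - 1) choose a) * x ^ a = fps_nth (fps_exp (real k) * exp_geo_fps ^ k) a * x ^ a"
      unfolding exp_geo_fps_factor geo_fps_power_nth[OF k] ..
    also have "\<dots> = (\<Sum>i\<le>a. u i * v (a - i))"
      unfolding fps_mult_nth sum_distrib_right atMost_atLeast0
      by (intro sum.cong) (auto simp: u_def v_def power_mult_distrib power_add[symmetric] mult_ac)
    finally show ?thesis ..
  qed
  have "local_factor k x \<le> (suminf v)\<^sup>2 * (\<Sum>i. (u i)\<^sup>2)" "summable (\<lambda>a. (real ((k + a - 1) choose a) * x ^ a)\<^sup>2)"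
    using Cauchy_product_square_sum[OF u(1) u(2) v(1) sums_summable[OF v(2)]]
    unfolding conv by (auto simp: local_factor_def)
  note lf = this
  then show "local_factor k x \<le> (exp (-x) * (1 / (1 - x))) ^ (2 * k) * bessel_I0 (2 * (real k * x))"
    using v(2) by (simp add: sums_iff bessel_I0_eq u_def power_mult[symmetric] mult.commute)
  have "v 0 = 1"
    using fps_power_zeroth_eq_one[of exp_geo_fps k] by (simp add: v_def exp_geo_fps_def geo_fps_def)
  then have le: "u a \<le> real ((k + a - 1) choose a) * x ^ a" for a
    using member_le_sum[of a "{..a}" "\<lambda>i. u i * v (a - i)"] u v unfolding conv by auto
  show "bessel_I0 (2 * (real k * x)) \<le> local_factor k x"
    unfolding bessel_I0_eq local_factor_def using le u(1) lf(2) bessel_I0_facts(1)[of "real k * x"] x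
    by (intro suminf_le power_mono) (auto simp: u_def)
qed

text \<open>The coefficients are unnormalised negative binomial weights with mean k x / (1 - x),
  which is at most k for x <= 1/2, so 2k of them carry half of the mass. This is for small primes,
  where the comparison with I_0 is too weak.\<close>

lemma local_factor_bounds':
  assumes k: "k \<ge> 1" and x: "0 \<le> x" "x \<le> 1/2"
  shows "summable (\<lambda>a. (real ((k + a - 1) choose a) * x ^ a)\<^sup>2)"
    "local_factor k x \<le> ((1 / (1 - x)) ^ k)\<^sup>2"
    "((1 / (1 - x)) ^ k)\<^sup>2 / (8 * real k) \<le> local_factor k x"
proof -
  have x1: "x < 1" using x by simp
  define c where "c = (\<lambda>k a. real ((k + a - 1) choose a) * x ^ a)"
  have c: "c k a \<ge> 0" "c k sums (1 / (1 - x)) ^ k" if "k \<ge> 1" for k a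
  proof -
    show "c k a \<ge> 0" using x by (simp add: c_def)
    have "fps_nth geo_fps a \<ge> 0" for a by (simp add: geo_fps_def)
    from fps_power_nonneg_sums(2)[OF this x(1) geo_fps_sums[OF x(1) x1], of k]
    show "c k sums (1 / (1 - x)) ^ k" unfolding c_def geo_fps_power_nth[OF that] .
  qed
  \<comment> \<open>By the absorption identity, weighting with the index leads from k to k + 1,
    where the series sums in closed form; this gives the mean.\<close>
  have rec: "real (Suc a) * c k (Suc a) = real k * x * c (Suc k) a" for a
  proof -
    have "Suc a * ((k + a) choose (Suc a)) = k * ((k + a) choose a)"
      using binomial_absorption[of a "k + a"] binomial_absorb_comp[of "k + a" a] k
      by (metis add_diff_cancel_right' binomial_absorption mult.commute)
    then have "real (Suc a) * real ((k + a) choose (Suc a)) = real k * real ((k + a) choose a)"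
      by (metis of_nat_mult)
    then show ?thesis using k by (simp add: c_def mult_ac del: of_nat_Suc)
  qed
  have "(\<lambda>a. real (Suc a) * c k (Suc a)) sums (real k * x * (1 / (1 - x)) ^ (Suc k))"
    unfolding rec by (intro sums_mult c) auto
  then have m: "(\<lambda>a. real a * c k a) sums (real k * x * (1 / (1 - x)) ^ (Suc k))"
    by (subst (asm) sums_Suc_iff) simp
  have m2: "real k * x * (1 / (1 - x)) ^ (Suc k) \<le> real k * (1 / (1 - x)) ^ k"
  proof -
    have "x * (1 / (1 - x)) \<le> 1" using x by (simp add: field_simps)
    then have "(real k * (1 / (1 - x)) ^ k) * (x * (1 / (1 - x))) \<le> (real k * (1 / (1 - x)) ^ k) * 1"
      using x by (intro mult_left_mono) auto
    then show ?thesis by (simp add: mult_ac)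
  qed
  have S: "(1 / (1 - x)) ^ k > 0" using x by simp
  have N: "1 \<le> 2 * k" "2 * real k \<le> real (2 * k)" using k by auto
  note * = suminf_square_bounds[OF c[OF k] m m2 N S]
  show "summable (\<lambda>a. (real ((k + a - 1) choose a) * x ^ a)\<^sup>2)"
    "local_factor k x \<le> ((1 / (1 - x)) ^ k)\<^sup>2"
    "((1 / (1 - x)) ^ k)\<^sup>2 / (8 * real k) \<le> local_factor k x"
    using * by (simp_all add: local_factor_def c_def)
qed

text \<open>The comparison with I_0 is for p > sqrt k, the two bounds with 2 k ln (1 - x) are for p
  <= sqrt k, and the last one trades the removed factor for the linear term t = 2kx.\<close>

lemma ln_local_factor:
  assumes k: "k \<ge> 1" and x: "0 \<le> x" "x \<le> 1/2"
  shows "local_factor k x > 0"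
    "0 \<le> ln (local_factor k x) - ln (bessel_I0 (2 * (real k * x)))"
    "ln (local_factor k x) - ln (bessel_I0 (2 * (real k * x))) \<le> 4 * real k * x\<^sup>2"
    "ln (local_factor k x) + 2 * real k * ln (1 - x) \<le> 0"
    "- ln (8 * real k) \<le> ln (local_factor k x) + 2 * real k * ln (1 - x)"
    "2 * real k * (- x - ln (1 - x)) \<le> 4 * real k * x\<^sup>2"
proof -
  have x1: "x < 1" using x by simp
  have I: "bessel_I0 (2 * (real k * x)) \<ge> 1" using x by (intro bessel_I0_ge_1) auto
  note 1 = local_factor_bounds[OF k x(1) x1]
  note 2 = local_factor_bounds'[OF k x]
  show pos: "local_factor k x > 0" using 1(1) I by simp
  show "0 \<le> ln (local_factor k x) - ln (bessel_I0 (2 * (real k * x)))" using 1(1) I pos by simp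
  have lx: "- x - ln (1 - x) \<le> 2 * x\<^sup>2" using ln_one_minus_pos_lower_bound[of x] x by simp
  then have "2 * real k * (- x - ln (1 - x)) \<le> 2 * real k * (2 * x\<^sup>2)" by (intro mult_left_mono) auto
  then show 3: "2 * real k * (- x - ln (1 - x)) \<le> 4 * real k * x\<^sup>2" by simp
  have "ln (local_factor k x) \<le> ln ((exp (-x) * (1 / (1 - x))) ^ (2 * k) * bessel_I0 (2 * (real k * x)))"
    using 1(2) pos I x by (subst ln_le_cancel_iff) auto
  also have "\<dots> = 2 * real k * (- x - ln (1 - x)) + ln (bessel_I0 (2 * (real k * x)))"
    using x I by (simp add: ln_mult ln_realpow ln_div)
  finally show "ln (local_factor k x) - ln (bessel_I0 (2 * (real k * x))) \<le> 4 * real k * x\<^sup>2"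
    using 3 by linarith
  have S: "ln (((1 / (1 - x)) ^ k)\<^sup>2) = - (2 * real k * ln (1 - x))"
    using x by (simp add: ln_realpow ln_div)
  have "ln (local_factor k x) \<le> ln (((1 / (1 - x)) ^ k)\<^sup>2)" using 2(2) pos x by (subst ln_le_cancel_iff) auto
  then show "ln (local_factor k x) + 2 * real k * ln (1 - x) \<le> 0" unfolding S by simp
  have "ln (((1 / (1 - x)) ^ k)\<^sup>2 / (8 * real k)) \<le> ln (local_factor k x)" using 2(3) pos x k by (subst ln_le_cancel_iff) auto
  moreover have "ln (((1 / (1 - x)) ^ k)\<^sup>2 / (8 * real k)) = ln (((1 / (1 - x)) ^ k)\<^sup>2) - ln (8 * real k)"
    using x k by (subst ln_div) auto
  ultimately show "- ln (8 * real k) \<le> ln (local_factor k x) + 2 * real k * ln (1 - x)"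
    unfolding S by simp
qed

subsection \<open>The Euler product\<close>

lemma local_factor_summable:
  assumes "k \<ge> 1" "0 \<le> x" "x \<le> 1/2"
  shows "summable (\<lambda>a. (real ((k + a - 1) choose a) * x ^ a)\<^sup>2)"
  using local_factor_bounds'(1)[OF assms] .

lemma divisor_coeff_eq: "n > 0 \<Longrightarrow> divisor_coeff k n = div_count k n"
  using is_divisor_coeffs_unique[OF is_divisor_coeffs_divisor_coeff is_divisor_coeffs_div_count[of k]]
  by simp

text \<open>\<open>div_count\<close> is built by repeated Dirichlet convolution with 1. A divisor of
  m n is uniquely a product of divisors of m and of n, which are recovered as gcds with m and
  n.\<close>

lemma div_count_mult_coprime:
  assumes "coprime m n" "m > 0" "n > 0"
  shows "div_count k (m * n) = div_count k m * div_count k n"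
  using assms
proof (induction k arbitrary: m n)
  case 0
  then show ?case by auto
next
  case (Suc k)
  have gcd1: "gcd (a * b) m = a" if "a dvd m" "b dvd n" for a b
    using that Suc.prems(1) by (metis coprime_mult_right_iff dvd_mult_div_cancel gcd_mult_left_right_cancel gcd_nat.order_iff)
  have gcd2: "gcd (a * b) n = b" if "a dvd m" "b dvd n" for a b
    using that Suc.prems(1) by (metis coprime_commute coprime_mult_right_iff dvd_mult_div_cancel gcd_mult_left_right_cancel gcd_nat.order_iff mult.commute)
  have inj: "inj_on (\<lambda>(a, b). a * b) ({a. a dvd m} \<times> {b. b dvd n})"
    by (rule inj_onI) (auto, metis gcd1, metis gcd2)
  have img: "{d. d dvd m * n} = (\<lambda>(a, b). a * b) ` ({a. a dvd m} \<times> {b. b dvd n})"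
  proof (intro equalityI subsetI)
    fix d assume "d \<in> {d. d dvd m * n}"
    then obtain a b where "d = a * b" "a dvd m" "b dvd n" using division_decomp[of d m n] by auto
    then show "d \<in> (\<lambda>(a, b). a * b) ` ({a. a dvd m} \<times> {b. b dvd n})" by auto
  qed (auto intro: mult_dvd_mono)
  have "(\<Sum>d | d dvd m * n. div_count k d) = (\<Sum>(a, b) \<in> {a. a dvd m} \<times> {b. b dvd n}. div_count k (a * b))"
    unfolding img by (subst sum.reindex[OF inj]) (simp add: case_prod_unfold)
  also have "\<dots> = (\<Sum>(a, b) \<in> {a. a dvd m} \<times> {b. b dvd n}. div_count k a * div_count k b)"
  proof (rule sum.cong, simp, clarify)
    fix a b assume ab: "a dvd m" "b dvd n"
    then have "coprime a b" using Suc.prems(1) coprime_divisors by blast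
    moreover have "a > 0" "b > 0" using ab Suc.prems by (auto intro!: Nat.gr0I)
    ultimately show "div_count k (a * b) = div_count k a * div_count k b" by (rule Suc.IH)
  qed
  also have "\<dots> = (\<Sum>a | a dvd m. div_count k a) * (\<Sum>b | b dvd n. div_count k b)"
    by (simp add: sum_product sum.cartesian_product)
  finally show ?case using Suc.prems by simp
qed

text \<open>The divisors of p^a are the powers up to a, so each convolution step is the hockey-stick
  identity.\<close>

lemma div_count_prime_power:
  assumes p: "prime p" and k: "k \<ge> 1"
  shows "div_count k (p ^ a) = real ((k + a - 1) choose a)"
  using k
proof (induction k arbitrary: a rule: nat_induct_at_least)
  have p1: "p > 1" using p by (rule prime_gt_1_nat)
  have inj: "inj_on (\<lambda>i. p ^ i) {..a}" for a using p1 by (auto simp: inj_on_def power_inject_exp)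
  have dv: "{m. m dvd p ^ a} = (\<lambda>i. p ^ i) ` {..a}" for a using p by (auto simp: divides_primepow_nat)
  have rec: "div_count (Suc k) (p ^ a) = (\<Sum>i\<le>a. div_count k (p ^ i))" for k a
    using p1 unfolding div_count.simps dv by (subst sum.reindex[OF inj]) auto
  {
    case base
    have "div_count (Suc 0) (p ^ a) = (\<Sum>i\<le>a. of_bool (i = 0))"
      unfolding rec using p1 by (intro sum.cong) auto
    also have "\<dots> = 1" by (simp add: of_bool_def)
    finally show ?case by simp
  next
    case (Suc k)
    have "div_count (Suc k) (p ^ a) = real (\<Sum>i\<le>a. (k - 1 + i) choose i)"
      unfolding rec Suc.IH of_nat_sum using Suc.hyps by (intro sum.cong) (auto simp: add_ac)
    also have "\<dots> = real (Suc (k - 1 + a) choose a)" by (simp only: sum_choose_lower)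
    finally show ?case using Suc.hyps by simp
  }
qed

text \<open>Allowing any set in place of the primes up to y lets the Euler product be built one
  prime at a time.\<close>

definition smooth_over :: "nat set \<Rightarrow> nat set" where
  "smooth_over S = {n. n > 0 \<and> (\<forall>p. prime p \<and> p dvd n \<longrightarrow> p \<in> S)}"

lemma has_sum_times_real:
  fixes f :: "'a \<Rightarrow> real" and g :: "'b \<Rightarrow> real"
  assumes "(f has_sum a) A" "(g has_sum b) B"
  shows "((\<lambda>(x, y). f x * g y) has_sum (a * b)) (A \<times> B)"
proof -
  have "((\<lambda>(x, y). complex_of_real (f x) * complex_of_real (g y)) has_sum (of_real a * of_real b)) (A \<times> B)"
    using assms by (intro has_sum_times_complex) (simp_all only: has_sum_of_real_iff)
  then have "((\<lambda>z. complex_of_real (case z of (x, y) \<Rightarrow> f x * g y)) has_sum of_real (a * b)) (A \<times> B)"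
    by (simp add: case_prod_unfold)
  then show ?thesis by (simp only: has_sum_of_real_iff)
qed

lemma Euler_product_smooth_over:
  assumes k: "k \<ge> 1" and S: "finite S" "\<And>p. p \<in> S \<Longrightarrow> prime p"
  shows "((\<lambda>n. (div_count k n / real n)\<^sup>2) has_sum (\<Prod>p\<in>S. local_factor k (1 / real p))) (smooth_over S)"
  using S
proof (induction S rule: finite_induct)
  case empty
  have "smooth_over {} = {1}"
    using prime_factor_nat by (auto simp: smooth_over_def)
  moreover have "div_count k 1 = 1" using div_count_prime_power[OF two_is_prime_nat k, of 0] by simp
  ultimately show ?case using has_sum_finite[of "{1::nat}" "\<lambda>n. (div_count k n / real n)\<^sup>2"] by simp
next
  case (insert p S)
  have p: "prime p" and p1: "p > 1" using insert.prems prime_gt_1_nat by auto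
  have nd: "\<not> p dvd m" if "m \<in> smooth_over S" for m
    using that insert.hyps p by (auto simp: smooth_over_def)
  let ?g = "\<lambda>a. (real ((k + a - 1) choose a) * (1 / real p) ^ a)\<^sup>2"
  have "summable ?g" using p1 k by (intro local_factor_summable) (auto simp: field_simps)
  then have g: "(?g has_sum local_factor k (1 / real p)) UNIV"
    unfolding local_factor_def by (intro norm_summable_imp_has_sum summable_sums) auto
  have "((\<lambda>n. (div_count k n / real n)\<^sup>2) has_sum (\<Prod>p\<in>S. local_factor k (1 / real p))) (smooth_over S)"
    using insert by blast
  from has_sum_times_real[OF this g]
  have "((\<lambda>(m, a). (div_count k m / real m)\<^sup>2 * ?g a) has_sum
      ((\<Prod>p\<in>S. local_factor k (1 / real p)) * local_factor k (1 / real p))) (smooth_over S \<times> UNIV)" .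
  also have "?this \<longleftrightarrow> ((\<lambda>n. (div_count k n / real n)\<^sup>2) has_sum
      ((\<Prod>p\<in>S. local_factor k (1 / real p)) * local_factor k (1 / real p))) (smooth_over (insert p S))"
  \<comment> \<open>Each number over \<open>insert p S\<close> is m p^a for exactly one m over S and
    one a; \<open>multiplicity\<close> supplies the inverse map.\<close>
  proof (rule has_sum_reindex_bij_witness[where i = "\<lambda>n. (n div p ^ multiplicity p n, multiplicity p n)" and j = "\<lambda>(m, a). m * p ^ a"])
    fix z assume z: "z \<in> smooth_over S \<times> (UNIV :: nat set)"
    obtain m a where ma: "z = (m, a)" "m \<in> smooth_over S" using z by (cases z) auto
    have m0: "m > 0" using ma by (simp add: smooth_over_def)
    have mult: "multiplicity p (m * p ^ a) = a"
      using nd[OF ma(2)] p1 by (intro multiplicity_decomposeI[where x' = m]) (auto simp: mult.commute)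
    show "(case case z of (m, a) \<Rightarrow> m * p ^ a of n \<Rightarrow> (n div p ^ multiplicity p n, multiplicity p n)) = z"
      using mult p1 ma by simp
    have "q = p" if "prime q" "q dvd p ^ a" for q
      using that p by (metis prime_dvd_power primes_dvd_imp_eq)
    then show "(case z of (m, a) \<Rightarrow> m * p ^ a) \<in> smooth_over (insert p S)"
      using ma m0 p1 by (auto simp: smooth_over_def prime_dvd_mult_iff)
    have "coprime m (p ^ a)" using nd[OF ma(2)] p
      by (metis coprime_commute coprime_power_left_iff prime_imp_coprime)
    then have "div_count k (m * p ^ a) = div_count k m * real ((k + a - 1) choose a)"
      using m0 p1 k by (simp add: div_count_mult_coprime div_count_prime_power[OF p])
    then show "(div_count k (case z of (m, a) \<Rightarrow> m * p ^ a) / real (case z of (m, a) \<Rightarrow> m * p ^ a))\<^sup>2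
        = (case z of (m, a) \<Rightarrow> (div_count k m / real m)\<^sup>2 * ?g a)"
      using ma by (simp add: power_mult_distrib power_divide)
  next
    fix n assume n: "n \<in> smooth_over (insert p S)"
    then have n0: "n > 0" by (simp add: smooth_over_def)
    have dec: "p ^ multiplicity p n dvd n" by (rule multiplicity_dvd)
    then show "(case (n div p ^ multiplicity p n, multiplicity p n) of (m, a) \<Rightarrow> m * p ^ a) = n" by simp
    have "\<not> p dvd n div p ^ multiplicity p n"
      using n0 p1 p by (intro multiplicity_decompose) auto
    moreover have "n div p ^ multiplicity p n > 0" using dec n0 p1 by (simp add: dvd_imp_le div_greater_zero_iff)
    moreover have "n div p ^ multiplicity p n dvd n" using dec by (metis dvd_div_mult_self dvd_triv_left)
    ultimately show "(n div p ^ multiplicity p n, multiplicity p n) \<in> smooth_over S \<times> UNIV"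
      using n unfolding smooth_over_def by (auto dest: dvd_trans)
  qed (rule refl)
  finally show ?case using insert by (simp add: mult.commute)
qed

lemma D_friable_eq_prod:
  assumes k: "k \<ge> 1" and y: "y \<ge> 0"
  shows "D_friable k y = (\<Prod>p | prime p \<and> p \<le> nat \<lfloor>y\<rfloor>. local_factor k (1 / real p))"
proof -
  let ?S = "{p. prime p \<and> p \<le> nat \<lfloor>y\<rfloor>}"
  have fin: "finite ?S" by (rule finite_subset[of _ "{..nat \<lfloor>y\<rfloor>}"]) auto
  have "smooth_over ?S = friable y"
    using y by (auto simp: smooth_over_def friable_def le_nat_iff le_floor_iff)
  moreover have "((\<lambda>n. (div_count k n / real n)\<^sup>2) has_sum (\<Prod>p\<in>?S. local_factor k (1 / real p))) (smooth_over ?S)"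
    by (rule Euler_product_smooth_over[OF k fin]) auto
  ultimately have "((\<lambda>n. (div_count k n / real n)\<^sup>2) has_sum (\<Prod>p\<in>?S. local_factor k (1 / real p))) (friable y)"
    by simp
  also have "?this \<longleftrightarrow> ((\<lambda>n. (divisor_coeff k n)\<^sup>2 / (real n)\<^sup>2) has_sum (\<Prod>p\<in>?S. local_factor k (1 / real p))) (friable y)"
    by (intro has_sum_cong) (auto simp: friable_def divisor_coeff_eq power_divide)
  finally show ?thesis unfolding D_friable_def by (rule infsumI)
qed

subsection \<open>From sums over primes to integrals\<close>

lemma continuous_on_Lipschitz_real:
  fixes g :: "real \<Rightarrow> real"
  assumes "\<And>s t. 0 \<le> s \<Longrightarrow> s \<le> t \<Longrightarrow> \<bar>g t - g s\<bar> \<le> t - s" "S \<subseteq> {0..}"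
  shows "continuous_on S g"
proof -
  have "1-lipschitz_on {0..} g"
  proof (rule lipschitz_onI)
    fix x y :: real assume "x \<in> {0..}" "y \<in> {0..}"
    then show "dist (g x) (g y) \<le> 1 * dist x y"
      using assms(1)[of x y] assms(1)[of y x] by (cases "x \<le> y") (auto simp: dist_real_def)
  qed auto
  then show ?thesis using assms(2) by (meson continuous_on_subset lipschitz_on_continuous_on)
qed

lemma ln_Suc_diff:
  fixes x :: real assumes "x > 0"
  shows "1 / (x + 1) \<le> ln (x + 1) - ln x" "ln (x + 1) - ln x \<le> 1 / x"
proof -
  have "ln (x / (x + 1)) \<le> x / (x + 1) - 1" using assms by (intro ln_le_minus_one) auto
  then show "1 / (x + 1) \<le> ln (x + 1) - ln x" using assms by (simp add: ln_div field_simps)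
  have "ln ((x + 1) / x) \<le> (x + 1) / x - 1" using assms by (intro ln_le_minus_one) auto
  then show "ln (x + 1) - ln x \<le> 1 / x" using assms by (simp add: ln_div field_simps)
qed

text \<open>Both weights that occur, log I_0(t) for p > k and log I_0(t) - t for p <= k, satisfy
  these bounds with constant 1, so a single argument treats both.\<close>

locale Lipschitz_weight =
  fixes g :: "real \<Rightarrow> real" and k :: nat
  assumes g_lip: "\<And>s t. 0 \<le> s \<Longrightarrow> s \<le> t \<Longrightarrow> \<bar>g t - g s\<bar> \<le> t - s"
    and g_le: "\<And>t. 0 \<le> t \<Longrightarrow> \<bar>g t\<bar> \<le> t" and k: "k \<ge> 2"
begin

text \<open>The density after the substitution u = 2k/t: du / log u becomes 2k dt / (t^2 log
  (2k/t)).\<close>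

definition kern :: "real \<Rightarrow> real" where "kern t = g t / (t\<^sup>2 * ln (2 * real k / t))"

lemma continuous_kern:
  assumes "0 < a" "b < 2 * real k"
  shows "continuous_on {a..b} kern"
proof -
  have "continuous_on {a..b} g" using assms by (intro continuous_on_Lipschitz_real g_lip) auto
  moreover have "2 * real k / t > 1" if "t \<in> {a..b}" for t using that assms by (simp add: field_simps)
  ultimately show ?thesis unfolding kern_def using assms k
    by (intro continuous_intros) fastforce+
qed

lemma integrable_kern: "0 < a \<Longrightarrow> b < 2 * real k \<Longrightarrow> kern integrable_on {a..b}"
  by (intro integrable_continuous_interval continuous_kern)

text \<open>The unit interval [n, n + 1] corresponds to [2k/(n + 1), 2k/n], on which 1/t^2 has
  integral 1/(2k). There \<open>g\<close> varies by at most 2k/n^2 and the logarithm by at most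
  1/n.\<close>

lemma kern_step:
  fixes n :: nat
  assumes n: "n \<ge> 2"
  shows "\<bar>g (2 * real k / real n) / ln (real n) - 2 * real k * integral {2 * real k / real (n + 1)..2 * real k / real n} kern\<bar>
     \<le> 8 * real k / real n ^ 2"
proof -
  define \<alpha> \<beta> where "\<alpha> = 2 * real k / real (n + 1)" and "\<beta> = 2 * real k / real n"
  have ab: "0 < \<alpha>" "\<alpha> \<le> \<beta>" "\<beta> < 2 * real k" using n k by (auto simp: \<alpha>_def \<beta>_def field_simps)
  have ab1: "\<beta> - \<alpha> \<le> 2 * real k / real n ^ 2" 
  proof -
    have "\<beta> - \<alpha> = 2 * real k / (real n * (real n + 1))"
      using n by (simp add: \<alpha>_def \<beta>_def field_simps)
    also have "\<dots> \<le> 2 * real k / (real n * real n)"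
      using n by (intro divide_left_mono mult_left_mono) auto
    finally show ?thesis by (simp add: power2_eq_square)
  qed
  have lnn: "ln (real n) \<ge> 2 / 3"
  proof -
    have "ln 2 \<le> ln (real n)" using n by simp
    then show ?thesis using ln2_ge_two_thirds by linarith
  qed
  define \<delta> where "\<delta> = 8 * real k / real n ^ 2"
  have inv: "((\<lambda>t. 1 / t\<^sup>2) has_integral (1 / (2 * real k))) {\<alpha>..\<beta>}"
  proof -
    have "((\<lambda>t. 1 / t\<^sup>2) has_integral ((- 1 / \<beta>) - (- 1 / \<alpha>))) {\<alpha>..\<beta>}"
    proof (rule fundamental_theorem_of_calculus)
      fix x assume "x \<in> {\<alpha>..\<beta>}"
      then show "((\<lambda>t. - 1 / t) has_vector_derivative 1 / x\<^sup>2) (at x within {\<alpha>..\<beta>})"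
        using ab by (auto intro!: derivative_eq_intros simp: has_real_derivative_iff_has_vector_derivative[symmetric] power2_eq_square)
    qed (rule ab)
    moreover have "(- 1 / \<beta>) - (- 1 / \<alpha>) = 1 / (2 * real k)"
      using n k by (simp add: \<alpha>_def \<beta>_def field_simps)
    ultimately show ?thesis by simp
  qed
  have ptw: "\<bar>g \<beta> / ln (real n) * (1 / t\<^sup>2) - kern t\<bar> \<le> \<delta> * (1 / t\<^sup>2)" if t: "t \<in> {\<alpha>..\<beta>}" for t
  proof -
    have t0: "t > 0" using t ab by auto
    define l where "l = ln (2 * real k / t)"
    have l1: "ln (real n) \<le> l" using t t0 n k unfolding l_def by (subst ln_le_cancel_iff) (auto simp: \<beta>_def field_simps)
    have "l \<le> ln (real n + 1)" using t t0 n k unfolding l_def by (subst ln_le_cancel_iff) (auto simp: \<alpha>_def field_simps)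
    then have l2: "l - ln (real n) \<le> 1 / real n" using ln_Suc_diff(2)[of "real n"] n by auto
    have l0: "l \<ge> 2 / 3" using l1 lnn by simp
    have e: "g \<beta> / ln (real n) - g t / l = (g \<beta> - g t) / ln (real n) + g t * (l - ln (real n)) / (ln (real n) * l)"
      using lnn l0 by (simp add: field_simps)
    have b1: "\<bar>(g \<beta> - g t) / ln (real n)\<bar> \<le> (2 * real k / real n ^ 2) * (3 / 2)"
    proof -
      have "\<bar>g \<beta> - g t\<bar> \<le> 2 * real k / real n ^ 2" using g_lip[of t \<beta>] t t0 ab1 by auto
      then have "\<bar>g \<beta> - g t\<bar> / ln (real n) \<le> (2 * real k / real n ^ 2) / (2 / 3)"
        using lnn by (intro frac_le) auto
      then show ?thesis using lnn by (simp add: abs_divide)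
    qed
    have b2: "\<bar>g t * (l - ln (real n)) / (ln (real n) * l)\<bar> \<le> (2 * real k / real n * (1 / real n)) * (9 / 4)"
    proof -
      have "\<bar>g t\<bar> \<le> 2 * real k / real n" using g_le[of t] t t0 by (auto simp: \<beta>_def)
      then have "\<bar>g t\<bar> * (l - ln (real n)) \<le> (2 * real k / real n) * (1 / real n)"
        using l1 l2 by (intro mult_mono) auto
      moreover have "2 / 3 * (2 / 3) \<le> ln (real n) * l" using lnn l0 by (intro mult_mono) auto
      ultimately have "\<bar>g t\<bar> * (l - ln (real n)) / (ln (real n) * l) \<le> (2 * real k / real n) * (1 / real n) / (2 / 3 * (2 / 3))"
        using l1 by (intro frac_le) auto
      then show ?thesis using lnn l0 l1 by (simp add: abs_mult abs_divide)
    qed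
    have "\<bar>g \<beta> / ln (real n) - g t / l\<bar> \<le> \<delta>"
    proof -
      have "\<bar>g \<beta> / ln (real n) - g t / l\<bar> \<le> \<bar>(g \<beta> - g t) / ln (real n)\<bar> + \<bar>g t * (l - ln (real n)) / (ln (real n) * l)\<bar>"
        unfolding e by (rule abs_triangle_ineq)
      \<comment> \<open>Logarithms at least 2/3 in the denominators give the factors 3/2 and 9/4; 2
        * 3/2 + 2 * 9/4 = 15/2 is rounded up to 8.\<close>
      also have "\<dots> \<le> (2 * real k / real n ^ 2) * (3 / 2) + (2 * real k / real n * (1 / real n)) * (9 / 4)"
        using b1 b2 by (rule add_mono)
      also have "\<dots> = 15 / 2 * (real k / real n ^ 2)" by (simp add: power2_eq_square)
      also have "\<dots> \<le> 8 * (real k / real n ^ 2)" by (intro mult_right_mono) auto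
      also have "\<dots> = \<delta>" by (simp add: \<delta>_def)
      finally show ?thesis .
    qed
    then have "\<bar>g \<beta> / ln (real n) - g t / l\<bar> * (1 / t\<^sup>2) \<le> \<delta> * (1 / t\<^sup>2)" by (intro mult_right_mono) auto
    moreover have "g \<beta> / ln (real n) * (1 / t\<^sup>2) - kern t = (g \<beta> / ln (real n) - g t / l) * (1 / t\<^sup>2)"
      using t0 by (simp add: kern_def l_def diff_divide_distrib mult.commute)
    ultimately show ?thesis by (simp add: abs_mult)
  qed
  have i1: "((\<lambda>t. g \<beta> / ln (real n) * (1 / t\<^sup>2) - kern t) has_integral (g \<beta> / ln (real n) * (1 / (2 * real k)) - integral {\<alpha>..\<beta>} kern)) {\<alpha>..\<beta>}"
    by (intro has_integral_diff has_integral_mult_right inv integrable_integral integrable_kern ab)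
  have i2: "((\<lambda>t. \<delta> * (1 / t\<^sup>2)) has_integral (\<delta> * (1 / (2 * real k)))) {\<alpha>..\<beta>}"
    by (intro has_integral_mult_right inv)
  have "norm (integral {\<alpha>..\<beta>} (\<lambda>t. g \<beta> / ln (real n) * (1 / t\<^sup>2) - kern t)) \<le> integral {\<alpha>..\<beta>} (\<lambda>t. \<delta> * (1 / t\<^sup>2))"
    using i1 i2 ptw by (intro Henstock_Kurzweil_Integration.integral_norm_bound_integral) (auto simp: has_integral_iff)
  then have "\<bar>g \<beta> / ln (real n) * (1 / (2 * real k)) - integral {\<alpha>..\<beta>} kern\<bar> \<le> \<delta> * (1 / (2 * real k))"
    using integral_unique[OF i1] integral_unique[OF i2] by simp
  then have "2 * real k * \<bar>g \<beta> / ln (real n) * (1 / (2 * real k)) - integral {\<alpha>..\<beta>} kern\<bar> \<le> 2 * real k * (\<delta> * (1 / (2 * real k)))"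
    by (intro mult_left_mono) auto
  moreover have "2 * real k * \<bar>g \<beta> / ln (real n) * (1 / (2 * real k)) - integral {\<alpha>..\<beta>} kern\<bar> = \<bar>g \<beta> / ln (real n) - 2 * real k * integral {\<alpha>..\<beta>} kern\<bar>"
  proof -
    have "2 * real k * \<bar>X\<bar> = \<bar>2 * real k * X\<bar>" for X using k by (simp add: abs_mult)
    moreover have "2 * real k * (g \<beta> / ln (real n) * (1 / (2 * real k)) - integral {\<alpha>..\<beta>} kern) = g \<beta> / ln (real n) - 2 * real k * integral {\<alpha>..\<beta>} kern"
      using k by (simp add: right_diff_distrib)
    ultimately show ?thesis by simp
  qed
  ultimately show ?thesis using k unfolding \<delta>_def \<alpha>_def \<beta>_def by simp
qed

text \<open>The errors 8k/n^2 telescope. The endpoints carry M + 1 and N + 1 because the blocks run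
  from the first summand M + 1 to the right end N + 1 of the last one.\<close>

lemma sum_kern:
  assumes M: "M \<ge> 1" "M \<le> N"
  shows "\<bar>(\<Sum>n\<in>{M<..N}. g (2 * real k / real n) / ln (real n)) - 2 * real k * integral {2 * real k / real (N + 1)..2 * real k / real (M + 1)} kern\<bar>
     \<le> 8 * real k * (1 / real M - 1 / real N)"
  using M(2)
proof (induction N rule: dec_induct)
  case base
  then show ?case by simp
next
  case (step N)
  have N: "N \<ge> 1" using M step by auto
  define \<alpha> \<beta> \<gamma> where "\<alpha> = 2 * real k / real (Suc N + 1)" and "\<beta> = 2 * real k / real (Suc N)" and "\<gamma> = 2 * real k / real (M + 1)"
  have ord: "0 < \<alpha>" "\<alpha> \<le> \<beta>" "\<beta> \<le> \<gamma>" "\<gamma> < 2 * real k"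
    using k M step by (auto simp: \<alpha>_def \<beta>_def \<gamma>_def field_simps)
  have comb: "integral {\<alpha>..\<beta>} kern + integral {\<beta>..\<gamma>} kern = integral {\<alpha>..\<gamma>} kern"
    by (rule Henstock_Kurzweil_Integration.integral_combine) (use ord integrable_kern in auto)
  have set: "{M<..Suc N} = insert (Suc N) {M<..N}" using step by auto
  have 1: "\<bar>g \<beta> / ln (real (Suc N)) - 2 * real k * integral {\<alpha>..\<beta>} kern\<bar> \<le> 8 * real k / real (Suc N) ^ 2"
    using kern_step[of "Suc N"] N by (simp add: \<alpha>_def \<beta>_def)
  have "1 / real (Suc N) ^ 2 \<le> 1 / real N - 1 / real (Suc N)"
  proof -
    have "1 / real (Suc N) ^ 2 \<le> 1 / (real N * real (Suc N))"
      unfolding power2_eq_square using N by (intro divide_left_mono mult_right_mono) auto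
    also have "\<dots> = 1 / real N - 1 / real (Suc N)" using N by (simp add: field_simps)
    finally show ?thesis .
  qed
  then have 2: "8 * real k / real (Suc N) ^ 2 \<le> 8 * real k * (1 / real N - 1 / real (Suc N))"
    using mult_left_mono[of "1 / real (Suc N) ^ 2" "1 / real N - 1 / real (Suc N)" "8 * real k"] by simp
  have 3: "\<bar>(\<Sum>n\<in>{M<..N}. g (2 * real k / real n) / ln (real n)) - 2 * real k * integral {\<beta>..\<gamma>} kern\<bar>
     \<le> 8 * real k * (1 / real M - 1 / real N)"
    using step.IH by (simp add: \<beta>_def \<gamma>_def add.commute)
  have 4: "(\<Sum>n\<in>{M<..Suc N}. g (2 * real k / real n) / ln (real n)) = g \<beta> / ln (real (Suc N)) + (\<Sum>n\<in>{M<..N}. g (2 * real k / real n) / ln (real n))"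
    unfolding set by (simp add: \<beta>_def)
  have "\<bar>(\<Sum>n\<in>{M<..Suc N}. g (2 * real k / real n) / ln (real n)) - 2 * real k * integral {\<alpha>..\<gamma>} kern\<bar>
     \<le> 8 * real k * (1 / real M - 1 / real (Suc N))"
    unfolding 4 comb[symmetric] using 1 2 3 by (simp only: distrib_left right_diff_distrib)
  then show ?case by (simp add: \<alpha>_def \<gamma>_def)
qed

text \<open>In the summation by parts a partial sum of size c n meets an increment of
  \<open>g\<close> of about 2k/n^2, so each step costs about 2kc/n and the total one logarithm. The
  steps are compared with increments of log.\<close>

lemma Abel_step:
  fixes e d :: "nat \<Rightarrow> real"
  assumes M: "M \<ge> 1" "M \<le> N" and e: "\<And>n. n \<ge> M \<Longrightarrow> e (Suc n) = e n + d (Suc n)" "\<And>n. n \<ge> M \<Longrightarrow> \<bar>e n\<bar> \<le> c * real n"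
    and c: "c \<ge> 0"
  shows "\<bar>\<Sum>n\<in>{M<..N}. g (2 * real k / real n) * d n\<bar> \<le> 2 * real k * c * (2 + ln (real (N + 1)))"
proof -
  define G where "G = (\<lambda>n. g (2 * real k / real n))"
  have "\<bar>(\<Sum>n\<in>{M<..N}. G n * d n) - e N * G (N + 1) + e M * G (M + 1)\<bar> \<le> 2 * real k * c * (ln (real (N + 1)) - ln (real (M + 1)))"
    using M(2)
  proof (induction N rule: dec_induct)
    case base
    then show ?case by simp
  next
    case (step N)
    have set: "{M<..Suc N} = insert (Suc N) {M<..N}" using step by auto
    have 1: "(\<Sum>n\<in>{M<..Suc N}. G n * d n) - e (Suc N) * G (Suc N + 1) + e M * G (M + 1)
      = ((\<Sum>n\<in>{M<..N}. G n * d n) - e N * G (N + 1) + e M * G (M + 1)) + e (Suc N) * (G (N + 1) - G (N + 2))"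
      unfolding set using e(1)[of N] step by (simp add: algebra_simps)
    have gl: "\<bar>G (N + 1) - G (N + 2)\<bar> \<le> 2 * real k / real (N + 1) - 2 * real k / real (N + 2)"
      unfolding G_def by (rule g_lip) (auto intro!: divide_left_mono)
    have "\<bar>e (Suc N) * (G (N + 1) - G (N + 2))\<bar> \<le> (c * real (N + 1)) * (2 * real k / real (N + 1) - 2 * real k / real (N + 2))"
      unfolding abs_mult using e(2)[of "Suc N"] gl step c by (intro mult_mono) auto
    also have "\<dots> = 2 * real k * c * (1 / (real (N + 1) + 1))"
    proof -
      have "(c * a) * (K / a - K / (a + 1)) = K * c * (1 / (a + 1))" if "a > 0" for a K :: real
        using that by (simp add: divide_simps) (simp add: algebra_simps)
      from this[of "real (N + 1)" "2 * real k"] show ?thesis by (simp add: add_ac)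
    qed
    also have "\<dots> \<le> 2 * real k * c * (ln (real (N + 1) + 1) - ln (real (N + 1)))"
      using c ln_Suc_diff(1)[of "real (N + 1)"] by (intro mult_left_mono) auto
    finally have 2: "\<bar>e (Suc N) * (G (N + 1) - G (N + 2))\<bar> \<le> 2 * real k * c * (ln (real (Suc N + 1)) - ln (real (N + 1)))"
      by (simp add: add_ac)
    show ?case unfolding 1 using 2 step.IH by (simp only: right_diff_distrib)
  qed
  moreover have eG: "\<bar>e n * G (n + 1)\<bar> \<le> 2 * real k * c" if "n \<ge> M" for n
  proof -
    have "\<bar>e n * G (n + 1)\<bar> \<le> (c * real n) * (2 * real k / real (n + 1))"
      unfolding abs_mult using e(2)[OF that] g_le[of "2 * real k / real (n + 1)"] c
      by (intro mult_mono) (auto simp: G_def)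
    also have "\<dots> = 2 * real k * c * (real n / real (n + 1))" by simp
    also have "\<dots> \<le> 2 * real k * c * 1" using c by (intro mult_left_mono) auto
    finally show ?thesis by simp
  qed
  moreover have "0 \<le> 2 * real k * c * ln (real (M + 1))" using c by simp
  ultimately have "\<bar>\<Sum>n\<in>{M<..N}. G n * d n\<bar> \<le> 2 * real k * c * 2 + 2 * real k * c * ln (real (N + 1))"
    using eG[OF M(2)] eG[OF order_refl] unfolding right_diff_distrib by linarith
  then show ?thesis by (simp add: G_def distrib_left)
qed

lemma prime_sum_integral:
  assumes M: "M \<ge> 1" "M \<le> N" and c: "c \<ge> 0"
    and e: "\<And>n. n \<ge> M \<Longrightarrow> \<bar>\<Sum>i=2..n. of_bool (prime i) - 1 / ln (real i)\<bar> \<le> c * real n"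
  shows "\<bar>(\<Sum>p | prime p \<and> p \<in> {M<..N}. g (2 * real k / real p))
      - 2 * real k * integral {2 * real k / real (N + 1)..2 * real k / real (M + 1)} kern\<bar>
     \<le> 2 * real k * c * (2 + ln (real (N + 1))) + 8 * real k / real M"
proof -
  let ?d = "\<lambda>n. of_bool (prime n) - 1 / ln (real n) :: real"
  have "\<bar>\<Sum>n\<in>{M<..N}. g (2 * real k / real n) * ?d n\<bar> \<le> 2 * real k * c * (2 + ln (real (N + 1)))"
    using M by (intro Abel_step[where e = "\<lambda>n. \<Sum>i=2..n. ?d i"] M e c) (auto simp: )
  moreover have "(\<Sum>n\<in>{M<..N}. g (2 * real k / real n) * ?d n) =
      (\<Sum>p | prime p \<and> p \<in> {M<..N}. g (2 * real k / real p)) - (\<Sum>n\<in>{M<..N}. g (2 * real k / real n) / ln (real n))"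
  proof -
    have "(\<Sum>p | prime p \<and> p \<in> {M<..N}. g (2 * real k / real p)) = (\<Sum>n\<in>{M<..N}. g (2 * real k / real n) * of_bool (prime n))"
      by (rule sum.mono_neutral_cong_left) auto
    then show ?thesis by (simp add: right_diff_distrib sum_subtractf)
  qed
  moreover have "8 * real k * (1 / real M - 1 / real N) \<le> 8 * real k / real M"
    by (simp add: right_diff_distrib)
  ultimately show ?thesis using sum_kern[OF M] by linarith
qed

end

subsection \<open>The integrals defining the constants\<close>

text \<open>A majorant for powers of logarithms near 0 whose integral is still of order
  \<tau>.\<close>

lemma set_integral_rpow_low:
  fixes \<tau> :: real
  assumes "\<tau> > 0"
  shows "set_integrable lborel {0<..<\<tau>} (\<lambda>t. sqrt (\<tau> / t))" "(LBINT t:{0<..<\<tau>}. sqrt (\<tau> / t)) = 2 * \<tau>"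
proof -
  have 1: "((\<lambda>t. 2 * sqrt \<tau> * sqrt t) \<longlongrightarrow> 0) (at_right 0)"
    by (auto intro!: tendsto_eq_intros)
  have 2: "((\<lambda>t. 2 * sqrt \<tau> * sqrt t) \<longlongrightarrow> 2 * \<tau>) (at_left \<tau>)"
    using assms by (auto intro!: tendsto_eq_intros)
  have d: "((\<lambda>t. 2 * sqrt \<tau> * sqrt t) has_real_derivative sqrt (\<tau> / x)) (at x)" if "x > 0" for x
    using that assms by (auto intro!: derivative_eq_intros simp: real_sqrt_divide field_simps)
  note * = interval_integral_FTC_nonneg[of "ereal 0" "ereal \<tau>" "\<lambda>t. 2 * sqrt \<tau> * sqrt t" "\<lambda>t. sqrt (\<tau> / t)" 0 "2 * \<tau>"]
  have "set_integrable lborel (einterval (ereal 0) (ereal \<tau>)) (\<lambda>t. sqrt (\<tau> / t))"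
    by (rule *) (use 1 2 d assms in \<open>auto intro!: continuous_intros simp: ereal_tendsto_simps\<close>)
  then show "set_integrable lborel {0<..<\<tau>} (\<lambda>t. sqrt (\<tau> / t))" by simp
  have "(LBINT t=ereal 0..ereal \<tau>. sqrt (\<tau> / t)) = 2 * \<tau> - 0"
    by (rule *) (use 1 2 d assms in \<open>auto intro!: continuous_intros simp: ereal_tendsto_simps\<close>)
  then show "(LBINT t:{0<..<\<tau>}. sqrt (\<tau> / t)) = 2 * \<tau>"
    using assms by (simp add: interval_lebesgue_integral_def)
qed

lemma set_integral_rpow_high:
  fixes T :: real
  assumes "T > 0"
  shows "set_integrable lborel {T<..} (\<lambda>t. (1 / t) * sqrt (1 / t))" "(LBINT t:{T<..}. (1 / t) * sqrt (1 / t)) = 2 / sqrt T"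
proof -
  have 1: "((\<lambda>t. - 2 / sqrt t) \<longlongrightarrow> - 2 / sqrt T) (at_right T)"
    using assms by (auto intro!: tendsto_eq_intros)
  have 2: "((\<lambda>t. - 2 / sqrt t) \<longlongrightarrow> 0) at_top"
    by (intro tendsto_divide_0[OF tendsto_const] filterlim_at_top_imp_at_infinity sqrt_at_top)
  have d: "((\<lambda>t. - 2 / sqrt t) has_real_derivative (1 / x) * sqrt (1 / x)) (at x)" if "x > 0" for x
    using that assms by (auto intro!: derivative_eq_intros simp: real_sqrt_divide field_simps)
  note * = interval_integral_FTC_nonneg[of "ereal T" \<infinity> "\<lambda>t. - 2 / sqrt t" "\<lambda>t. (1 / t) * sqrt (1 / t)" "- 2 / sqrt T" 0]
  have "set_integrable lborel (einterval (ereal T) \<infinity>) (\<lambda>t. (1 / t) * sqrt (1 / t))"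
    by (rule *) (use 1 2 d assms in \<open>auto intro!: continuous_intros simp: ereal_tendsto_simps\<close>)
  then show "set_integrable lborel {T<..} (\<lambda>t. (1 / t) * sqrt (1 / t))" by simp
  have "(LBINT t=ereal T..\<infinity>. (1 / t) * sqrt (1 / t)) = 0 - (- 2 / sqrt T)"
    by (rule *) (use 1 2 d assms in \<open>auto intro!: continuous_intros simp: ereal_tendsto_simps\<close>)
  then show "(LBINT t:{T<..}. (1 / t) * sqrt (1 / t)) = 2 / sqrt T"
    using assms by (simp add: interval_lebesgue_integral_def)
qed

text \<open>Merges the two integrands of the C_j; the point t = 2 belongs to the branch without
  subtraction, as in \<open>C_coeff\<close>.\<close>

definition bessel_weight :: "real \<Rightarrow> real" where
  "bessel_weight t = ln (bessel_I0 t) - (if t \<le> 2 then 0 else t)"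

definition C_integrand :: "nat \<Rightarrow> real \<Rightarrow> real" where
  "C_integrand j t = ln (t / 2) ^ j * bessel_weight t / t\<^sup>2"

lemma continuous_on_ln_bessel_I0: "S \<subseteq> {0..} \<Longrightarrow> continuous_on S (\<lambda>t. ln (bessel_I0 t))"
proof (rule continuous_on_Lipschitz_real)
  fix s t :: real assume "0 \<le> s" "s \<le> t"
  then show "\<bar>ln (bessel_I0 t) - ln (bessel_I0 s)\<bar> \<le> t - s"
    using ln_bessel_I0_Lipschitz[of s t] by auto
qed

lemma bessel_weight_bounds:
  shows "0 < t \<Longrightarrow> t \<le> 2 \<Longrightarrow> \<bar>bessel_weight t\<bar> \<le> t\<^sup>2 / 4"
    "2 < t \<Longrightarrow> \<bar>bessel_weight t\<bar> \<le> 3 * (1 + ln (t / 2))"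
proof -
  assume "0 < t" "t \<le> 2"
  then show "\<bar>bessel_weight t\<bar> \<le> t\<^sup>2 / 4"
    using ln_bessel_I0_bounds[of t] ln_bessel_I0_le_square[of t] by (simp add: bessel_weight_def)
next
  assume t: "2 < t"
  have "\<bar>bessel_weight t\<bar> \<le> ln (4 * (t + 2))" using ln_bessel_I0_bounds[of t] t by (simp add: bessel_weight_def)
  also have "\<dots> \<le> ln (16 * (t / 2))" using t by (subst ln_le_cancel_iff) auto
  also have "\<dots> = ln 16 + ln (t / 2)" using t by (subst ln_mult) auto
  also have "\<dots> \<le> 3 * (1 + ln (t / 2))"
  proof -
    have "0 \<le> ln (t / 2)" using t by simp
    moreover have "ln (16 :: real) = 4 * ln 2" using ln_realpow[of "2::real" 4] by simp
    then have "ln (16 :: real) \<le> 3" using ln2_le_25_over_36 by simp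
    ultimately show ?thesis by simp
  qed
  finally show "\<bar>bessel_weight t\<bar> \<le> 3 * (1 + ln (t / 2))" .
qed

lemma C_integrand_measurable: "set_borel_measurable lborel {0<..} (C_integrand j)"
proof -
  have c1: "continuous_on {0<..2} (\<lambda>t. ln (t / 2) ^ j * ln (bessel_I0 t) / t\<^sup>2)"
    by (intro continuous_intros continuous_on_ln_bessel_I0) auto
  have c2: "continuous_on {2<..} (\<lambda>t. ln (t / 2) ^ j * (ln (bessel_I0 t) - t) / t\<^sup>2)"
    by (intro continuous_intros continuous_on_ln_bessel_I0) auto
  have 1: "(\<lambda>t. indicator {0<..2} t *\<^sub>R (ln (t / 2) ^ j * ln (bessel_I0 t) / t\<^sup>2)) \<in> borel_measurable borel"
    by (rule borel_measurable_continuous_on_indicator[OF _ c1]) auto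
  have 2: "(\<lambda>t. indicator {2<..} t *\<^sub>R (ln (t / 2) ^ j * (ln (bessel_I0 t) - t) / t\<^sup>2)) \<in> borel_measurable borel"
    by (rule borel_measurable_continuous_on_indicator[OF _ c2]) auto
  have "(\<lambda>t. indicator {0<..} t *\<^sub>R C_integrand j t) = (\<lambda>t. indicator {0<..2} t *\<^sub>R (ln (t / 2) ^ j * ln (bessel_I0 t) / t\<^sup>2) + indicator {2<..} t *\<^sub>R (ln (t / 2) ^ j * (ln (bessel_I0 t) - t) / t\<^sup>2))"
    by (rule ext) (auto simp: indicator_def C_integrand_def bessel_weight_def)
  then show ?thesis unfolding set_borel_measurable_def using 1 2 by simp
qed

text \<open>Split |log (t/2)| as log (2/\<tau>) + log (\<tau>/t), which is at most the product of
  both terms increased by 1, and absorb the second factor into sqrt (\<tau>/t). Keeping \<tau> apart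
  yields a tail of order \<tau> times logarithms, as the error k/y demands, instead of a smaller
  power of \<tau>.\<close>

lemma C_integrand_low_bound:
  obtains C :: real where "C > 0"
    "\<And>t \<tau>. 0 < t \<Longrightarrow> t \<le> \<tau> \<Longrightarrow> \<tau> \<le> 2 \<Longrightarrow> \<bar>C_integrand j t\<bar> \<le> C * (1 + ln (2 / \<tau>)) ^ j * sqrt (\<tau> / t)"
proof -
  obtain C :: real where C: "C > 0" "\<And>r::real. r \<ge> 1 \<Longrightarrow> (1 + ln r) ^ j \<le> C * r powr (1/2)"
    by (rule one_plus_ln_power_le_powr[of "1/2" j]) (simp, blast)
  show ?thesis
  proof
    show "C > 0" by (rule C)
    fix t \<tau> :: real assume t: "0 < t" "t \<le> \<tau>" "\<tau> \<le> 2"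
    have "\<bar>ln (t / 2)\<bar> = ln (2 / \<tau>) + ln (\<tau> / t)"
      using t by (simp add: ln_div)
    also have "\<dots> \<le> (1 + ln (2 / \<tau>)) * (1 + ln (\<tau> / t))"
      using mult_nonneg_nonneg[of "ln (2 / \<tau>)" "ln (\<tau> / t)"] t ln_ge_zero[of "2 / \<tau>"] ln_ge_zero[of "\<tau> / t"]
      by (simp add: distrib_left distrib_right)
    finally have "\<bar>ln (t / 2)\<bar> ^ j \<le> ((1 + ln (2 / \<tau>)) * (1 + ln (\<tau> / t))) ^ j" by (intro power_mono) auto
    also have "\<dots> \<le> (1 + ln (2 / \<tau>)) ^ j * (C * sqrt (\<tau> / t))"
      unfolding power_mult_distrib using C(2)[of "\<tau> / t"] t
      by (intro mult_left_mono) (auto simp: powr_half_sqrt)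
    finally have 1: "\<bar>ln (t / 2)\<bar> ^ j \<le> (1 + ln (2 / \<tau>)) ^ j * (C * sqrt (\<tau> / t))" .
    have "\<bar>bessel_weight t\<bar> / t\<^sup>2 \<le> 1" using bessel_weight_bounds(1)[of t] t by (simp add: field_simps)
    then have "\<bar>ln (t / 2)\<bar> ^ j * (\<bar>bessel_weight t\<bar> / t\<^sup>2) \<le> (1 + ln (2 / \<tau>)) ^ j * (C * sqrt (\<tau> / t)) * 1"
      using 1 t C(1) by (intro mult_mono) auto
    then show "\<bar>C_integrand j t\<bar> \<le> C * (1 + ln (2 / \<tau>)) ^ j * sqrt (\<tau> / t)"
      by (simp add: C_integrand_def abs_mult power_abs mult_ac)
  qed
qed

text \<open>\<open>bessel_weight\<close> grows only like log t, so j + 1 logarithms have to be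
  absorbed by sqrt t.\<close>

lemma C_integrand_high_bound:
  obtains C :: real where "C > 0" "\<And>t. 2 < t \<Longrightarrow> \<bar>C_integrand j t\<bar> \<le> C * ((1 / t) * sqrt (1 / t))"
proof -
  obtain C :: real where C: "C > 0" "\<And>r::real. r \<ge> 1 \<Longrightarrow> (1 + ln r) ^ (j + 1) \<le> C * r powr (1/2)"
    by (rule one_plus_ln_power_le_powr[of "1/2" "j + 1"]) (simp, blast)
  show ?thesis
  proof
    show "3 * C > 0" using C by simp
    fix t :: real assume t: "2 < t"
    have l: "ln (t / 2) \<ge> 0" using t by simp
    have "\<bar>ln (t / 2)\<bar> ^ j * \<bar>bessel_weight t\<bar> \<le> (1 + ln (t / 2)) ^ j * (3 * (1 + ln (t / 2)))"
      using l bessel_weight_bounds(2)[OF t] by (intro mult_mono power_mono) auto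
    also have "\<dots> = 3 * (1 + ln (t / 2)) ^ (j + 1)" by simp
    also have "\<dots> \<le> 3 * (C * sqrt (t / 2))" using C(2)[of "t / 2"] t by (simp add: powr_half_sqrt)
    also have "\<dots> \<le> 3 * (C * sqrt t)" using C(1) t by simp
    finally have "\<bar>ln (t / 2)\<bar> ^ j * \<bar>bessel_weight t\<bar> / t\<^sup>2 \<le> 3 * (C * sqrt t) / t\<^sup>2" by (intro divide_right_mono) auto
    also have "\<dots> = 3 * C * ((1 / t) * sqrt (1 / t))"
    proof -
      have "sqrt t / t\<^sup>2 = (1 / t) * sqrt (1 / t)"
      proof -
        have "t = sqrt t * sqrt t" using t by simp
        then show ?thesis using t by (simp add: real_sqrt_divide power2_eq_square field_simps)
      qed
      then have "3 * C * (sqrt t / t\<^sup>2) = 3 * C * ((1 / t) * sqrt (1 / t))" by (simp only:)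
      then show ?thesis by simp
    qed
    finally show "\<bar>C_integrand j t\<bar> \<le> 3 * C * ((1 / t) * sqrt (1 / t))" by (simp add: C_integrand_def abs_mult power_abs abs_divide)
  qed
qed

lemma set_integrable_mono_bound:
  fixes f g :: "real \<Rightarrow> real"
  assumes "set_integrable lborel A g" "set_borel_measurable lborel A f" "\<And>t. t \<in> A \<Longrightarrow> \<bar>f t\<bar> \<le> g t"
  shows "set_integrable lborel A f" "\<bar>LBINT t:A. f t\<bar> \<le> (LBINT t:A. g t)"
proof -
  show f: "set_integrable lborel A f"
    unfolding set_integrable_def
    by (rule Bochner_Integration.integrable_bound[OF assms(1)[unfolded set_integrable_def]])
       (use assms in \<open>auto simp: set_borel_measurable_def indicator_def\<close>, force)
  show "\<bar>LBINT t:A. f t\<bar> \<le> (LBINT t:A. g t)"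
    using Bochner_Integration.integral_norm_bound_integral[of lborel "\<lambda>t. indicator A t *\<^sub>R f t" "\<lambda>t. indicator A t *\<^sub>R g t"] f assms
    unfolding set_lebesgue_integral_def set_integrable_def by (auto simp: indicator_def)
qed

lemma C_integrand_measurable_subset: "A \<subseteq> {0<..} \<Longrightarrow> A \<in> sets borel \<Longrightarrow> set_borel_measurable lborel A (C_integrand j)"
  using C_integrand_measurable[of j] by (rule set_borel_measurable_subset) auto

lemma C_integrand_tail_low:
  obtains C :: real where "C > 0"
    "\<And>\<tau>. 0 < \<tau> \<Longrightarrow> \<tau> \<le> 2 \<Longrightarrow> set_integrable lborel {0<..<\<tau>} (C_integrand j) \<and> \<bar>LBINT t:{0<..<\<tau>}. C_integrand j t\<bar> \<le> C * \<tau> * (1 + ln (2 / \<tau>)) ^ j"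
proof -
  obtain C :: real where C: "C > 0" "\<And>t \<tau>. 0 < t \<Longrightarrow> t \<le> \<tau> \<Longrightarrow> \<tau> \<le> 2 \<Longrightarrow> \<bar>C_integrand j t\<bar> \<le> C * (1 + ln (2 / \<tau>)) ^ j * sqrt (\<tau> / t)"
    using C_integrand_low_bound[of j] by blast
  show ?thesis
  proof
    show "2 * C > 0" using C by simp
    fix \<tau> :: real assume \<tau>: "0 < \<tau>" "\<tau> \<le> 2"
    have i: "set_integrable lborel {0<..<\<tau>} (\<lambda>t. C * (1 + ln (2 / \<tau>)) ^ j * sqrt (\<tau> / t))"
      using set_integral_rpow_low(1)[OF \<tau>(1)] by (rule set_integrable_mult_right)
    have m: "set_borel_measurable lborel {0<..<\<tau>} (C_integrand j)" by (rule C_integrand_measurable_subset) auto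
    have b: "\<bar>C_integrand j t\<bar> \<le> C * (1 + ln (2 / \<tau>)) ^ j * sqrt (\<tau> / t)" if "t \<in> {0<..<\<tau>}" for t
      using that \<tau> by (intro C) auto
    have eq: "(LBINT t:{0<..<\<tau>}. C * (1 + ln (2 / \<tau>)) ^ j * sqrt (\<tau> / t)) = C * (1 + ln (2 / \<tau>)) ^ j * (2 * \<tau>)"
      using set_integral_rpow_low(2)[OF \<tau>(1)] by (simp only: set_integral_mult_right)
    show "set_integrable lborel {0<..<\<tau>} (C_integrand j) \<and> \<bar>LBINT t:{0<..<\<tau>}. C_integrand j t\<bar> \<le> 2 * C * \<tau> * (1 + ln (2 / \<tau>)) ^ j"
      using set_integrable_mono_bound(1)[OF i m b] set_integrable_mono_bound(2)[OF i m b, unfolded eq] by (simp add: mult_ac)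
  qed
qed

lemma C_integrand_tail_high:
  obtains C :: real where "C > 0"
    "\<And>T. 2 \<le> T \<Longrightarrow> set_integrable lborel {T<..} (C_integrand j) \<and> \<bar>LBINT t:{T<..}. C_integrand j t\<bar> \<le> C / sqrt T"
proof -
  obtain C :: real where C: "C > 0" "\<And>t. 2 < t \<Longrightarrow> \<bar>C_integrand j t\<bar> \<le> C * ((1 / t) * sqrt (1 / t))"
    using C_integrand_high_bound[of j] by blast
  show ?thesis
  proof
    show "2 * C > 0" using C by simp
    fix T :: real assume T: "2 \<le> T"
    then have T0: "T > 0" by simp
    have i: "set_integrable lborel {T<..} (\<lambda>t. C * ((1 / t) * sqrt (1 / t)))"
      using set_integral_rpow_high(1)[OF T0] by (rule set_integrable_mult_right)
    have m: "set_borel_measurable lborel {T<..} (C_integrand j)" using T by (intro C_integrand_measurable_subset) auto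
    have b: "\<bar>C_integrand j t\<bar> \<le> C * ((1 / t) * sqrt (1 / t))" if "t \<in> {T<..}" for t
      using that T by (intro C) auto
    have eq: "(LBINT t:{T<..}. C * ((1 / t) * sqrt (1 / t))) = C * (2 / sqrt T)"
      using set_integral_rpow_high(2)[OF T0] by (simp only: set_integral_mult_right)
    show "set_integrable lborel {T<..} (C_integrand j) \<and> \<bar>LBINT t:{T<..}. C_integrand j t\<bar> \<le> 2 * C / sqrt T"
      using set_integrable_mono_bound(1)[OF i m b] set_integrable_mono_bound(2)[OF i m b, unfolded eq] by (simp add: mult_ac)
  qed
qed

lemma set_integrable_C_integrand: "set_integrable lborel {0<..} (C_integrand j)"
  and C_coeff_eq: "C_coeff j = (LBINT t:{0<..}. C_integrand j t)"
proof -
  have 1: "set_integrable lborel {0<..<2} (C_integrand j)" by (rule C_integrand_tail_low[of j]) auto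
  have 2: "set_integrable lborel {2<..} (C_integrand j)" by (rule C_integrand_tail_high[of j]) auto
  have 3: "set_integrable lborel {2} (C_integrand j)"
  proof -
    have "(\<lambda>t. indicator {2} t *\<^sub>R C_integrand j t) = (\<lambda>t. indicator {2} t * C_integrand j 2)"
      by (rule ext) (auto simp: indicator_def)
    then show ?thesis unfolding set_integrable_def by simp
  qed
  have "{0<..<2} \<union> {2} = {0<..2::real}" by auto
  then have 4: "set_integrable lborel {0<..2} (C_integrand j)" using set_integrable_Un[OF 1 3] by simp
  have un: "{0<..2} \<union> {2<..} = {0::real<..}" by auto
  show "set_integrable lborel {0<..} (C_integrand j)" using set_integrable_Un[OF 4 2] un by simp
  have "(LBINT t:{0<..}. C_integrand j t) = (LBINT t:{0<..2}. C_integrand j t) + (LBINT t:{2<..}. C_integrand j t)"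
    unfolding un[symmetric] by (rule set_integral_Un[OF _ 4 2]) auto
  moreover have "(LBINT t:{0<..2}. C_integrand j t) = (LBINT t:{0<..2}. ln (t / 2) ^ j * ln (bessel_I0 t) / t\<^sup>2)"
    by (rule set_lebesgue_integral_cong) (auto simp: C_integrand_def bessel_weight_def)
  moreover have "(LBINT t:{2<..}. C_integrand j t) = (LBINT t:{2<..}. ln (t / 2) ^ j * (ln (bessel_I0 t) - t) / t\<^sup>2)"
    by (rule set_lebesgue_integral_cong) (auto simp: C_integrand_def bessel_weight_def)
  ultimately show "C_coeff j = (LBINT t:{0<..}. C_integrand j t)" by (simp add: C_coeff_def)
qed

lemma integral_C_integrand_truncated:
  assumes "0 < \<tau>" "\<tau> \<le> T"
  shows "C_integrand j integrable_on {\<tau>..T}" "(\<lambda>t. \<bar>C_integrand j t\<bar>) integrable_on {\<tau>..T}"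
    "integral {\<tau>..T} (C_integrand j) = C_coeff j - (LBINT t:{0<..<\<tau>}. C_integrand j t) - (LBINT t:{T<..}. C_integrand j t)"
    "integral {\<tau>..T} (\<lambda>t. \<bar>C_integrand j t\<bar>) \<le> (LBINT t:{0<..}. \<bar>C_integrand j t\<bar>)"
proof -
  note si = set_integrable_subset[OF set_integrable_C_integrand[of j]]
  have 1: "set_integrable lborel {\<tau>..T} (C_integrand j)" by (rule si) (use assms in auto)
  have 2: "set_integrable lborel {0<..<\<tau>} (C_integrand j)" by (rule si) auto
  have 3: "set_integrable lborel {T<..} (C_integrand j)" by (rule si) (use assms in auto)
  have 4: "set_integrable lborel ({0<..<\<tau>} \<union> {\<tau>..T}) (C_integrand j)" by (rule set_integrable_Un[OF 2 1]) auto
  show "C_integrand j integrable_on {\<tau>..T}" by (rule set_borel_integral_eq_integral(1)[OF 1])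
  have a: "set_integrable lborel {\<tau>..T} (\<lambda>t. \<bar>C_integrand j t\<bar>)" by (rule set_integrable_abs[OF 1])
  show "(\<lambda>t. \<bar>C_integrand j t\<bar>) integrable_on {\<tau>..T}" by (rule set_borel_integral_eq_integral(1)[OF a])
  have un: "({0<..<\<tau>} \<union> {\<tau>..T}) \<union> {T<..} = {0<..}" using assms by auto
  have "C_coeff j = (LBINT t:{0<..<\<tau>} \<union> {\<tau>..T}. C_integrand j t) + (LBINT t:{T<..}. C_integrand j t)"
    unfolding C_coeff_eq un[symmetric] by (rule set_integral_Un[OF _ 4 3]) (use assms in auto)
  also have "(LBINT t:{0<..<\<tau>} \<union> {\<tau>..T}. C_integrand j t) = (LBINT t:{0<..<\<tau>}. C_integrand j t) + (LBINT t:{\<tau>..T}. C_integrand j t)"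
    by (rule set_integral_Un[OF _ 2 1]) auto
  also have "(LBINT t:{\<tau>..T}. C_integrand j t) = integral {\<tau>..T} (C_integrand j)" by (rule set_borel_integral_eq_integral(2)[OF 1])
  finally show "integral {\<tau>..T} (C_integrand j) = C_coeff j - (LBINT t:{0<..<\<tau>}. C_integrand j t) - (LBINT t:{T<..}. C_integrand j t)" by simp
  have "integral {\<tau>..T} (\<lambda>t. \<bar>C_integrand j t\<bar>) = (LBINT t:{\<tau>..T}. \<bar>C_integrand j t\<bar>)"
    by (rule set_borel_integral_eq_integral(2)[OF a, symmetric])
  also have "\<dots> \<le> (LBINT t:{0<..}. \<bar>C_integrand j t\<bar>)"
    unfolding set_lebesgue_integral_def
    using a set_integrable_abs[OF set_integrable_C_integrand[of j]] assms
    by (intro integral_mono) (auto simp: set_integrable_def indicator_def)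
  finally show "integral {\<tau>..T} (\<lambda>t. \<bar>C_integrand j t\<bar>) \<le> (LBINT t:{0<..}. \<bar>C_integrand j t\<bar>)" .
qed

text \<open>An exact remainder is needed rather than convergence: l = log (t/2) is unbounded below
  as t tends to 0, where |l| < L fails and only L - l > 0 remains.\<close>

lemma truncated_geometric:
  fixes L l :: real
  assumes "L > 0" "l < L"
  shows "1 / (L - l) - (\<Sum>j\<le>J. l ^ j / L ^ (j + 1)) = l ^ (J + 1) / (L ^ (J + 1) * (L - l))"
proof (induction J)
  case 0
  then show ?case using assms by (simp add: field_simps)
next
  case (Suc J)
  have "1 / (L - l) - (\<Sum>j\<le>Suc J. l ^ j / L ^ (j + 1)) = l ^ (J + 1) / (L ^ (J + 1) * (L - l)) - l ^ (J + 1) / L ^ (J + 2)"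
    using Suc by simp
  also have "\<dots> = l ^ (Suc J + 1) / (L ^ (Suc J + 1) * (L - l))"
  proof -
    have "x / (z * (L - l)) - x / (z * L) = x * l / (z * L * (L - l))" if "z > 0" for x z
      using that assms by (simp add: divide_simps) (simp add: algebra_simps)
    from this[of "L ^ (J + 1)" "l ^ (J + 1)"] show ?thesis using assms by (simp add: mult_ac)
  qed
  finally show ?case .
qed

text \<open>Here log (2k/t) = L - l with L = log k and l = log (t/2). The hypothesis on
  \<open>T\<close> ensures L - l >= L/2, so the geometric remainder is at most 2 / L^(J + 2) times
  the next integrand, which is absolutely integrable.\<close>

lemma integral_expansion:
  fixes k :: nat and \<tau> T :: real
  assumes k: "k \<ge> 2" and tT: "0 < \<tau>" "\<tau> \<le> 2" "2 \<le> T" and T: "ln (T / 2) \<le> ln (real k) / 2"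
  shows "(\<lambda>t. bessel_weight t / (t\<^sup>2 * ln (2 * real k / t))) integrable_on {\<tau>..T} \<Longrightarrow>
    \<bar>integral {\<tau>..T} (\<lambda>t. bessel_weight t / (t\<^sup>2 * ln (2 * real k / t))) - (\<Sum>j\<le>J. integral {\<tau>..T} (C_integrand j) / ln (real k) ^ (j + 1))\<bar>
      \<le> 2 / ln (real k) ^ (J + 2) * (LBINT t:{0<..}. \<bar>C_integrand (J + 1) t\<bar>)"
proof -
  assume int: "(\<lambda>t. bessel_weight t / (t\<^sup>2 * ln (2 * real k / t))) integrable_on {\<tau>..T}"
  define L where "L = ln (real k)"
  have L: "L > 0" using k by (simp add: L_def)
  have tT': "\<tau> \<le> T" using tT by simp
  note iv = integral_C_integrand_truncated[OF tT(1) tT']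
  have ptw: "\<bar>bessel_weight t / (t\<^sup>2 * ln (2 * real k / t)) - (\<Sum>j\<le>J. C_integrand j t / L ^ (j + 1))\<bar> \<le> 2 / L ^ (J + 2) * \<bar>C_integrand (J + 1) t\<bar>"
    if t: "t \<in> {\<tau>..T}" for t
  proof -
    define l where "l = ln (t / 2)"
    have t0: "t > 0" using t tT by auto
    have "l \<le> ln (T / 2)" using t t0 unfolding l_def by simp
    then have l: "l \<le> L / 2" using T by (simp add: L_def)
    have eq: "ln (2 * real k / t) = L - l" using t0 k by (simp add: L_def l_def ln_div ln_mult)
    have v: "C_integrand j t = l ^ j * (bessel_weight t / t\<^sup>2)" for j by (simp add: C_integrand_def l_def)
    have "bessel_weight t / (t\<^sup>2 * ln (2 * real k / t)) - (\<Sum>j\<le>J. C_integrand j t / L ^ (j + 1)) = (bessel_weight t / t\<^sup>2) * (1 / (L - l) - (\<Sum>j\<le>J. l ^ j / L ^ (j + 1)))"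
      unfolding eq v by (simp add: right_diff_distrib sum_distrib_left mult_ac)
    also have "\<dots> = (bessel_weight t / t\<^sup>2) * (l ^ (J + 1) / (L ^ (J + 1) * (L - l)))"
      using L l by (subst truncated_geometric) auto
    also have "\<dots> = C_integrand (J + 1) t * (1 / (L ^ (J + 1) * (L - l)))" unfolding v by simp
    also have "\<bar>\<dots>\<bar> = \<bar>C_integrand (J + 1) t\<bar> * (1 / (L ^ (J + 1) * (L - l)))" using L l by (simp add: abs_mult)
    also have "\<dots> \<le> \<bar>C_integrand (J + 1) t\<bar> * (1 / (L ^ (J + 1) * (L / 2)))"
      using L l by (intro mult_left_mono divide_left_mono) auto
    finally show ?thesis by (simp add: mult_ac)
  qed
  have isum: "(\<lambda>t. \<Sum>j\<le>J. C_integrand j t / L ^ (j + 1)) integrable_on {\<tau>..T}"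
    by (intro integrable_sum integrable_on_divide iv) auto
  have "integral {\<tau>..T} (\<lambda>t. bessel_weight t / (t\<^sup>2 * ln (2 * real k / t)) - (\<Sum>j\<le>J. C_integrand j t / L ^ (j + 1)))
     = integral {\<tau>..T} (\<lambda>t. bessel_weight t / (t\<^sup>2 * ln (2 * real k / t))) - (\<Sum>j\<le>J. integral {\<tau>..T} (C_integrand j) / L ^ (j + 1))"
    by (subst Henstock_Kurzweil_Integration.integral_diff[OF int isum], subst Henstock_Kurzweil_Integration.integral_sum)
       (auto intro!: integrable_on_divide iv)
  moreover have "norm (integral {\<tau>..T} (\<lambda>t. bessel_weight t / (t\<^sup>2 * ln (2 * real k / t)) - (\<Sum>j\<le>J. C_integrand j t / L ^ (j + 1))))
     \<le> integral {\<tau>..T} (\<lambda>t. 2 / L ^ (J + 2) * \<bar>C_integrand (J + 1) t\<bar>)"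
  proof (rule Henstock_Kurzweil_Integration.integral_norm_bound_integral)
    show "(\<lambda>t. 2 / L ^ (J + 2) * \<bar>C_integrand (J + 1) t\<bar>) integrable_on {\<tau>..T}"
      by (rule integrable_on_mult_right) (rule iv)
    show "(\<lambda>t. bessel_weight t / (t\<^sup>2 * ln (2 * real k / t)) - (\<Sum>j\<le>J. C_integrand j t / L ^ (j + 1))) integrable_on {\<tau>..T}"
      by (rule integrable_diff[OF int isum])
  qed (use ptw in auto)
  moreover have "integral {\<tau>..T} (\<lambda>t. 2 / L ^ (J + 2) * \<bar>C_integrand (J + 1) t\<bar>) \<le> 2 / L ^ (J + 2) * (LBINT t:{0<..}. \<bar>C_integrand (J + 1) t\<bar>)"
    using iv(4)[of "J + 1"] L by (simp add: divide_right_mono)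
  ultimately show ?thesis unfolding L_def by simp
qed

subsection \<open>Assembling the estimate\<close>

text \<open>Each prime up to M costs at most log (8k). Between M and k the local factor and the
  removed factor combine to log I_0(t) - t with t = 2k/p; beyond k nothing is removed. The errors
  4k/p^2 telescope to 4k/M, so M near sqrt k is the natural choice.\<close>

lemma ln_local_factor_error:
  assumes k: "k \<ge> 2" and M: "M \<ge> 1" "M \<le> k" "k \<le> N"
  shows "\<bar>(\<Sum>p | prime p \<and> p \<in> {0<..N}. ln (local_factor k (1 / real p))) + 2 * real k * (\<Sum>p | prime p \<and> p \<in> {0<..k}. ln (1 - 1 / real p))
     - ((\<Sum>p | prime p \<and> p \<in> {M<..k}. ln (bessel_I0 (2 * real k / real p)) - 2 * real k / real p)
        + (\<Sum>p | prime p \<and> p \<in> {k<..N}. ln (bessel_I0 (2 * real k / real p))))\<bar>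
     \<le> real M * ln (8 * real k) + 4 * real k / real M"
proof -
  define f where "f = (\<lambda>p. ln (local_factor k (1 / real p)))"
  define s where "s = (\<lambda>p. 2 * real k * ln (1 - 1 / real p))"
  define I where "I = (\<lambda>p. ln (bessel_I0 (2 * real k / real p)))"
  define P where "P = (\<lambda>a b. {p::nat. prime p \<and> p \<in> {a<..b}})"
  have fin: "finite (P a b)" for a b unfolding P_def by (rule finite_subset[of _ "{..b}"]) auto
  have split: "sum F (P a c) = sum F (P a b) + sum F (P b c)" if "a \<le> b" "b \<le> c" for a b c and F :: "nat \<Rightarrow> real"
  proof -
    have "P a c = P a b \<union> P b c" "P a b \<inter> P b c = {}" using that by (auto simp: P_def)
    then show ?thesis using fin by (simp add: sum.union_disjoint)
  qed
  have p2: "p \<ge> 2" if "p \<in> P a b" for p a b using that prime_ge_2_nat by (auto simp: P_def)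
  have lf: "\<bar>f p + s p\<bar> \<le> ln (8 * real k)" "\<bar>f p + s p - (I p - 2 * real k / real p)\<bar> \<le> 4 * real k / real p ^ 2"
     "\<bar>f p - I p\<bar> \<le> 4 * real k / real p ^ 2" if "p \<ge> 2" for p
  proof -
    have x: "0 \<le> 1 / real p" "1 / real p \<le> 1 / 2" "k \<ge> 1" using that k by (auto simp: field_simps)
    note l = ln_local_factor[OF x(3,1,2)]
    show "\<bar>f p + s p\<bar> \<le> ln (8 * real k)" using l(4,5) ln_ge_zero[of "8 * real k"] k by (simp add: f_def s_def)
    \<comment> \<open>f p - I p lies in [0, 4k/p^2] and s p + 2k/p in [-4k/p^2, 0]; the signs are
      opposite, so the two bounds do not add up.\<close>
    show "\<bar>f p + s p - (I p - 2 * real k / real p)\<bar> \<le> 4 * real k / real p ^ 2"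
      using l(2,3,6) ln_one_minus_pos_upper_bound[of "1 / real p"] x mult_left_mono[of "ln (1 - 1 / real p)" "- (1 / real p)" "2 * real k"] that
      by (simp add: f_def s_def I_def power_divide right_diff_distrib abs_le_iff)
    show "\<bar>f p - I p\<bar> \<le> 4 * real k / real p ^ 2"
      using l(2,3) by (simp add: f_def I_def power_divide)
  qed
  have tel: "(\<Sum>p\<in>P M N. 4 * real k / real p ^ 2) \<le> 4 * real k / real M"
  proof -
    have "(\<Sum>n\<in>{M<..N}. 4 * real k / real n ^ 2) \<le> 4 * real k * (1 / real M - 1 / real N)"
      using order_trans[OF M(2,3)]
    proof (induction N rule: dec_induct)
      case base
      then show ?case by simp
    next
      case (step n)
      have n: "n \<ge> 1" using step M by simp
      have set: "{M<..Suc n} = insert (Suc n) {M<..n}" using step by auto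
      have "1 / real (Suc n) ^ 2 \<le> 1 / (real n * real (Suc n))"
        unfolding power2_eq_square using n by (intro divide_left_mono mult_right_mono) auto
      also have "\<dots> = 1 / real n - 1 / real (Suc n)" using n by (simp add: field_simps)
      finally have "4 * real k * (1 / real (Suc n) ^ 2) \<le> 4 * real k * (1 / real n - 1 / real (Suc n))"
        by (intro mult_left_mono) auto
      then show ?case unfolding set using step.IH by (simp add: right_diff_distrib)
    qed
    also have "\<dots> \<le> 4 * real k / real M" by (simp add: right_diff_distrib)
    moreover have "(\<Sum>p\<in>P M N. 4 * real k / real p ^ 2) \<le> (\<Sum>n\<in>{M<..N}. 4 * real k / real n ^ 2)"
      by (rule sum_mono2) (auto simp: P_def)
    ultimately show ?thesis by linarith
  qed
  have b1: "\<bar>\<Sum>p\<in>P 0 M. f p + s p\<bar> \<le> real M * ln (8 * real k)"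
  proof -
    have "\<bar>\<Sum>p\<in>P 0 M. f p + s p\<bar> \<le> (\<Sum>p\<in>P 0 M. ln (8 * real k))"
      by (rule order_trans[OF sum_abs sum_mono]) (rule lf(1)[OF p2])
    also have "\<dots> = real (card (P 0 M)) * ln (8 * real k)" by simp
    also have "\<dots> \<le> real M * ln (8 * real k)"
    proof (intro mult_right_mono)
      have "card (P 0 M) \<le> card {0<..M}" by (rule card_mono) (auto simp: P_def)
      then show "real (card (P 0 M)) \<le> real M" by simp
    qed (use k in auto)
    finally show ?thesis .
  qed
  have b2: "\<bar>\<Sum>p\<in>P M k. f p + s p - (I p - 2 * real k / real p)\<bar> \<le> (\<Sum>p\<in>P M k. 4 * real k / real p ^ 2)"
    by (rule order_trans[OF sum_abs sum_mono]) (rule lf(2)[OF p2])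
  have b3: "\<bar>\<Sum>p\<in>P k N. f p - I p\<bar> \<le> (\<Sum>p\<in>P k N. 4 * real k / real p ^ 2)"
    by (rule order_trans[OF sum_abs sum_mono]) (rule lf(3)[OF p2])
  have "sum f (P 0 N) + sum s (P 0 k) - ((\<Sum>p\<in>P M k. I p - 2 * real k / real p) + sum I (P k N))
     = (\<Sum>p\<in>P 0 M. f p + s p) + (\<Sum>p\<in>P M k. f p + s p - (I p - 2 * real k / real p)) + (\<Sum>p\<in>P k N. f p - I p)"
    using split[of 0 M N f] split[of M k N f] split[of 0 M k s] M by (simp add: sum.distrib sum_subtractf)
  also have "\<bar>\<dots>\<bar> \<le> real M * ln (8 * real k) + 4 * real k / real M"
    using b1 b2 b3 tel split[of M k N "\<lambda>p. 4 * real k / real p ^ 2"] M by linarith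
  finally show ?thesis by (simp add: P_def f_def s_def I_def sum_distrib_left)
qed

lemma Lipschitz_weight_ln_bessel_I0:
  assumes "k \<ge> 2"
  shows "Lipschitz_weight (\<lambda>t. ln (bessel_I0 t)) k" "Lipschitz_weight (\<lambda>t. ln (bessel_I0 t) - t) k"
proof -
  show "Lipschitz_weight (\<lambda>t. ln (bessel_I0 t)) k"
  proof
    fix s t :: real assume "0 \<le> s" "s \<le> t"
    then show "\<bar>ln (bessel_I0 t) - ln (bessel_I0 s)\<bar> \<le> t - s"
      using ln_bessel_I0_Lipschitz[of s t] by auto
  next
    fix t :: real assume "0 \<le> t"
    then show "\<bar>ln (bessel_I0 t)\<bar> \<le> t" using ln_bessel_I0_bounds[of t] by auto
  qed (rule assms)
  show "Lipschitz_weight (\<lambda>t. ln (bessel_I0 t) - t) k"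
  proof
    fix s t :: real assume "0 \<le> s" "s \<le> t"
    then show "\<bar>(ln (bessel_I0 t) - t) - (ln (bessel_I0 s) - s)\<bar> \<le> t - s"
      using ln_bessel_I0_Lipschitz[of s t] by auto
  next
    fix t :: real assume "0 \<le> t"
    then show "\<bar>ln (bessel_I0 t) - t\<bar> \<le> t" using ln_bessel_I0_bounds[of t] by auto
  qed (rule assms)
qed

text \<open>Blocks [n, n + 1] make the prime sums break at \<theta> = 2k/(k + 1), whereas the C_j
  break at 2. On [\<theta>, 2], of length at most 2/k, the two kernels differ by at most
  3/2.\<close>

lemma kern_integrals_combine:
  fixes k :: nat and \<tau> T :: real
  defines "g1 \<equiv> \<lambda>t. ln (bessel_I0 t) - t" and "g2 \<equiv> \<lambda>t. ln (bessel_I0 t)"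
  defines "\<theta> \<equiv> 2 * real k / (real k + 1)"
  assumes k: "k \<ge> 2" and tT: "0 < \<tau>" "\<tau> \<le> 1" "2 \<le> T" "T < 2 * real k"
  shows "(\<lambda>t. bessel_weight t / (t\<^sup>2 * ln (2 * real k / t))) integrable_on {\<tau>..T}"
    "\<bar>integral {\<tau>..\<theta>} (Lipschitz_weight.kern g2 k) + integral {\<theta>..T} (Lipschitz_weight.kern g1 k)
       - integral {\<tau>..T} (\<lambda>t. bessel_weight t / (t\<^sup>2 * ln (2 * real k / t)))\<bar> \<le> 3 / real k"
proof -
  interpret W1: Lipschitz_weight g1 k unfolding g1_def by (rule Lipschitz_weight_ln_bessel_I0[OF k])
  interpret W2: Lipschitz_weight g2 k unfolding g2_def by (rule Lipschitz_weight_ln_bessel_I0[OF k])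
  let ?h = "\<lambda>t. bessel_weight t / (t\<^sup>2 * ln (2 * real k / t))"
  have \<theta>: "1 \<le> \<theta>" "\<theta> \<le> 2" "2 - \<theta> \<le> 2 / real k"
    using k by (auto simp: \<theta>_def field_simps)
  have k2: "2 < 2 * real k" using k by simp
  have k1: "W1.kern t = (ln (bessel_I0 t) - t) / (t\<^sup>2 * ln (2 * real k / t))" for t
    unfolding W1.kern_def by (simp add: g1_def)
  have k2': "W2.kern t = ln (bessel_I0 t) / (t\<^sup>2 * ln (2 * real k / t))" for t
    unfolding W2.kern_def by (simp add: g2_def)
  have "W2.kern t = ?h t" if "t \<in> {\<tau>..2}" for t using that by (simp add: k2' bessel_weight_def)
  then have i2: "(?h has_integral integral {\<tau>..2} W2.kern) {\<tau>..2}"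
    using integrable_integral[OF W2.integrable_kern[OF tT(1) k2]] has_integral_cong[of "{\<tau>..2}" W2.kern ?h] by blast
  have i1: "(?h has_integral integral {2..T} W1.kern) {2..T}"
  proof (rule has_integral_spike[of "{2}"])
    show "(W1.kern has_integral integral {2..T} W1.kern) {2..T}"
      by (rule integrable_integral[OF W1.integrable_kern[OF _ tT(4)]]) simp
  qed (auto simp: k1 bessel_weight_def)
  have ih: "(?h has_integral (integral {\<tau>..2} W2.kern + integral {2..T} W1.kern)) {\<tau>..T}"
    by (rule has_integral_combine[OF _ _ i2 i1]) (use tT in auto)
  then show "?h integrable_on {\<tau>..T}" by (rule has_integral_integrable)
  have c2: "integral {\<tau>..\<theta>} W2.kern + integral {\<theta>..2} W2.kern = integral {\<tau>..2} W2.kern"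
    by (rule Henstock_Kurzweil_Integration.integral_combine) (use tT \<theta> W2.integrable_kern k2 in auto)
  have c1: "integral {\<theta>..2} W1.kern + integral {2..T} W1.kern = integral {\<theta>..T} W1.kern"
    by (rule Henstock_Kurzweil_Integration.integral_combine) (use tT \<theta> W1.integrable_kern k2 in auto)
  have n2: "W2.kern integrable_on {\<theta>..2}" and n1: "W1.kern integrable_on {\<theta>..2}"
    using \<theta> k2 by (auto intro!: W2.integrable_kern W1.integrable_kern)
  have "\<bar>integral {\<theta>..2} (\<lambda>t. W1.kern t - W2.kern t)\<bar> \<le> 3 / 2 * (2 - \<theta>)"
  proof -
    have "norm (integral {\<theta>..2} (\<lambda>t. W1.kern t - W2.kern t)) \<le> 3 / 2 * (2 - \<theta>)"
    proof (rule integral_bound)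
      show "continuous_on {\<theta>..2} (\<lambda>t. W1.kern t - W2.kern t)"
        using \<theta> k2 by (intro continuous_on_diff W1.continuous_kern W2.continuous_kern) auto
      fix t assume t: "t \<in> {\<theta>..2}"
      then have t0: "t \<ge> 1" "t \<le> 2" using \<theta> by auto
      have "2 \<le> 2 * real k / t" using t0 k by (simp add: field_simps)
      then have "ln 2 \<le> ln (2 * real k / t)" using t0 by (subst ln_le_cancel_iff) auto
      then have l: "2 / 3 \<le> ln (2 * real k / t)" using ln2_ge_two_thirds by linarith
      have "W1.kern t - W2.kern t = - (1 / (t * ln (2 * real k / t)))"
        using t0 l by (simp add: k1 k2' diff_divide_distrib[symmetric] power2_eq_square)
      also have "norm \<dots> = 1 / (t * ln (2 * real k / t))" using t0 l by simp
      also have "\<dots> \<le> 1 / (1 * (2 / 3))" using t0 l by (intro divide_left_mono mult_mono) auto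
      finally show "norm (W1.kern t - W2.kern t) \<le> 3 / 2" by simp
    qed (use \<theta> in auto)
    then show ?thesis by simp
  qed
  also have "3 / 2 * (2 - \<theta>) \<le> 3 / real k" using \<theta>(3) by simp
  finally have d: "\<bar>integral {\<theta>..2} W1.kern - integral {\<theta>..2} W2.kern\<bar> \<le> 3 / real k"
    using Henstock_Kurzweil_Integration.integral_diff[OF n1 n2] by simp
  show "\<bar>integral {\<tau>..\<theta>} W2.kern + integral {\<theta>..T} W1.kern - integral {\<tau>..T} ?h\<bar> \<le> 3 / real k"
    using d c1 c2 integral_unique[OF ih] by linarith
qed

text \<open>M is the integer part of sqrt k, and N will be that of y. The term k / (log k)^(J + 2)
  comes from the prime number theorem and the geometric remainder, k/M and 1 from comparing sums
  with integrals, k^(3/4) from cutting the C_j at T of size sqrt k, where the tail is O(T^(-1/2)).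
  The \<open>K2\<close> term comes from cutting at \<tau> of size k/N and is kept apart, since it
  becomes k/y.\<close>

lemma prime_sums_expansion:
  fixes A :: real and J :: nat
  assumes A: "A > 1"
  obtains K1 K2 :: real where "K1 \<ge> 0" "K2 \<ge> 0"
    "\<And>(k::nat) (M::nat) (N::nat). k \<ge> 2 \<Longrightarrow> 1 \<le> M \<Longrightarrow> M < k \<Longrightarrow> M\<^sup>2 \<le> k \<Longrightarrow> k < (M + 1)\<^sup>2 \<Longrightarrow> 2 * k \<le> N \<Longrightarrow> real (N + 1) \<le> real k powr (A + 1) \<Longrightarrow>
     \<bar>((\<Sum>p | prime p \<and> p \<in> {M<..k}. ln (bessel_I0 (2 * real k / real p)) - 2 * real k / real p)
        + (\<Sum>p | prime p \<and> p \<in> {k<..N}. ln (bessel_I0 (2 * real k / real p))))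
      - 2 * real k * (\<Sum>j\<le>J. C_coeff j / ln (real k) ^ (j + 1))\<bar>
      \<le> K1 * (real k / ln (real k) ^ (J + 2) + 1 + real k / real M + real k * real k powr (-1/4)) + K2 * ((real k)\<^sup>2 / (real (N + 1) * ln (real k)))"
proof -
  \<comment> \<open>One logarithm is lost in \<open>Abel_step\<close>, and k / (log k)^(J + 2) is to
    remain.\<close>
  define q where "q = J + 3"
  obtain Cp :: real where Cp: "Cp > 0" "\<And>N. N \<ge> 2 \<Longrightarrow>
    \<bar>(\<Sum>n=2..N. of_bool (prime n) - 1 / ln (real n))\<bar> \<le> Cp * real N / ln (real N) ^ q"
    by (rule prime_number_theorem_log_powers[of q]) blast
  have "\<exists>C>0. \<forall>\<tau>. 0 < \<tau> \<longrightarrow> \<tau> \<le> 2 \<longrightarrow> \<bar>LBINT t:{0<..<\<tau>}. C_integrand j t\<bar> \<le> C * \<tau> * (1 + ln (2 / \<tau>)) ^ j" for j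
    by (rule C_integrand_tail_low[of j]) blast
  then obtain Cl :: "nat \<Rightarrow> real" where Cl: "\<And>j. Cl j > 0" "\<And>j \<tau>. 0 < \<tau> \<Longrightarrow> \<tau> \<le> 2 \<Longrightarrow> \<bar>LBINT t:{0<..<\<tau>}. C_integrand j t\<bar> \<le> Cl j * \<tau> * (1 + ln (2 / \<tau>)) ^ j"
    by metis
  have "\<exists>C>0. \<forall>T\<ge>2. \<bar>LBINT t:{T<..}. C_integrand j t\<bar> \<le> C / sqrt T" for j
    by (rule C_integrand_tail_high[of j]) blast
  then obtain Ch :: "nat \<Rightarrow> real" where Ch: "\<And>j. Ch j > 0" "\<And>j T. 2 \<le> T \<Longrightarrow> \<bar>LBINT t:{T<..}. C_integrand j t\<bar> \<le> Ch j / sqrt T"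
    by metis
  define W where "W = (LBINT t:{0<..}. \<bar>C_integrand (J + 1) t\<bar>)"
  have W: "W \<ge> 0" unfolding W_def set_lebesgue_integral_def by (intro integral_nonneg_AE) auto
  define K3 where "K3 = 4 * Cp * 4 ^ q * (A + 4)"
  define K4 where "K4 = 2 ^ (J + 2) * (\<Sum>j\<le>J. Ch j)"
  define K1 where "K1 = K3 + 16 + 4 * W + K4"
  define K2 where "K2 = 4 * (A + 3) ^ J * (\<Sum>j\<le>J. Cl j)"
  have "(\<Sum>j\<le>J. Ch j) \<ge> 0" "(\<Sum>j\<le>J. Cl j) \<ge> 0"
    using Ch(1) Cl(1) by (auto intro!: sum_nonneg simp: less_imp_le)
  then have K: "K3 \<ge> 0" "K4 \<ge> 0" "K2 \<ge> 0" using Cp(1) A by (simp_all add: K3_def K4_def K2_def)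
  show ?thesis
  proof
    show "K1 \<ge> 0" "K2 \<ge> 0" using K W by (auto simp: K1_def)
    fix k M N :: nat
    assume k: "k \<ge> 2" and M: "1 \<le> M" "M < k" "M\<^sup>2 \<le> k" "k < (M + 1)\<^sup>2" and N: "2 * k \<le> N" "real (N + 1) \<le> real k powr (A + 1)"
    define L where "L = ln (real k)"
    have L: "2 / 3 \<le> L"
    proof -
      have "ln 2 \<le> L" using k by (simp add: L_def)
      then show ?thesis using ln2_ge_two_thirds by linarith
    qed
    have L0: "L > 0" using L by simp
    define \<tau> T \<theta> where "\<tau> = 2 * real k / real (N + 1)" and "T = 2 * real k / real (M + 1)" and "\<theta> = 2 * real k / (real k + 1)"
    have tT: "0 < \<tau>" "\<tau> \<le> 1" "2 \<le> T" "T < 2 * real k"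
      using k M N by (auto simp: \<tau>_def T_def field_simps)
    have lnN: "ln (real (N + 1)) \<le> (A + 1) * L"
    proof -
      have "ln (real (N + 1)) \<le> ln (real k powr (A + 1))" using N(2) k by (subst ln_le_cancel_iff) auto
      then show ?thesis using k by (simp add: L_def ln_powr)
    qed
    let ?g1 = "\<lambda>t. ln (bessel_I0 t) - t" and ?g2 = "\<lambda>t. ln (bessel_I0 t)"
    interpret W1: Lipschitz_weight ?g1 k by (rule Lipschitz_weight_ln_bessel_I0[OF k])
    interpret W2: Lipschitz_weight ?g2 k by (rule Lipschitz_weight_ln_bessel_I0[OF k])
    define c where "c = Cp * 4 ^ q / L ^ q"
    have c: "c \<ge> 0" using Cp L0 by (simp add: c_def)
    \<comment> \<open>For n >= 2 and n >= M, k < (n + 1)^2 <= n^4, so log n is at least (log k)/4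
      and the error can be stated with log k, uniformly in n. This is the origin of
      \<open>4 ^ q\<close>; for n < 2 the sum is empty.\<close>
    have e: "\<bar>\<Sum>i=2..n. of_bool (prime i) - 1 / ln (real i)\<bar> \<le> c * real n" if n: "n \<ge> M" for n
    proof (cases "n \<ge> 2")
      case False
      then show ?thesis using c by simp
    next
      case True
      have "2 * n \<le> n * n" using True by (intro mult_le_mono) auto
      then have "n + 1 \<le> n\<^sup>2" unfolding power2_eq_square using True by linarith
      then have "(n + 1)\<^sup>2 \<le> (n\<^sup>2)\<^sup>2" by (intro power_mono) auto
      moreover have "(M + 1)\<^sup>2 \<le> (n + 1)\<^sup>2" using n by (intro power_mono) auto
      moreover have "(n\<^sup>2)\<^sup>2 = n ^ 4" by (simp flip: power_mult)
      ultimately have "k \<le> n ^ 4" using M(4) by linarith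
      then have "real k \<le> real n ^ 4" by (simp only: of_nat_power[symmetric] of_nat_le_iff)
      then have "L \<le> ln (real n ^ 4)" unfolding L_def using k True by (subst ln_le_cancel_iff) auto
      then have l4: "L / 4 \<le> ln (real n)" using True by (simp add: ln_realpow)
      have "Cp * real n / ln (real n) ^ q \<le> Cp * real n / (L / 4) ^ q"
        using l4 L0 Cp True by (intro divide_left_mono power_mono mult_pos_pos zero_less_power) auto
      also have "\<dots> = c * real n" by (simp add: c_def power_divide)
      finally show ?thesis using Cp(2)[OF True] by linarith
    qed
    have cE: "2 * real k * c * (2 + ln (real (m + 1))) \<le> K3 / 2 * (real k / L ^ (J + 2))" if "m \<le> N" for m
    proof -
      have "ln (real (m + 1)) \<le> ln (real (N + 1))" using that by simp
      moreover have "(A + 4) * L = (A + 1) * L + 3 * L" by (simp add: algebra_simps)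
      ultimately have "2 + ln (real (m + 1)) \<le> (A + 4) * L" using lnN L by linarith
      then have "2 * real k * c * (2 + ln (real (m + 1))) \<le> 2 * real k * c * ((A + 4) * L)"
        using c by (intro mult_left_mono) auto
      also have "\<dots> = K3 / 2 * (real k / L ^ (J + 2))"
        using L0 by (simp add: c_def K3_def q_def power_add power_numeral_reduce field_simps)
      finally show ?thesis .
    qed
    have Q1: "\<bar>(\<Sum>p | prime p \<and> p \<in> {M<..k}. ?g1 (2 * real k / real p)) - 2 * real k * integral {\<theta>..T} W1.kern\<bar>
       \<le> K3 / 2 * (real k / L ^ (J + 2)) + 8 * (real k / real M)"
      using W1.prime_sum_integral[OF M(1) less_imp_le[OF M(2)] c e] cE[of k] N
      by (simp add: \<theta>_def T_def add.commute)
    have Q2: "\<bar>(\<Sum>p | prime p \<and> p \<in> {k<..N}. ?g2 (2 * real k / real p)) - 2 * real k * integral {\<tau>..\<theta>} W2.kern\<bar>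
       \<le> K3 / 2 * (real k / L ^ (J + 2)) + 8"
      using W2.prime_sum_integral[of k N c] c e cE[of N] N k M
      by (simp add: \<theta>_def \<tau>_def add.commute)
    let ?H = "integral {\<tau>..T} (\<lambda>t. bessel_weight t / (t\<^sup>2 * ln (2 * real k / t)))"
    note comb = kern_integrals_combine[OF k tT]
    have Q3: "\<bar>2 * real k * integral {\<tau>..\<theta>} W2.kern + 2 * real k * integral {\<theta>..T} W1.kern - 2 * real k * ?H\<bar> \<le> 6"
    proof -
      have "2 * real k * \<bar>integral {\<tau>..\<theta>} W2.kern + integral {\<theta>..T} W1.kern - ?H\<bar> \<le> 2 * real k * (3 / real k)"
        using comb(2) unfolding \<theta>_def by (intro mult_left_mono) auto
      moreover have "2 * real k * integral {\<tau>..\<theta>} W2.kern + 2 * real k * integral {\<theta>..T} W1.kern - 2 * real k * ?H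
         = 2 * real k * (integral {\<tau>..\<theta>} W2.kern + integral {\<theta>..T} W1.kern - ?H)" by (simp add: algebra_simps)
      ultimately show ?thesis using k by (simp add: abs_mult)
    qed
    have T2: "ln (T / 2) \<le> ln (real k) / 2"
    proof -
      have "T / 2 = real k / real (M + 1)" by (simp add: T_def field_simps)
      then have "(T / 2)\<^sup>2 = (real k / real (M + 1))\<^sup>2" by (simp only:)
      also have "\<dots> = real k * (real k / real ((M + 1)\<^sup>2))"
      proof -
        have "(a / b)\<^sup>2 = a * (a / b\<^sup>2)" for a b :: real by (simp add: power2_eq_square)
        from this[of "real k" "real (M + 1)"] show ?thesis by (simp only: of_nat_power)
      qed
      also have "\<dots> \<le> real k * 1" using M(4) k by (intro mult_left_mono) (auto simp del: of_nat_power)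
      finally have "ln ((T / 2)\<^sup>2) \<le> ln (real k)" using tT k by (subst ln_le_cancel_iff) auto
      then show ?thesis using tT by (simp add: ln_realpow)
    qed
    have "\<bar>?H - (\<Sum>j\<le>J. integral {\<tau>..T} (C_integrand j) / L ^ (j + 1))\<bar> \<le> 2 / L ^ (J + 2) * W"
      unfolding L_def W_def using tT by (intro integral_expansion k T2 comb(1)) auto
    then have "2 * real k * \<bar>?H - (\<Sum>j\<le>J. integral {\<tau>..T} (C_integrand j) / L ^ (j + 1))\<bar> \<le> 2 * real k * (2 / L ^ (J + 2) * W)"
      by (intro mult_left_mono) auto
    moreover have "2 * real k * \<bar>?H - (\<Sum>j\<le>J. integral {\<tau>..T} (C_integrand j) / L ^ (j + 1))\<bar> = \<bar>2 * real k * ?H - 2 * real k * (\<Sum>j\<le>J. integral {\<tau>..T} (C_integrand j) / L ^ (j + 1))\<bar>"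
    proof -
      have "2 * real k * \<bar>x - y\<bar> = \<bar>2 * real k * x - 2 * real k * y\<bar>" for x y :: real
        by (simp add: right_diff_distrib[symmetric] abs_mult)
      then show ?thesis .
    qed
    ultimately have Q4: "\<bar>2 * real k * ?H - 2 * real k * (\<Sum>j\<le>J. integral {\<tau>..T} (C_integrand j) / L ^ (j + 1))\<bar> \<le> 4 * W * (real k / L ^ (J + 2))"
      by (simp add: mult_ac)
    \<comment> \<open>As 2/\<tau> = (N + 1)/k is bounded by a power of k depending on
      \<open>A\<close>, the logarithms in the lower tail are at most (A + 3) L each and cancel
      against \<open>L ^ (j + 1)\<close> up to one factor 1/L.\<close>
    have tail: "\<bar>integral {\<tau>..T} (C_integrand j) / L ^ (j + 1) - C_coeff j / L ^ (j + 1)\<bar>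
       \<le> (2 * (A + 3) ^ J * Cl j) * (real k / real (N + 1) / L) + (2 ^ (J + 1) * Ch j) * real k powr (-1/4)" if j: "j \<le> J" for j
    proof -
      have "\<bar>integral {\<tau>..T} (C_integrand j) / L ^ (j + 1) - C_coeff j / L ^ (j + 1)\<bar> = \<bar>(LBINT t:{0<..<\<tau>}. C_integrand j t) + (LBINT t:{T<..}. C_integrand j t)\<bar> / L ^ (j + 1)"
        using tT L0 integral_C_integrand_truncated(3)[OF tT(1), of T j] by (simp add: diff_divide_distrib[symmetric] abs_divide)
      also have "\<dots> \<le> (Cl j * \<tau> * (1 + ln (2 / \<tau>)) ^ j + Ch j / sqrt T) / L ^ (j + 1)"
        using Cl(2)[of \<tau> j] Ch(2)[of T j] tT L0 by (intro divide_right_mono order_trans[OF abs_triangle_ineq] add_mono) auto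
      also have "\<dots> = Cl j * \<tau> * ((1 + ln (2 / \<tau>)) ^ j / L ^ (j + 1)) + Ch j * (1 / sqrt T) * (1 / L ^ (j + 1))"
        by (simp add: add_divide_distrib)
      also have "\<dots> \<le> Cl j * \<tau> * ((A + 3) ^ J / L) + Ch j * real k powr (-1/4) * 2 ^ (J + 1)"
      proof (intro add_mono mult_mono)
        have "2 / \<tau> = real (N + 1) / real k" using k by (simp add: \<tau>_def field_simps)
        then have "ln (2 / \<tau>) \<le> ln (real (N + 1))" using k tT by (simp add: ln_div)
        then have "1 + ln (2 / \<tau>) \<le> (A + 3) * L" using lnN L by (simp add: distrib_right)
        moreover have "0 \<le> 1 + ln (2 / \<tau>)" using tT by simp
        ultimately have "(1 + ln (2 / \<tau>)) ^ j \<le> ((A + 3) * L) ^ j" by (intro power_mono) auto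
        then have "(1 + ln (2 / \<tau>)) ^ j / L ^ (j + 1) \<le> ((A + 3) * L) ^ j / L ^ (j + 1)"
          using L0 by (intro divide_right_mono) auto
        also have "\<dots> = (A + 3) ^ j / L" using L0 by (simp add: power_mult_distrib)
        also have "\<dots> \<le> (A + 3) ^ J / L" using j A L0 by (intro divide_right_mono power_increasing) auto
        finally show "(1 + ln (2 / \<tau>)) ^ j / L ^ (j + 1) \<le> (A + 3) ^ J / L" .
        have "real k powr (1/2) \<le> T"
        proof -
          have "real (M + 1) \<le> 2 * sqrt (real k)"
          proof -
            have "real M \<le> sqrt (real k)" using M(3) by (intro real_le_rsqrt) (simp flip: of_nat_power)
            moreover have "1 \<le> sqrt (real k)" using k by simp
            ultimately show ?thesis unfolding of_nat_add of_nat_1 by linarith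
          qed
          then have "sqrt (real k) * real (M + 1) \<le> sqrt (real k) * (2 * sqrt (real k))" by (intro mult_left_mono) auto
          also have "\<dots> = 2 * (sqrt (real k) * sqrt (real k))" by simp
          also have "\<dots> = 2 * real k" by simp
          finally show ?thesis by (simp add: T_def powr_half_sqrt pos_le_divide_eq mult_ac)
        qed
        then have "sqrt (real k powr (1/2)) \<le> sqrt T" by simp
        moreover have "sqrt (real k powr (1/2)) = real k powr (1/4)"
          by (simp add: powr_half_sqrt[symmetric] powr_powr)
        ultimately have "1 / sqrt T \<le> 1 / real k powr (1/4)" using k by (intro frac_le) auto
        then show "1 / sqrt T \<le> real k powr (-1/4)" by (simp add: powr_minus_divide)
        have "(1 / L) ^ (j + 1) \<le> 2 ^ (j + 1)" using L L0 by (intro power_mono) (auto simp: field_simps)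
        also have "\<dots> \<le> (2::real) ^ (J + 1)" using j by (intro power_increasing) auto
        finally show "1 / L ^ (j + 1) \<le> 2 ^ (J + 1)" by (simp add: power_one_over)
      qed (use Cl(1)[of j] Ch(1)[of j] tT L0 A in \<open>auto intro!: less_imp_le\<close>)
      also have "\<dots> = (2 * (A + 3) ^ J * Cl j) * (real k / real (N + 1) / L) + (2 ^ (J + 1) * Ch j) * real k powr (-1/4)"
        by (simp add: \<tau>_def)
      finally show ?thesis .
    qed
    have "\<bar>(\<Sum>j\<le>J. integral {\<tau>..T} (C_integrand j) / L ^ (j + 1)) - (\<Sum>j\<le>J. C_coeff j / L ^ (j + 1))\<bar>
       \<le> (\<Sum>j\<le>J. (2 * (A + 3) ^ J * Cl j) * (real k / real (N + 1) / L) + (2 ^ (J + 1) * Ch j) * real k powr (-1/4))"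
      unfolding sum_subtractf[symmetric] by (rule order_trans[OF sum_abs sum_mono]) (use tail in auto)
    also have "\<dots> = K2 / 2 * (real k / real (N + 1) / L) + K4 / 2 * real k powr (-1/4)"
      by (simp only: sum.distrib sum_distrib_right[symmetric] sum_distrib_left[symmetric] K2_def K4_def) simp
    finally have "2 * real k * \<bar>(\<Sum>j\<le>J. integral {\<tau>..T} (C_integrand j) / L ^ (j + 1)) - (\<Sum>j\<le>J. C_coeff j / L ^ (j + 1))\<bar>
       \<le> 2 * real k * (K2 / 2 * (real k / real (N + 1) / L) + K4 / 2 * real k powr (-1/4))"
      by (intro mult_left_mono) auto
    moreover have "2 * real k * \<bar>x - y\<bar> = \<bar>2 * real k * x - 2 * real k * y\<bar>" for x y :: real
      by (simp add: right_diff_distrib[symmetric] abs_mult)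
    moreover have "2 * a * (b / 2 * (a / n / l) + d / 2 * q) = b * (a\<^sup>2 / (n * l)) + d * (a * q)" for a b d n l q :: real
      by (simp add: power2_eq_square distrib_left)
    ultimately have Q5: "\<bar>2 * real k * (\<Sum>j\<le>J. integral {\<tau>..T} (C_integrand j) / L ^ (j + 1)) - 2 * real k * (\<Sum>j\<le>J. C_coeff j / L ^ (j + 1))\<bar>
       \<le> K2 * ((real k)\<^sup>2 / (real (N + 1) * L)) + K4 * (real k * real k powr (-1/4))"
      by (simp only:)
    have pos: "0 \<le> real k / L ^ (J + 2)" "0 \<le> real k / real M" "0 \<le> real k * real k powr (-1/4)" "1 \<le> real k / real M"
      using L0 M by auto
    \<comment> \<open>The constant 14 is 8 from \<open>Q2\<close> plus 6 from \<open>Q3\<close>; the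
      summand 16 of \<open>K1\<close> covers it as well as 8 R.\<close>
    have "K3 * X + 8 * R + 14 + 4 * W * X + K4 * S \<le> K1 * (X + 1 + R + S)" if "0 \<le> X" "0 \<le> R" "0 \<le> S" for X R S
    proof -
      have "0 \<le> K3 * 1 + K3 * R + K3 * S" "0 \<le> 16 * X + 16 * S + 8 * R" "0 \<le> W * 1 + W * R + W * S" "0 \<le> K4 * X + K4 * 1 + K4 * R"
        using that K W by (auto intro!: add_nonneg_nonneg mult_nonneg_nonneg)
      then show ?thesis unfolding K1_def by (simp add: distrib_left distrib_right)
    qed
    from this[OF pos(1-3)] show "\<bar>((\<Sum>p | prime p \<and> p \<in> {M<..k}. ln (bessel_I0 (2 * real k / real p)) - 2 * real k / real p)
        + (\<Sum>p | prime p \<and> p \<in> {k<..N}. ln (bessel_I0 (2 * real k / real p))))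
      - 2 * real k * (\<Sum>j\<le>J. C_coeff j / ln (real k) ^ (j + 1))\<bar>
      \<le> K1 * (real k / ln (real k) ^ (J + 2) + 1 + real k / real M + real k * real k powr (-1/4)) + K2 * ((real k)\<^sup>2 / (real (N + 1) * ln (real k)))"
      using Q1 Q2 Q3 Q4 Q5 unfolding L_def[symmetric] by linarith
  qed
qed

(* E is the O-term; its implied constant K depends on A and J only. *)
theorem proposition3p1:
  fixes A :: real and J :: nat
  assumes "A > 1"
  shows "\<exists>K. \<forall>(k::nat) (y::real). 2 \<le> k \<and> 2 * real k \<le> y \<and> y \<le> real k powr A \<longrightarrow>
    (\<exists>E. \<bar>E\<bar> \<le> K * (1 / ln (real k) ^ (J + 1) + real k / y) \<and>
      D_friable k y = (\<Prod>p | prime p \<and> p \<le> k. (1 - 1 / real p) powi (- 2 * int k)) *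
        exp (2 * real k / ln (real k) * ((\<Sum>j=0..J. C_coeff j / ln (real k) ^ j) + E)))"
proof -
  obtain K1 K2 :: real where K: "K1 \<ge> 0" "K2 \<ge> 0"
    and main: "\<And>(k::nat) (M::nat) (N::nat). k \<ge> 2 \<Longrightarrow> 1 \<le> M \<Longrightarrow> M < k \<Longrightarrow> M\<^sup>2 \<le> k \<Longrightarrow> k < (M + 1)\<^sup>2 \<Longrightarrow> 2 * k \<le> N \<Longrightarrow> real (N + 1) \<le> real k powr (A + 1) \<Longrightarrow>
     \<bar>((\<Sum>p | prime p \<and> p \<in> {M<..k}. ln (bessel_I0 (2 * real k / real p)) - 2 * real k / real p)
        + (\<Sum>p | prime p \<and> p \<in> {k<..N}. ln (bessel_I0 (2 * real k / real p))))
      - 2 * real k * (\<Sum>j\<le>J. C_coeff j / ln (real k) ^ (j + 1))\<bar>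
      \<le> K1 * (real k / ln (real k) ^ (J + 2) + 1 + real k / real M + real k * real k powr (-1/4)) + K2 * ((real k)\<^sup>2 / (real (N + 1) * ln (real k)))"
    by (rule prime_sums_expansion[OF assms, of J]) blast
  \<comment> \<open>A fourth root of k pays for J + 3 logarithms, so that both sqrt k log k and
    k^(3/4) are absorbed into k / (log k)^(J + 2).\<close>
  obtain Cs :: real where Cs: "Cs > 0" "\<And>r::real. r \<ge> 1 \<Longrightarrow> (1 + ln r) ^ (J + 3) \<le> Cs * r powr (1/4)"
    by (rule one_plus_ln_power_le_powr[of "1/4" "J + 3"]) (simp, blast)
  \<comment> \<open>11 = 3 + 8: 3 from the primes up to M and 8 from 4k/M <= 8 sqrt k. The factor of
    \<open>K1\<close> counts X itself and 1 + 2 + 1 multiples of Cs X.\<close>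
  define B where "B = 11 * Cs + K1 * (1 + 4 * Cs)"
  have B: "B \<ge> 0" using Cs K by (simp add: B_def)
  show ?thesis
  proof (rule exI[of _ "B + K2"], intro allI impI)
    fix k :: nat and y :: real
    assume asm: "2 \<le> k \<and> 2 * real k \<le> y \<and> y \<le> real k powr A"
    then have k: "k \<ge> 2" and y: "2 * real k \<le> y" "y \<le> real k powr A" by auto
    define L where "L = ln (real k)"
    have L: "L > 0" using k by (simp add: L_def)
    define N where "N = nat \<lfloor>y\<rfloor>"
    define M where "M = nat \<lfloor>sqrt (real k)\<rfloor>"
    have N1: "2 * k \<le> N" using y by (simp add: N_def le_nat_iff le_floor_iff)
    have "real N = of_int \<lfloor>y\<rfloor>" using y by (simp add: N_def)
    then have yN: "y \<le> real (N + 1)" "real N \<le> y" by linarith+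
    \<comment> \<open>Passing from y to N + 1 <= 2y costs one factor k >= 2, hence the exponent A +
      1.\<close>
    have N2: "real (N + 1) \<le> real k powr (A + 1)"
    proof -
      have "real (N + 1) \<le> 2 * y" using yN y k by simp
      also have "\<dots> \<le> real k * real k powr A" using k y by (intro mult_mono) auto
      finally show ?thesis using k by (simp add: powr_add mult.commute)
    qed
    have sq: "real M \<le> sqrt (real k)" "sqrt (real k) < real M + 1" by (simp_all add: M_def)
    have M1: "M \<ge> 1"
    proof -
      have "1 \<le> sqrt (real k)" using k by simp
      then show ?thesis by (simp add: M_def le_nat_iff le_floor_iff)
    qed
    have M2: "M\<^sup>2 \<le> k"
    proof -
      have "(real M)\<^sup>2 \<le> (sqrt (real k))\<^sup>2" using sq by (intro power_mono) auto
      then show ?thesis by (simp flip: of_nat_power)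
    qed
    have M3: "k < (M + 1)\<^sup>2"
    proof -
      have "(sqrt (real k))\<^sup>2 < (real M + 1)\<^sup>2" using sq by (intro power_strict_mono) auto
      then have "real k < real ((M + 1)\<^sup>2)" by (simp add: add.commute)
      then show ?thesis by (simp only: of_nat_less_iff)
    qed
    have M4: "M < k"
    proof (rule ccontr)
      assume "\<not> M < k"
      then have "k * k \<le> M\<^sup>2" unfolding power2_eq_square by (intro mult_le_mono) auto
      moreover have "2 * k \<le> k * k" using k by (intro mult_le_mono) auto
      ultimately show False using M2 k by linarith
    qed
    define F where "F = (\<Sum>p | prime p \<and> p \<in> {0<..N}. ln (local_factor k (1 / real p)))"
    define S where "S = (\<Sum>p | prime p \<and> p \<in> {0<..k}. ln (1 - 1 / real p))"
    define CC where "CC = (\<Sum>j\<le>J. C_coeff j / L ^ (j + 1))"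
    define R where "R = F + 2 * real k * S - 2 * real k * CC"
    define X where "X = real k / L ^ (J + 2)"
    have R1: "\<bar>R\<bar> \<le> (real M * ln (8 * real k) + 4 * real k / real M)
       + (K1 * (X + 1 + real k / real M + real k * real k powr (-1/4)) + K2 * ((real k)\<^sup>2 / (real (N + 1) * L)))"
      using main[OF k M1 M4 M2 M3 N1 N2] ln_local_factor_error[OF k M1, of N] M4 N1
      unfolding R_def F_def S_def CC_def X_def L_def by linarith
    have X_le: "Z \<le> Cs * X" if "Z * (1 + L) ^ (J + 2) \<le> Cs * real k" for Z
    proof (cases "Z \<ge> 0")
      case True
      have "Z * L ^ (J + 2) \<le> Z * (1 + L) ^ (J + 2)" using True L by (intro mult_left_mono power_mono) auto
      then have "Z * L ^ (J + 2) \<le> Cs * real k" using that by linarith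
      then show ?thesis using L by (simp add: X_def pos_le_divide_eq)
    next
      case False
      have "0 \<le> Cs * X" using Cs(1) L by (simp add: X_def)
      then show ?thesis using False by linarith
    qed
    have k14: "(1 + L) ^ (J + 3) \<le> Cs * real k powr (1/4)" using Cs(2)[of "real k"] k by (simp add: L_def)
    have X1: "sqrt (real k) * (1 + L) \<le> Cs * X"
    proof (rule X_le)
      have "sqrt (real k) * (1 + L) * (1 + L) ^ (J + 2) = sqrt (real k) * (1 + L) ^ (J + 3)"
        by (simp add: eval_nat_numeral mult_ac)
      also have "\<dots> \<le> real k powr (1/2) * (Cs * real k powr (1/4))"
        using k14 L by (intro mult_mono) (auto simp: powr_half_sqrt)
      also have "\<dots> = Cs * real k powr (3/4)" by (simp add: powr_add[symmetric])
      also have "\<dots> \<le> Cs * real k powr 1" using Cs(1) k by (intro mult_left_mono powr_mono) auto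
      finally show "sqrt (real k) * (1 + L) * (1 + L) ^ (J + 2) \<le> Cs * real k" using k by simp
    qed
    have X2: "real k * real k powr (-1/4) \<le> Cs * X"
    proof (rule X_le)
      have "(1 + L) ^ (J + 2) \<le> (1 + L) ^ (J + 3)" using L by (intro power_increasing) auto
      then have "real k * real k powr (-1/4) * (1 + L) ^ (J + 2) \<le> real k * real k powr (-1/4) * (Cs * real k powr (1/4))"
        using k14 by (intro mult_left_mono) auto
      also have "\<dots> = Cs * real k * (real k powr (-1/4) * real k powr (1/4))" by simp
      also have "real k powr (-1/4) * real k powr (1/4) = 1" using k by (simp add: powr_add[symmetric])
      finally show "real k * real k powr (-1/4) * (1 + L) ^ (J + 2) \<le> Cs * real k" by simp
    qed
    have sk: "1 \<le> sqrt (real k)" using k by simp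
    have "sqrt (real k) * 1 \<le> sqrt (real k) * (1 + L)" using L by (intro mult_left_mono) auto
    then have s1: "1 \<le> Cs * X" "sqrt (real k) \<le> Cs * X" using X1 sk by linarith+
    have kM: "real k / real M \<le> 2 * sqrt (real k)"
    proof -
      have "sqrt (real k) \<le> 2 * real M" using sq M1 by simp
      then have "sqrt (real k) * sqrt (real k) \<le> sqrt (real k) * (2 * real M)" by (intro mult_left_mono) auto
      then show ?thesis using M1 by (simp add: pos_divide_le_eq mult_ac)
    qed
    have l8: "real M * ln (8 * real k) \<le> 3 * (Cs * X)"
    proof -
      have "ln (8 * real k) = ln 8 + L" using k by (simp add: ln_mult L_def)
      also have "ln (8::real) = 3 * ln 2" using ln_realpow[of "2::real" 3] by simp
      also have "3 * ln 2 + L \<le> 3 * (1 + L)" using L ln_2_less_1 by simp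
      finally have "real M * ln (8 * real k) \<le> sqrt (real k) * (3 * (1 + L))"
        using sq k by (intro mult_mono) auto
      moreover have "sqrt (real k) * (3 * (1 + L)) = 3 * (sqrt (real k) * (1 + L))" by simp
      ultimately show ?thesis using X1 by linarith
    qed
    have V: "(real k)\<^sup>2 / (real (N + 1) * L) \<le> (real k)\<^sup>2 / (y * L)"
      using yN y k L by (intro divide_left_mono mult_right_mono mult_pos_pos) auto
    have R2: "\<bar>R\<bar> \<le> B * X + K2 * ((real k)\<^sup>2 / (y * L))"
    proof -
      have "X + 1 + real k / real M + real k * real k powr (-1/4) \<le> X + Cs * X + 2 * (Cs * X) + Cs * X"
        using s1 kM X2 by linarith
      then have "K1 * (X + 1 + real k / real M + real k * real k powr (-1/4)) \<le> K1 * (X + Cs * X + 2 * (Cs * X) + Cs * X)"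
        using K(1) by (rule mult_left_mono)
      moreover have "K2 * ((real k)\<^sup>2 / (real (N + 1) * L)) \<le> K2 * ((real k)\<^sup>2 / (y * L))"
        using V K(2) by (rule mult_left_mono)
      moreover have "4 * real k / real M \<le> 8 * (Cs * X)" using kM s1 by simp
      moreover have "B * X = 11 * (Cs * X) + K1 * (X + Cs * X + 2 * (Cs * X) + Cs * X)"
        by (simp add: B_def algebra_simps)
      ultimately show ?thesis using R1 l8 by linarith
    qed
    \<comment> \<open>Obtained by solving the asserted identity, R = (2k/L) E. The factor L/(2k)
      turns k / L^(J + 2) into 1 / L^(J + 1) and k^2 / (y L) into k/y, each up to the factor
      1/2.\<close>
    define E where "E = R * L / (2 * real k)"
    have "\<bar>E\<bar> \<le> (B + K2) * (1 / L ^ (J + 1) + real k / y)"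
    proof -
      have "\<bar>E\<bar> = \<bar>R\<bar> * (L / (2 * real k))" using L by (simp add: E_def abs_mult abs_divide)
      also have "\<dots> \<le> (B * X + K2 * ((real k)\<^sup>2 / (y * L))) * (L / (2 * real k))"
        using R2 L by (intro mult_right_mono) auto
      also have "\<dots> = B / 2 * (1 / L ^ (J + 1)) + K2 / 2 * (real k / y)"
        using L k y by (simp add: X_def field_simps power2_eq_square)
      also have "\<dots> \<le> (B + K2) * (1 / L ^ (J + 1)) + (B + K2) * (real k / y)"
        using B K L y k by (intro add_mono mult_right_mono) auto
      finally show ?thesis by (simp add: distrib_left)
    qed
    moreover have "D_friable k y = (\<Prod>p | prime p \<and> p \<le> k. (1 - 1 / real p) powi (- 2 * int k)) *
        exp (2 * real k / L * ((\<Sum>j=0..J. C_coeff j / L ^ j) + E))"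
    proof -
      have P: "{p::nat. prime p \<and> p \<le> n} = {p. prime p \<and> p \<in> {0<..n}}" for n
        by (auto dest: prime_gt_0_nat)
      have fin: "finite {p::nat. prime p \<and> p \<in> {0<..n}}" for n by (rule finite_subset[of _ "{..n}"]) auto
      have p2: "1 / real p \<le> 1 / 2" if "prime p" for p :: nat
        using prime_ge_2_nat[OF that] by (simp add: field_simps)
      have "D_friable k y = (\<Prod>p | prime p \<and> p \<in> {0<..N}. local_factor k (1 / real p))"
        using D_friable_eq_prod[of k y] k y unfolding N_def P by simp
      also have "\<dots> = exp F"
        unfolding F_def exp_sum[OF fin] using k p2
        by (intro prod.cong refl exp_ln[symmetric] ln_local_factor(1)) (auto dest: prime_ge_2_nat)
      finally have 1: "D_friable k y = exp F" .
      have "(\<Prod>p | prime p \<and> p \<le> k. (1 - 1 / real p) powi (- 2 * int k)) = (\<Prod>p | prime p \<and> p \<in> {0<..k}. exp (- (2 * real k * ln (1 - 1 / real p))))"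
        unfolding P
      proof (intro prod.cong refl)
        fix p assume "p \<in> {p. prime p \<and> p \<in> {0<..k}}"
        then have x: "1 - 1 / real p > 0" using p2[of p] by auto
        have "- 2 * int k = - int (2 * k)" by simp
        then have "(1 - 1 / real p) powi (- 2 * int k) = inverse ((1 - 1 / real p) ^ (2 * k))"
          by (simp only: power_int_minus power_int_of_nat)
        also have "(1 - 1 / real p) ^ (2 * k) = exp (real (2 * k) * ln (1 - 1 / real p))"
          using x by (simp only: exp_of_nat_mult exp_ln)
        finally show "(1 - 1 / real p) powi (- 2 * int k) = exp (- (2 * real k * ln (1 - 1 / real p)))"
          by (simp add: exp_minus)
      qed
      also have "\<dots> = exp (- (2 * real k * S))"
        unfolding S_def sum_distrib_left sum_negf[symmetric] exp_sum[OF fin] ..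
      finally have 2: "(\<Prod>p | prime p \<and> p \<le> k. (1 - 1 / real p) powi (- 2 * int k)) = exp (- (2 * real k * S))" .
      have 3: "(\<Sum>j=0..J. C_coeff j / L ^ j) = L * CC"
        using L by (simp add: CC_def sum_distrib_left atMost_atLeast0)
      have "2 * real k / L * (L * CC + E) = 2 * real k * CC + R"
        using L k by (simp add: E_def field_simps)
      then show ?thesis unfolding 1 2 3 by (simp add: R_def exp_add[symmetric])
    qed
    ultimately show "\<exists>E. \<bar>E\<bar> \<le> (B + K2) * (1 / ln (real k) ^ (J + 1) + real k / y) \<and>
      D_friable k y = (\<Prod>p | prime p \<and> p \<le> k. (1 - 1 / real p) powi (- 2 * int k)) *
        exp (2 * real k / ln (real k) * ((\<Sum>j=0..J. C_coeff j / ln (real k) ^ j) + E))"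
      unfolding L_def by blast
  qed
qed

end
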